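(* Let $f\colon M^m\to \mathbb{Q}_{k_1}^{n_1}\times \mathbb{Q}_{k_2}^{n_2}$ be an isometric immersion of a Riemannian manifold. Then the following assertions are equivalent: (i) $f$ reduces codimension on the left by $\ell$; (ii) there exists a vector subbundle $L$ of rank $\ell$ of the normal bundle $N_fM$ such that $L$ is parallel in the normal connection and $L\subset U\cap N_1^\perp$.
   Context: Manifolds are assumed connected. $\mathbb{Q}_k^n$ denotes, for $k\neq 0$, the hyperquadric $\{X\in\mathbb{R}^{n+1}_{\sigma(k)}:\langle X,X\rangle=1/k\}$ (a connected component of it if $k<0$), where $\sigma(k)=1$ if $k<0$, $\sigma(k)=0$ otherwise, and $\mathbb{R}^N_s$ is flat space of index $s$; $\mathbb{Q}_0^n=\mathbb{R}^n$. $f$ reduces codimension on the left by $\ell$ if there exist a totally geodesic inclusion (isometric embedding onto a totally geodesic submanifold) $j_1\colon\mathbb{Q}_{k_1}^{m_1}\to\mathbb{Q}_{k_1}^{n_1}$ with $n_1-m_1=\ell$ and an isometric immersion $\bar f\colon M^m\to\mathbb{Q}_{k_1}^{m_1}\times\mathbb{Q}_{k_2}^{n_2}$ such that $f=(j_1\times\mathrm{id})\circ\bar f$. Let $\pi_2$ be the orthogonal projection of $T(\mathbb{Q}_{k_1}^{n_1}\times\mathbb{Q}_{k_2}^{n_2})$ onto the subbundle tangent to the second factor. The tensor $T\colon N_fM\to N_fM$ is defined by letting $T\xi$ be the normal component of $\pi_2\xi$, for $\xi\in N_fM$. Put $U=\ker T$. $N_1(x)\subset N_fM(x)$ is the first normal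 space, spanned by the image of the second fundamental form of $f$ at $x$, and $N_1^\perp$ is its orthogonal complement in $N_fM$. $L$ parallel in the normal connection means $\nabla^\perp_X\xi\in L$ for all sections $\xi$ of $L$ and $X\in TM$. *)

theory Defs
  imports "HOL-Analysis.Analysis"
begin

section \<open>Smoothness\<close>

fun Ck_on :: "nat \<Rightarrow> 'a::real_normed_vector set \<Rightarrow> ('a \<Rightarrow> 'b::real_normed_vector) \<Rightarrow> bool" where
  "Ck_on 0 S h \<longleftrightarrow> continuous_on S h"
| "Ck_on (Suc n) S h \<longleftrightarrow>
     (\<forall>x\<in>S. h differentiable (at x)) \<and> (\<forall>v. Ck_on n S (\<lambda>x. frechet_derivative h (at x) v))"

text \<open>\<open>Ck_on\<close> is meant for open sets of a Euclidean space. On an arbitrary set, smooth means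
  locally the restriction of a \<open>C\<^sup>\<infinity>\<close> map defined on an open set of the surrounding space.\<close>

definition smooth_on :: "'a::real_normed_vector set \<Rightarrow> ('a \<Rightarrow> 'b::real_normed_vector) \<Rightarrow> bool" where
  "smooth_on S h \<longleftrightarrow>
     (\<forall>p\<in>S. \<exists>W H. open W \<and> p \<in> W \<and> (\<forall>n. Ck_on n W H) \<and> (\<forall>q\<in>S \<inter> W. h q = H q))"

section \<open>Connected Riemannian manifolds\<close>

text \<open>A chart \<open>(U, \<phi>)\<close> only matters through \<open>\<phi>\<close> on \<open>U\<close>; the dimension of the manifold is the
  dimension of the Euclidean space \<open>'c\<close>.\<close>

type_synonym ('a, 'c) chart = "'a set \<times> ('a \<Rightarrow> 'c)"

definition chart_inv :: "('a, 'c) chart \<Rightarrow> 'c \<Rightarrow> 'a" where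
  "chart_inv c = inv_into (fst c) (snd c)"

definition smooth_manifold ::
  "('a::{t2_space,second_countable_topology}, 'c::euclidean_space) chart set \<Rightarrow> bool" where
  "smooth_manifold A \<longleftrightarrow>
     connected (UNIV :: 'a set) \<and>
     \<Union>(fst ` A) = UNIV \<and>
     (\<forall>c\<in>A. open (fst c) \<and> open (snd c ` fst c) \<and>
        homeomorphism (fst c) (snd c ` fst c) (snd c) (chart_inv c)) \<and>
     (\<forall>c\<in>A. \<forall>d\<in>A. smooth_on (snd c ` (fst c \<inter> fst d)) (snd d \<circ> chart_inv c))"

definition smooth_map_on ::
  "('a::{t2_space,second_countable_topology}, 'c::euclidean_space) chart set \<Rightarrow> 'a set
     \<Rightarrow> ('a \<Rightarrow> 'e::real_normed_vector) \<Rightarrow> bool" where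
  "smooth_map_on A W h \<longleftrightarrow> (\<forall>c\<in>A. smooth_on (snd c ` (fst c \<inter> W)) (h \<circ> chart_inv c))"

text \<open>Tangent vectors of the manifold at \<open>x\<close> are given by their components \<open>v :: 'c\<close> in a chart
  around \<open>x\<close>; \<open>chart_deriv c h x v\<close> is the derivative of \<open>h\<close> at \<open>x\<close> along that vector.\<close>

definition chart_deriv ::
  "('a, 'c::euclidean_space) chart \<Rightarrow> ('a \<Rightarrow> 'e::real_normed_vector) \<Rightarrow> 'a \<Rightarrow> 'c \<Rightarrow> 'e" where
  "chart_deriv c h x v = frechet_derivative (h \<circ> chart_inv c) (at (snd c x)) v"

text \<open>\<open>g c x\<close> is the inner product of the tangent space at \<open>x\<close>, expressed in the chart \<open>c\<close>.\<close>

type_synonym ('a, 'c) metric = "('a, 'c) chart \<Rightarrow> 'a \<Rightarrow> 'c \<Rightarrow> 'c \<Rightarrow> real"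

definition riemannian_metric ::
  "('a::{t2_space,second_countable_topology}, 'c::euclidean_space) chart set
     \<Rightarrow> ('a, 'c) metric \<Rightarrow> bool" where
  "riemannian_metric A g \<longleftrightarrow>
     (\<forall>c\<in>A. \<forall>x\<in>fst c. bilinear (g c x) \<and> (\<forall>v w. g c x v w = g c x w v) \<and>
        (\<forall>v. v \<noteq> 0 \<longrightarrow> g c x v v > 0)) \<and>
     (\<forall>c\<in>A. \<forall>v w. smooth_on (snd c ` fst c) (\<lambda>u. g c (chart_inv c u) v w)) \<and>
     (\<forall>c\<in>A. \<forall>d\<in>A. \<forall>x\<in>fst c \<inter> fst d. \<forall>v w.
        g c x v w = g d x (chart_deriv c (snd d) x v) (chart_deriv c (snd d) x w))"

definition riemannian_manifold ::
  "('a::{t2_space,second_countable_topology}, 'c::euclidean_space) chart set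
     \<Rightarrow> ('a, 'c) metric \<Rightarrow> bool" where
  "riemannian_manifold A g \<longleftrightarrow> smooth_manifold A \<and> riemannian_metric A g"

section \<open>Submanifolds of flat space\<close>

text \<open>Throughout, \<open>b\<close> is the (possibly indefinite) scalar product of a flat space, and \<open>S\<close> is a
  submanifold on whose tangent spaces \<open>b\<close> is positive definite.\<close>

definition tangent_space :: "'e::real_normed_vector set \<Rightarrow> 'e \<Rightarrow> 'e set" where
  "tangent_space S p =
     {v. \<exists>\<gamma> :: real \<Rightarrow> 'e. range \<gamma> \<subseteq> S \<and> \<gamma> 0 = p \<and> (\<gamma> has_vector_derivative v) (at 0)}"

definition orth_proj ::
  "('e \<Rightarrow> 'e \<Rightarrow> real) \<Rightarrow> 'e::real_vector set \<Rightarrow> 'e \<Rightarrow> 'e" where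
  "orth_proj b V v = (THE w. w \<in> V \<and> (\<forall>u\<in>V. b (v - w) u = 0))"

text \<open>Injectivity of the differential is not listed: it follows from positive definiteness
  of \<open>g\<close>.\<close>

definition isometric_immersion ::
  "('a::{t2_space,second_countable_topology}, 'c::euclidean_space) chart set
     \<Rightarrow> ('a, 'c) metric \<Rightarrow> ('e \<Rightarrow> 'e \<Rightarrow> real) \<Rightarrow> 'e::real_normed_vector set
     \<Rightarrow> ('a \<Rightarrow> 'e) \<Rightarrow> bool" where
  "isometric_immersion A g b S f \<longleftrightarrow>
     range f \<subseteq> S \<and> smooth_map_on A UNIV f \<and>
     (\<forall>c\<in>A. \<forall>x\<in>fst c. \<forall>v w. b (chart_deriv c f x v) (chart_deriv c f x w) = g c x v w)"

definition normal_space ::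
  "('a, 'c::euclidean_space) chart set \<Rightarrow> ('e \<Rightarrow> 'e \<Rightarrow> real) \<Rightarrow> 'e::real_normed_vector set
     \<Rightarrow> ('a \<Rightarrow> 'e) \<Rightarrow> 'a \<Rightarrow> 'e set" where
  "normal_space A b S f x =
     {\<xi> \<in> tangent_space S (f x). \<forall>c\<in>A. x \<in> fst c \<longrightarrow> (\<forall>v. b \<xi> (chart_deriv c f x v) = 0)}"

text \<open>The Levi-Civita connection of \<open>S\<close> is the tangential part of the flat derivative. Hence the
  normal component of a covariant derivative in \<open>S\<close> is the projection to the normal space of the
  flat derivative. In the second fundamental form, \<open>v\<close> and \<open>w\<close> are extended to coordinate fields.\<close>

definition second_ff ::
  "('a, 'c::euclidean_space) chart set \<Rightarrow> ('e \<Rightarrow> 'e \<Rightarrow> real) \<Rightarrow> 'e::real_normed_vector set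
     \<Rightarrow> ('a \<Rightarrow> 'e) \<Rightarrow> ('a, 'c) chart \<Rightarrow> 'a \<Rightarrow> 'c \<Rightarrow> 'c \<Rightarrow> 'e" where
  "second_ff A b S f c x v w =
     orth_proj b (normal_space A b S f x) (chart_deriv c (\<lambda>y. chart_deriv c f y w) x v)"

definition normal_deriv ::
  "('a, 'c::euclidean_space) chart set \<Rightarrow> ('e \<Rightarrow> 'e \<Rightarrow> real) \<Rightarrow> 'e::real_normed_vector set
     \<Rightarrow> ('a \<Rightarrow> 'e) \<Rightarrow> ('a, 'c) chart \<Rightarrow> ('a \<Rightarrow> 'e) \<Rightarrow> 'a \<Rightarrow> 'c \<Rightarrow> 'e" where
  "normal_deriv A b S f c \<xi> x v =
     orth_proj b (normal_space A b S f x) (chart_deriv c \<xi> x v)"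

definition first_normal_space ::
  "('a, 'c::euclidean_space) chart set \<Rightarrow> ('e \<Rightarrow> 'e \<Rightarrow> real) \<Rightarrow> 'e::real_normed_vector set
     \<Rightarrow> ('a \<Rightarrow> 'e) \<Rightarrow> 'a \<Rightarrow> 'e set" where
  "first_normal_space A b S f x =
     span {second_ff A b S f c x v w | c v w. c \<in> A \<and> x \<in> fst c}"

definition first_normal_perp ::
  "('a, 'c::euclidean_space) chart set \<Rightarrow> ('e \<Rightarrow> 'e \<Rightarrow> real) \<Rightarrow> 'e::real_normed_vector set
     \<Rightarrow> ('a \<Rightarrow> 'e) \<Rightarrow> 'a \<Rightarrow> 'e set" where
  "first_normal_perp A b S f x =
     {\<xi> \<in> normal_space A b S f x. \<forall>\<eta>\<in>first_normal_space A b S f x. b \<xi> \<eta> = 0}"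

definition normal_subbundle ::
  "('a::{t2_space,second_countable_topology}, 'c::euclidean_space) chart set
     \<Rightarrow> ('e \<Rightarrow> 'e \<Rightarrow> real) \<Rightarrow> 'e::euclidean_space set \<Rightarrow> ('a \<Rightarrow> 'e) \<Rightarrow> nat \<Rightarrow> ('a \<Rightarrow> 'e set) \<Rightarrow> bool"
  where
  "normal_subbundle A b S f l L \<longleftrightarrow>
     (\<forall>x. L x \<subseteq> normal_space A b S f x \<and> dim (L x) = l) \<and>
     (\<forall>x. \<exists>W (e :: nat \<Rightarrow> 'a \<Rightarrow> 'e). open W \<and> x \<in> W \<and> (\<forall>i<l. smooth_map_on A W (e i)) \<and>
        (\<forall>y\<in>W. L y = span ((\<lambda>i. e i y) ` {..<l})))"

text \<open>Sections are smooth and may be defined on an open subset \<open>W\<close> only.\<close>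

definition parallel_normal ::
  "('a::{t2_space,second_countable_topology}, 'c::euclidean_space) chart set
     \<Rightarrow> ('e \<Rightarrow> 'e \<Rightarrow> real) \<Rightarrow> 'e::real_normed_vector set \<Rightarrow> ('a \<Rightarrow> 'e) \<Rightarrow> ('a \<Rightarrow> 'e set) \<Rightarrow> bool"
  where
  "parallel_normal A b S f L \<longleftrightarrow>
     (\<forall>W \<xi>. open W \<longrightarrow> smooth_map_on A W \<xi> \<longrightarrow> (\<forall>y\<in>W. \<xi> y \<in> L y) \<longrightarrow>
        (\<forall>c\<in>A. \<forall>x\<in>fst c \<inter> W. \<forall>v. normal_deriv A b S f c \<xi> x v \<in> L x))"

section \<open>Maps between submanifolds\<close>

text \<open>The derivative within \<open>S\<close> is determined only on \<open>tangent_space S p\<close>, so it is applied to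
  tangent vectors only. There it is the differential of \<open>j\<close>.\<close>

definition isometric_embedding ::
  "('d \<Rightarrow> 'd \<Rightarrow> real) \<Rightarrow> 'd::real_normed_vector set
     \<Rightarrow> ('e \<Rightarrow> 'e \<Rightarrow> real) \<Rightarrow> 'e::real_normed_vector set \<Rightarrow> ('d \<Rightarrow> 'e) \<Rightarrow> bool" where
  "isometric_embedding b S b' S' j \<longleftrightarrow>
     j ` S \<subseteq> S' \<and> smooth_on S j \<and> homeomorphism S (j ` S) j (inv_into S j) \<and>
     (\<forall>p\<in>S. \<forall>v\<in>tangent_space S p. \<forall>w\<in>tangent_space S p.
        b' (frechet_derivative j (at p within S) v) (frechet_derivative j (at p within S) w) = b v w)"

text \<open>The second fundamental form vanishes: for a vector \<open>X\<close> and a vector field \<open>Y\<close> tangent to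
  \<open>S\<close>, the derivative of \<open>dj Y\<close> along \<open>X\<close> has no component in the normal space of \<open>j\<close>.\<close>

definition totally_geodesic ::
  "'d::real_normed_vector set \<Rightarrow> ('e \<Rightarrow> 'e \<Rightarrow> real) \<Rightarrow> 'e::real_normed_vector set
     \<Rightarrow> ('d \<Rightarrow> 'e) \<Rightarrow> bool" where
  "totally_geodesic S b' S' j \<longleftrightarrow>
     (\<forall>Y. smooth_on S Y \<longrightarrow> (\<forall>q\<in>S. Y q \<in> tangent_space S q) \<longrightarrow>
       (\<forall>p\<in>S. \<forall>X\<in>tangent_space S p.
          orth_proj b'
            {\<xi> \<in> tangent_space S' (j p).
               \<forall>v\<in>tangent_space S p. b' \<xi> (frechet_derivative j (at p within S) v) = 0}
            (frechet_derivative (\<lambda>q. frechet_derivative j (at q within S) (Y q)) (at p within S) X)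
          = 0))"

section \<open>Products of two space forms\<close>

definition flat_form :: "real \<Rightarrow> real \<times> 'e::euclidean_space \<Rightarrow> real \<times> 'e \<Rightarrow> real" where
  "flat_form k X Y = (if k < 0 then -1 else 1) * (fst X * fst Y) + snd X \<bullet> snd Y"

text \<open>For \<open>B \<subseteq> Basis\<close>, \<open>hyperquadric k B\<close> is the space form of curvature \<open>k\<close> and dimension
  \<open>card B\<close>, contained in \<open>\<real> \<times> span B\<close>, where \<open>span B\<close> serves as \<open>\<real>\<^sup>m\<close> with \<open>m = card B\<close>. This
  makes the dimension a term, so that it can be quantified. Euclidean space (\<open>k = 0\<close>) is identified
  with \<open>{0} \<times> span B\<close>. For \<open>k < 0\<close> the component is the upper sheet.\<close>

definition hyperquadric :: "real \<Rightarrow> 'e::euclidean_space set \<Rightarrow> (real \<times> 'e) set" where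
  "hyperquadric k B =
     {X. snd X \<in> span B \<and>
         (if k = 0 then fst X = 0
          else flat_form k X X = 1 / k \<and> (k < 0 \<longrightarrow> fst X > 0))}"

type_synonym ('e1, 'e2) flat_product = "(real \<times> 'e1) \<times> (real \<times> 'e2)"

definition prod_form ::
  "real \<Rightarrow> real \<Rightarrow> ('e1::euclidean_space, 'e2::euclidean_space) flat_product
     \<Rightarrow> ('e1, 'e2) flat_product \<Rightarrow> real" where
  "prod_form k1 k2 X Y = flat_form k1 (fst X) (fst Y) + flat_form k2 (snd X) (snd Y)"

definition space_form_product ::
  "real \<Rightarrow> real \<Rightarrow> ('e1::euclidean_space, 'e2::euclidean_space) flat_product set" where
  "space_form_product k1 k2 = hyperquadric k1 Basis \<times> hyperquadric k2 Basis"

definition reduces_codim_left ::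
  "('a::{t2_space,second_countable_topology}, 'c::euclidean_space) chart set
     \<Rightarrow> ('a, 'c) metric \<Rightarrow> real \<Rightarrow> real
     \<Rightarrow> ('a \<Rightarrow> ('e1::euclidean_space, 'e2::euclidean_space) flat_product) \<Rightarrow> nat \<Rightarrow> bool" where
  "reduces_codim_left A g k1 k2 f l \<longleftrightarrow>
     (\<exists>(B :: 'e1 set) (j1 :: real \<times> 'e1 \<Rightarrow> real \<times> 'e1) fbar.
        B \<subseteq> Basis \<and> card B + l = DIM('e1) \<and>
        isometric_embedding (flat_form k1) (hyperquadric k1 B)
          (flat_form k1) (hyperquadric k1 Basis) j1 \<and>
        totally_geodesic (hyperquadric k1 B) (flat_form k1) (hyperquadric k1 Basis) j1 \<and>
        isometric_immersion A g (prod_form k1 k2)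
          (hyperquadric k1 B \<times> hyperquadric k2 (Basis :: 'e2 set)) fbar \<and>
        f = map_prod j1 id \<circ> fbar)"

definition pi2 ::
  "real \<Rightarrow> real \<Rightarrow> ('e1::euclidean_space, 'e2::euclidean_space) flat_product
     \<Rightarrow> ('e1, 'e2) flat_product \<Rightarrow> ('e1, 'e2) flat_product" where
  "pi2 k1 k2 p =
     orth_proj (prod_form k1 k2) ({0} \<times> tangent_space (hyperquadric k2 Basis) (snd p))"

definition tensor_T ::
  "('a, 'c::euclidean_space) chart set \<Rightarrow> real \<Rightarrow> real
     \<Rightarrow> ('a \<Rightarrow> ('e1::euclidean_space, 'e2::euclidean_space) flat_product) \<Rightarrow> 'a
     \<Rightarrow> ('e1, 'e2) flat_product \<Rightarrow> ('e1, 'e2) flat_product" where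
  "tensor_T A k1 k2 f x \<xi> =
     orth_proj (prod_form k1 k2)
       (normal_space A (prod_form k1 k2) (space_form_product k1 k2) f x) (pi2 k1 k2 (f x) \<xi>)"

definition kernel_T ::
  "('a, 'c::euclidean_space) chart set \<Rightarrow> real \<Rightarrow> real
     \<Rightarrow> ('a \<Rightarrow> ('e1::euclidean_space, 'e2::euclidean_space) flat_product) \<Rightarrow> 'a
     \<Rightarrow> ('e1, 'e2) flat_product set" where
  "kernel_T A k1 k2 f x =
     {\<xi> \<in> normal_space A (prod_form k1 k2) (space_form_product k1 k2) f x.
        tensor_T A k1 k2 f x \<xi> = 0}"

end

theory Submission
  imports Defs
begin

text \<open>Both implications rest on one fact: a smooth family of subspaces of a vector space that contains
  the derivatives of its own sections is locally constant, hence constant on a connected manifold.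

  (i) implies (ii): along the totally geodesic inclusion \<open>j\<^sub>1\<close>, the span of the image of the
  differential and of the normal vector of the ambient hyperquadric is such a family, so it is one
  fixed subspace \<open>V\<close>. Then \<open>L = V\<^sup>\<bottom> \<times> 0\<close> is a constant subbundle with the required properties.

  (ii) implies (i): \<open>L \<subseteq> U\<close> says that \<open>L\<close> is tangent to the first factor, and together with
  \<open>L \<subseteq> N\<^sub>1\<^sup>\<bottom>\<close> it makes the derivative of a section of \<open>L\<close> in flat space equal to its normal covariant
  derivative. So \<open>L = D \<times> 0\<close> is constant in flat space, and the first component of \<open>f\<close> stays in the
  linear (for \<open>k\<^sub>1 = 0\<close>, affine) space orthogonal to \<open>D\<close>, whose intersection with the hyperquadric is
  the image of a lower dimensional one under a linear isometry.\<close>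

section \<open>Calculus of iterated differentiability\<close>

text \<open>The ambient form is Lorentzian when the curvature is negative, so it cannot measure how
  far two subspaces are apart. Constancy of a family of subspaces is therefore tested with the
  Euclidean inner product, by a mean value estimate in place of parallel transport along curves. The
  form itself serves for projections, but only on subspaces where it is positive definite, such as
  tangent and normal spaces. The normal vector is adjoined because the flat derivative of a field
  tangent to a hyperquadric may have a component along it, while total geodesy controls only the
  part tangent to the hyperquadric. The enlarged space is followed along the manifold, through
  \<open>fbar\<close>, and not on the smaller hyperquadric: connectedness is given for the manifold,
  whereas for \<open>B = {}\<close> and positive curvature \<open>hyperquadric k B\<close> consists
  of two points. A map known only on a hyperquadric has no full derivative there. Its differential
  is determined on velocities of curves in the set, so such computations pass to a smooth local
  extension and are evaluated on tangent vectors.\<close>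

lemma Ck_on_cong:
  assumes "open S" "\<And>x. x \<in> S \<Longrightarrow> h x = h' x" "Ck_on n S h"
  shows "Ck_on n S h'"
  using assms(2,3)
proof (induction n arbitrary: h h')
  case 0
  then show ?case using continuous_on_cong by force
next
  case (Suc n)
  have d: "h differentiable (at x)" if "x \<in> S" for x
    using Suc.prems(2) that by simp
  have fd: "frechet_derivative h (at x) = frechet_derivative h' (at x)" if "x \<in> S" for x
    using frechet_derivative_transform_within_open[OF d[OF that] assms(1) that] Suc.prems(1) by blast
  have d': "h' differentiable (at x)" if "x \<in> S" for x
  proof -
    have "(h has_derivative frechet_derivative h (at x)) (at x)"
      using d[OF that] frechet_derivative_works by blast
    then have "(h' has_derivative frechet_derivative h (at x)) (at x)"
      by (rule has_derivative_transform_within_open[OF _ assms(1) that]) (use Suc.prems(1) in auto)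
    then show ?thesis unfolding differentiable_def by blast
  qed
  have "Ck_on n S (\<lambda>x. frechet_derivative h' (at x) v)" for v
    by (rule Suc.IH[of "\<lambda>x. frechet_derivative h (at x) v"]) (use Suc.prems(2) fd in auto)
  with d' show ?case by simp
qed

lemma Ck_on_subset: "T \<subseteq> S \<Longrightarrow> Ck_on n S h \<Longrightarrow> Ck_on n T h"
proof (induction n arbitrary: h)
  case 0
  then show ?case using continuous_on_subset by auto
qed auto

lemma Ck_on_SucD: "Ck_on (Suc n) S h \<Longrightarrow> Ck_on n S h"
proof (induction n arbitrary: h)
  case 0
  then show ?case
    by (auto intro!: continuous_at_imp_continuous_on differentiable_imp_continuous_within)
next
  case (Suc n)
  then show ?case by (metis Ck_on.simps(2))
qed

lemma Ck_on_local:
  assumes "\<And>x. x \<in> S \<Longrightarrow> \<exists>W. open W \<and> x \<in> W \<and> Ck_on n W h"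
  shows "Ck_on n S h"
  using assms
proof (induction n arbitrary: h)
  case 0
  have "continuous (at x) h" if "x \<in> S" for x
    using 0[OF that] continuous_on_eq_continuous_at by auto
  then show ?case by (auto intro: continuous_at_imp_continuous_on)
next
  case (Suc n)
  have "h differentiable (at x)" if "x \<in> S" for x
    using Suc.prems[OF that] by auto
  moreover have "Ck_on n S (\<lambda>x. frechet_derivative h (at x) v)" for v
    by (rule Suc.IH) (use Suc.prems in fastforce)
  ultimately show ?case by simp
qed

text \<open>Near a point of an open set the local extension coincides with the map on a full
  neighbourhood, so it hands over its differentiability.\<close>

lemma smooth_on_openD:
  assumes "open S" "smooth_on S h"
  shows "Ck_on n S h"
proof (rule Ck_on_local)
  fix x assume x: "x \<in> S"
  obtain W H where W: "open W" "x \<in> W" "\<And>n. Ck_on n W H" "\<And>q. q \<in> S \<inter> W \<Longrightarrow> h q = H q"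
    using assms(2) x unfolding smooth_on_def by metis
  have "Ck_on n (S \<inter> W) h"
    by (rule Ck_on_cong[of _ H]) (use W assms Ck_on_subset[of "S \<inter> W" W] in auto)
  with W x assms show "\<exists>W. open W \<and> x \<in> W \<and> Ck_on n W h"
    by (intro exI[of _ "S \<inter> W"]) auto
qed

lemma smooth_onI: "(\<And>n. Ck_on n UNIV h) \<Longrightarrow> smooth_on S h"
  unfolding smooth_on_def by blast

lemma frechet_derivative_apply:
  "(h has_derivative h') (at x) \<Longrightarrow> frechet_derivative h (at x) v = h' v"
  using frechet_derivative_at by metis

lemma Ck_on_has_derivative:
  "Ck_on (Suc n) S h \<Longrightarrow> x \<in> S \<Longrightarrow> (h has_derivative frechet_derivative h (at x)) (at x)"
  using frechet_derivative_works by auto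

lemma Ck_on_const: "Ck_on n S (\<lambda>x. c)"
  by (induction n arbitrary: c) auto

lemma Ck_on_ident: "Ck_on n S (\<lambda>x. x)"
  by (cases n) (auto simp: Ck_on_const)

lemma Ck_on_bounded_linear:
  assumes T: "bounded_linear T" and "open S" "Ck_on n S h"
  shows "Ck_on n S (\<lambda>x. T (h x))"
  using assms(3)
proof (induction n arbitrary: h)
  case 0
  then show ?case using bounded_linear.continuous_on[OF T] by auto
next
  case (Suc n)
  have D: "((\<lambda>x. T (h x)) has_derivative (\<lambda>v. T (frechet_derivative h (at x) v))) (at x)"
    if "x \<in> S" for x
    by (rule bounded_linear.has_derivative[OF T Ck_on_has_derivative[OF Suc.prems that]])
  have "Ck_on n S (\<lambda>x. frechet_derivative (\<lambda>x. T (h x)) (at x) v)" for v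
    by (rule Ck_on_cong[OF assms(2), of "\<lambda>x. T (frechet_derivative h (at x) v)"])
      (use Suc in \<open>auto simp: frechet_derivative_apply[OF D]\<close>)
  moreover have "(\<lambda>x. T (h x)) differentiable (at x)" if "x \<in> S" for x
    using D[OF that] unfolding differentiable_def by blast
  ultimately show ?case by simp
qed

lemma Ck_on_add:
  assumes "open S" "Ck_on n S h" "Ck_on n S h'"
  shows "Ck_on n S (\<lambda>x. h x + h' x)"
  using assms(2,3)
proof (induction n arbitrary: h h')
  case 0
  then show ?case by (auto intro: continuous_on_add)
next
  case (Suc n)
  have D: "((\<lambda>x. h x + h' x) has_derivative
      (\<lambda>v. frechet_derivative h (at x) v + frechet_derivative h' (at x) v)) (at x)"
    if "x \<in> S" for x
    by (intro has_derivative_add Ck_on_has_derivative[OF Suc.prems(1) that]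
        Ck_on_has_derivative[OF Suc.prems(2) that])
  have "Ck_on n S (\<lambda>x. frechet_derivative (\<lambda>x. h x + h' x) (at x) v)" for v
    by (rule Ck_on_cong[OF assms(1),
        of "\<lambda>x. frechet_derivative h (at x) v + frechet_derivative h' (at x) v"])
      (use Suc in \<open>auto simp: frechet_derivative_apply[OF D]\<close>)
  moreover have "(\<lambda>x. h x + h' x) differentiable (at x)" if "x \<in> S" for x
    using D[OF that] unfolding differentiable_def by blast
  ultimately show ?case by simp
qed

lemma Ck_on_sum:
  assumes "open S" "\<And>i. i \<in> I \<Longrightarrow> Ck_on n S (h i)"
  shows "Ck_on n S (\<lambda>x. \<Sum>i\<in>I. h i x)"
proof (cases "finite I")
  case True
  then show ?thesis using assms(2)
    by (induction I) (auto simp: Ck_on_const intro!: Ck_on_add[OF assms(1)])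
qed (simp add: Ck_on_const)

lemma Ck_on_scaleR:
  fixes h :: "'a::real_normed_vector \<Rightarrow> real"
  assumes "open S" "Ck_on n S h" "Ck_on n S h'"
  shows "Ck_on n S (\<lambda>x. h x *\<^sub>R h' x)"
  using assms(2,3)
proof (induction n arbitrary: h h')
  case 0
  then show ?case by (auto intro: continuous_on_scaleR)
next
  case (Suc n)
  have D: "((\<lambda>x. h x *\<^sub>R h' x) has_derivative
      (\<lambda>v. h x *\<^sub>R frechet_derivative h' (at x) v + frechet_derivative h (at x) v *\<^sub>R h' x)) (at x)"
    if "x \<in> S" for x
    by (intro has_derivative_scaleR Ck_on_has_derivative[OF Suc.prems(1) that]
        Ck_on_has_derivative[OF Suc.prems(2) that])
  have "Ck_on n S (\<lambda>x. frechet_derivative (\<lambda>x. h x *\<^sub>R h' x) (at x) v)" for v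
  proof (rule Ck_on_cong[OF assms(1)])
    show "Ck_on n S (\<lambda>x. h x *\<^sub>R frechet_derivative h' (at x) v + frechet_derivative h (at x) v *\<^sub>R h' x)"
      using Suc.prems Ck_on_SucD[OF Suc.prems(1)] Ck_on_SucD[OF Suc.prems(2)]
      by (intro Ck_on_add[OF assms(1)] Suc.IH) auto
  qed (simp add: frechet_derivative_apply[OF D])
  moreover have "(\<lambda>x. h x *\<^sub>R h' x) differentiable (at x)" if "x \<in> S" for x
    using D[OF that] unfolding differentiable_def by blast
  ultimately show ?case by simp
qed

lemma frechet_derivative_euclidean:
  fixes h :: "'a::euclidean_space \<Rightarrow> 'b::real_normed_vector"
  assumes "h differentiable (at x)"
  shows "frechet_derivative h (at x) v = (\<Sum>i\<in>Basis. (v \<bullet> i) *\<^sub>R frechet_derivative h (at x) i)"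
proof -
  have lin: "linear (frechet_derivative h (at x))"
    by (rule linear_frechet_derivative[OF assms])
  have "frechet_derivative h (at x) v = frechet_derivative h (at x) (\<Sum>i\<in>Basis. (v \<bullet> i) *\<^sub>R i)"
    by (simp add: euclidean_representation)
  then show ?thesis by (simp only: linear_sum[OF lin] linear_scale[OF lin])
qed

text \<open>\<open>Ck_on\<close> differentiates in one fixed direction, but the chain rule takes the
  derivative of \<open>k\<close> in a direction that moves with \<open>x\<close>. Expanding that
  direction along \<open>Basis\<close> leaves products of scalar functions with derivatives in fixed
  directions, to which the induction hypothesis applies.\<close>

lemma Ck_on_compose:
  fixes h :: "'a::real_normed_vector \<Rightarrow> 'b::euclidean_space"
    and k :: "'b \<Rightarrow> 'c::real_normed_vector"
  assumes "open S" "open W" "h ` S \<subseteq> W" "Ck_on n S h" "Ck_on n W k"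
  shows "Ck_on n S (\<lambda>x. k (h x))"
  using assms(4,5)
proof (induction n arbitrary: k)
  case 0
  then show ?case using continuous_on_compose2[of W k S h] assms(3) by auto
next
  case (Suc n)
  have D: "((\<lambda>x. k (h x)) has_derivative
      (\<lambda>v. frechet_derivative k (at (h x)) (frechet_derivative h (at x) v))) (at x)"
    if "x \<in> S" for x
    using that assms(3)
    by (intro has_derivative_compose[of h _ x UNIV k] Ck_on_has_derivative[OF Suc.prems(1)]
        Ck_on_has_derivative[OF Suc.prems(2)]) auto
  have "Ck_on n S (\<lambda>x. frechet_derivative (\<lambda>x. k (h x)) (at x) v)" for v
  proof (rule Ck_on_cong[OF assms(1)])
    show "Ck_on n S (\<lambda>x. \<Sum>i\<in>Basis. (frechet_derivative h (at x) v \<bullet> i) *\<^sub>R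
            frechet_derivative k (at (h x)) i)"
      using Suc.prems Ck_on_SucD[OF Suc.prems(1)]
      by (intro Ck_on_sum Ck_on_scaleR assms(1) Suc.IH Ck_on_bounded_linear[of "\<lambda>x. x \<bullet> _"])
        (auto simp: bounded_linear_inner_left)
    fix x assume x: "x \<in> S"
    have "k differentiable (at (h x))" using Suc.prems(2) x assms(3) by auto
    from frechet_derivative_euclidean[OF this]
    show "(\<Sum>i\<in>Basis. (frechet_derivative h (at x) v \<bullet> i) *\<^sub>R frechet_derivative k (at (h x)) i) =
         frechet_derivative (\<lambda>x. k (h x)) (at x) v"
      using frechet_derivative_at[OF D[OF x]] by metis
  qed
  moreover have "(\<lambda>x. k (h x)) differentiable (at x)" if "x \<in> S" for x
    using D[OF that] unfolding differentiable_def by blast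
  ultimately show ?case by simp
qed

text \<open>Continuity is available for one direction at a time. The finitely many directions of
  \<open>Basis\<close> are bounded on a compact ball, and linearity combines their bounds into one
  that is uniform in \<open>v\<close>.\<close>

lemma Ck_on_derivative_bound:
  fixes h :: "'a::euclidean_space \<Rightarrow> 'b::real_normed_vector"
  assumes "open S" "Ck_on (Suc 0) S h" "x \<in> S"
  obtains r C where "r > 0" "cball x r \<subseteq> S" "C \<ge> 0"
    "\<And>y v. y \<in> cball x r \<Longrightarrow> norm (frechet_derivative h (at y) v) \<le> C * norm v"
proof -
  obtain r where r: "r > 0" "cball x r \<subseteq> S"
    using assms open_contains_cball by blast
  have "\<exists>B. \<forall>y\<in>cball x r. norm (frechet_derivative h (at y) i) \<le> B" for i
  proof -
    have "continuous_on (cball x r) (\<lambda>y. frechet_derivative h (at y) i)"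
      using assms(2) by (intro continuous_on_subset[OF _ r(2)]) simp
    then have "bounded ((\<lambda>y. frechet_derivative h (at y) i) ` cball x r)"
      using compact_imp_bounded compact_continuous_image compact_cball by blast
    then show ?thesis unfolding bounded_iff by auto
  qed
  then obtain B where B: "\<And>i y. y \<in> cball x r \<Longrightarrow> norm (frechet_derivative h (at y) i) \<le> B i"
    by metis
  have Bpos: "B i \<ge> 0" for i using B[of x i] norm_ge_zero r(1) order_trans
    by (metis centre_in_cball less_imp_le)
  show ?thesis
  proof (rule that[OF r(1,2)])
    show "(\<Sum>i\<in>Basis. B i) \<ge> 0" by (simp add: sum_nonneg Bpos)
    fix y v assume y: "y \<in> cball x r"
    have "h differentiable (at y)" using assms(2) r(2) y by auto
    then have "norm (frechet_derivative h (at y) v)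
        = norm (\<Sum>i\<in>Basis. (v \<bullet> i) *\<^sub>R frechet_derivative h (at y) i)"
      using frechet_derivative_euclidean by metis
    also have "\<dots> \<le> (\<Sum>i\<in>Basis. norm v * B i)"
      by (rule order_trans[OF norm_sum], rule sum_mono)
        (auto intro!: mult_mono B[OF y] Basis_le_norm Bpos)
    finally show "norm (frechet_derivative h (at y) v) \<le> (\<Sum>i\<in>Basis. B i) * norm v"
      by (simp add: sum_distrib_left mult.commute)
  qed
qed

section \<open>Parallel families of subspaces\<close>

text \<open>An indexed family might repeat vectors; that its span has dimension \<open>n\<close>
  excludes this and makes the family independent.\<close>

lemma dual_functionals:
  fixes e :: "nat \<Rightarrow> 'e::euclidean_space"
  assumes "n = dim (span (e ` {..<n}))"
  obtains \<theta> :: "nat \<Rightarrow> 'e \<Rightarrow> real" where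
    "\<And>i. linear (\<theta> i)" "\<And>i j. i < n \<Longrightarrow> j < n \<Longrightarrow> \<theta> i (e j) = (if i = j then 1 else 0)"
proof -
  have card: "card (e ` {..<n}) \<le> n" using card_image_le[of "{..<n}" e] by simp
  have "dim (e ` {..<n}) \<le> card (e ` {..<n})" by (rule dim_le_card) (auto intro: span_base)
  with assms card have c: "card (e ` {..<n}) = n" by simp
  then have inj: "inj_on e {..<n}" by (intro eq_card_imp_inj_on) auto
  have ind: "independent (e ` {..<n})"
    by (rule card_le_dim_spanning[of _ "span (e ` {..<n})"])
      (use assms[symmetric] c in \<open>simp_all add: span_superset del: dim_span\<close>)
  have "\<exists>t::'e \<Rightarrow> real. linear t \<and> (\<forall>j<n. i < n \<longrightarrow> t (e j) = (if i = j then 1 else 0))" for i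
  proof -
    obtain t :: "'e \<Rightarrow> real" where t: "linear t" "\<And>z. z \<in> e ` {..<n} \<Longrightarrow> t z = (if z = e i then 1 else 0)"
      using linear_independent_extend[OF ind, of "\<lambda>z. if z = e i then (1::real) else 0"] by blast
    have "\<forall>j<n. i < n \<longrightarrow> t (e j) = (if i = j then 1 else 0)"
      using t(2) inj by (auto simp: inj_on_def)
    with t show ?thesis by blast
  qed
  then obtain \<theta> :: "nat \<Rightarrow> 'e \<Rightarrow> real" where
    "\<And>i. linear (\<theta> i) \<and> (\<forall>j<n. i < n \<longrightarrow> \<theta> i (e j) = (if i = j then 1 else 0))" by metis
  then show ?thesis by (intro that[of \<theta>]) auto
qed

text \<open>A quantitative form of independence that survives a small move of the base point: the
  functionals dual to the frame at \<open>x\<close> turn the frame at \<open>y\<close> into a matrix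
  close to the identity. One constant \<open>K\<close> serves the whole ball, as the later
  derivative estimate requires.\<close>

lemma frame_lower_bound:
  fixes e :: "nat \<Rightarrow> 'c::euclidean_space \<Rightarrow> 'e::euclidean_space"
  assumes "n = dim (span ((\<lambda>i. e i x) ` {..<n}))" "\<And>i. i < n \<Longrightarrow> continuous (at x) (e i)"
  obtains r K where "r > 0" "K \<ge> 0"
    "\<And>y c. y \<in> cball x r \<Longrightarrow> (\<Sum>i<n. \<bar>c i\<bar>) \<le> K * norm (\<Sum>i<n. c i *\<^sub>R e i y)"
proof -
  obtain \<theta> :: "nat \<Rightarrow> 'e \<Rightarrow> real" where \<theta>: "\<And>i. linear (\<theta> i)"
    "\<And>i j. i < n \<Longrightarrow> j < n \<Longrightarrow> \<theta> i (e j x) = (if i = j then 1 else 0)"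
    using dual_functionals[of n "\<lambda>i. e i x"] assms(1) by (auto simp: image_image)
  have "\<exists>B>0. \<forall>z. \<bar>\<theta> i z\<bar> \<le> B * norm z" for i
    by (rule linear_bounded_pos[OF \<theta>(1)[of i]]) auto
  then obtain B where B: "\<And>i z. \<bar>\<theta> i z\<bar> \<le> B i * norm z" "\<And>i. B i > 0" by metis
  \<comment> \<open>The errors, at most \<open>\<delta> * N\<close> for each of the \<open>n\<close>
    coefficients, add up to at most half of \<open>N\<close> and are absorbed on the left. The
    summand 1 keeps \<delta> positive for \<open>n = 0\<close>.\<close>
  define \<delta> where "\<delta> = 1 / (2 * real n + 1)"
  have \<delta>: "\<delta> > 0" "real n * \<delta> \<le> 1/2" by (auto simp: \<delta>_def field_simps)
  have "\<exists>d>0. \<forall>y. dist y x < d \<longrightarrow> \<bar>\<theta> i (e j y) - \<theta> i (e j x)\<bar> < \<delta>" if "j < n" for i j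
  proof -
    have "continuous (at x) (\<lambda>y. \<theta> i (e j y))"
      by (intro isCont_o2[OF assms(2)[OF that]] linear_continuous_at)
        (simp add: linear_conv_bounded_linear[symmetric] \<theta>(1))
    then show ?thesis using \<delta>(1) unfolding continuous_at_eps_delta dist_real_def by blast
  qed
  then have "\<forall>i j. \<exists>d. j < n \<longrightarrow> d > 0 \<and>
      (\<forall>y. dist y x < d \<longrightarrow> \<bar>\<theta> i (e j y) - \<theta> i (e j x)\<bar> < \<delta>)" by blast
  then obtain d where "\<forall>i j. j < n \<longrightarrow> d i j > 0 \<and>
      (\<forall>y. dist y x < d i j \<longrightarrow> \<bar>\<theta> i (e j y) - \<theta> i (e j x)\<bar> < \<delta>)"
    unfolding choice_iff by blast
  then have d: "\<And>i j. j < n \<Longrightarrow> d i j > 0"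
    "\<And>i j y. j < n \<Longrightarrow> dist y x < d i j \<Longrightarrow> \<bar>\<theta> i (e j y) - \<theta> i (e j x)\<bar> < \<delta>"
    by blast+
  \<comment> \<open>The entry 1 keeps the minimum defined for \<open>n = 0\<close>.\<close>
  define D where "D = insert 1 ((\<lambda>(i,j). d i j) ` ({..<n} \<times> {..<n}))"
  define r where "r = Min D / 2"
  have D: "finite D" "D \<noteq> {}" "\<And>z. z \<in> D \<Longrightarrow> z > 0" using d(1) by (auto simp: D_def)
  then have "Min D > 0" by simp
  then have r: "r > 0" "r < Min D" by (auto simp: r_def)
  have close: "\<bar>\<theta> i (e j y) - \<theta> i (e j x)\<bar> < \<delta>" if "i < n" "j < n" "y \<in> cball x r" for i j y
  proof -
    have "d i j \<in> D" using that by (auto simp: D_def)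
    then have "Min D \<le> d i j" using D by simp
    then show ?thesis using d(2)[OF that(2)] that(3) r(2) by (auto simp: dist_commute)
  qed
  show ?thesis
  proof (rule that[OF r(1)])
    show "2 * (\<Sum>i<n. B i) \<ge> 0" using B(2) by (simp add: sum_nonneg less_imp_le)
    fix y and c :: "nat \<Rightarrow> real" assume y: "y \<in> cball x r"
    define Z where "Z = (\<Sum>i<n. c i *\<^sub>R e i y)"
    define N where "N = (\<Sum>i<n. \<bar>c i\<bar>)"
    have "\<bar>c i\<bar> \<le> B i * norm Z + \<delta> * N" if i: "i < n" for i
    proof -
      have "\<theta> i Z = (\<Sum>j<n. c j * \<theta> i (e j y))"
        unfolding Z_def by (simp add: linear_sum[OF \<theta>(1)] linear_scale[OF \<theta>(1)])
      also have "\<dots> = (\<Sum>j<n. c j * \<theta> i (e j x)) + (\<Sum>j<n. c j * (\<theta> i (e j y) - \<theta> i (e j x)))"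
        unfolding sum.distrib[symmetric] by (rule sum.cong) (auto simp: algebra_simps)
      also have "(\<Sum>j<n. c j * \<theta> i (e j x)) = (\<Sum>j<n. if i = j then c j else 0)"
        by (rule sum.cong) (use \<theta>(2) i in auto)
      also have "\<dots> = c i" using i by simp
      finally have 1: "c i = \<theta> i Z - (\<Sum>j<n. c j * (\<theta> i (e j y) - \<theta> i (e j x)))" by simp
      have "\<bar>\<Sum>j<n. c j * (\<theta> i (e j y) - \<theta> i (e j x))\<bar> \<le> (\<Sum>j<n. \<bar>c j\<bar> * \<delta>)"
      proof (rule order_trans[OF sum_abs], rule sum_mono)
        fix j assume "j \<in> {..<n}"
        then show "\<bar>c j * (\<theta> i (e j y) - \<theta> i (e j x))\<bar> \<le> \<bar>c j\<bar> * \<delta>"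
          unfolding abs_mult using close[OF i _ y] by (simp add: mult_left_mono less_imp_le)
      qed
      then have "\<bar>\<Sum>j<n. c j * (\<theta> i (e j y) - \<theta> i (e j x))\<bar> \<le> \<delta> * N"
        by (simp add: N_def sum_distrib_left mult.commute)
      with 1 B(1)[of i Z] show ?thesis by linarith
    qed
    then have "N \<le> (\<Sum>i<n. B i * norm Z + \<delta> * N)" unfolding N_def by (intro sum_mono) auto
    also have "\<dots> = (\<Sum>i<n. B i) * norm Z + real n * \<delta> * N"
      by (simp add: sum.distrib sum_distrib_right)
    also have "real n * \<delta> * N \<le> 1/2 * N"
      by (intro mult_right_mono \<delta>) (simp add: N_def sum_nonneg)
    finally show "(\<Sum>i<n. \<bar>c i\<bar>) \<le> 2 * (\<Sum>i<n. B i) * norm (\<Sum>i<n. c i *\<^sub>R e i y)"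
      unfolding N_def[symmetric] Z_def[symmetric] by linarith
  qed
qed

text \<open>By the bound a vanishing combination has zero coefficients, so the vectors are
  independent and, being indexed, also distinct.\<close>

lemma dim_span_frame:
  fixes e :: "nat \<Rightarrow> 'e::euclidean_space"
  assumes "\<And>c. (\<Sum>i<n. \<bar>c i\<bar>) \<le> K * norm (\<Sum>i<n. c i *\<^sub>R e i)"
  shows "dim (span (e ` {..<n})) = n"
proof -
  have z: "c i = 0" if "(\<Sum>i<n. c i *\<^sub>R e i) = 0" "i < n" for c i
  proof -
    have "(\<Sum>i<n. \<bar>c i\<bar>) \<le> 0" using assms[of c] that by simp
    then have "(\<Sum>i<n. \<bar>c i\<bar>) = 0" by (meson abs_ge_zero antisym sum_nonneg)
    then show ?thesis using that by (simp add: sum_nonneg_eq_0_iff)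
  qed
  have inj: "inj_on e {..<n}"
  proof (rule inj_onI, rule ccontr)
    fix i j assume *: "i \<in> {..<n}" "j \<in> {..<n}" "e i = e j" "i \<noteq> j"
    \<comment> \<open>If two members coincide, the difference of two indicator functions gives a
      vanishing combination with coefficient 1 at \<open>i\<close>.\<close>
    define c where "c k = (if k = i then 1 else 0) - (if k = j then 1 else (0::real))" for k
    have "(\<Sum>k<n. c k *\<^sub>R e k) = (\<Sum>k<n. if k = i then e k else 0) - (\<Sum>k<n. if k = j then e k else 0)"
      unfolding sum_subtractf[symmetric] by (rule sum.cong) (auto simp: c_def scaleR_diff_left)
    also have "\<dots> = 0" using * by simp
    finally have "c i = 0" using z * by blast
    then show False using * by (simp add: c_def)
  qed
  have "independent (e ` {..<n})"
  proof
    assume "dependent (e ` {..<n})"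
    then obtain u where u: "\<exists>v\<in>e ` {..<n}. u v \<noteq> 0" "(\<Sum>v\<in>e ` {..<n}. u v *\<^sub>R v) = 0"
      using dependent_finite[of "e ` {..<n}"] by auto
    have "(\<Sum>i<n. u (e i) *\<^sub>R e i) = 0" using u(2) by (simp add: sum.reindex[OF inj, of "\<lambda>v. u v *\<^sub>R v"])
    then show False using z[of "\<lambda>i. u (e i)"] u(1) by auto
  qed
  then show ?thesis by (simp add: dim_eq_card_independent card_image[OF inj])
qed

text \<open>For \<open>\<eta>\<close> orthogonal to \<open>V x\<close>, the functions \<open>\<eta> \<bullet> e\<^sub>i\<close> vanish at \<open>x\<close> and their derivatives are
  bounded linear combinations of themselves; on a small ball their maximum is at most half of itself.\<close>

lemma parallel_subspace_locally_constant:
  fixes V :: "'c::euclidean_space \<Rightarrow> 'e::euclidean_space set" and e :: "nat \<Rightarrow> 'c \<Rightarrow> 'e"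
  assumes "open U" "x \<in> U"
    and V: "\<And>y. y \<in> U \<Longrightarrow> subspace (V y)" "\<And>y. y \<in> U \<Longrightarrow> dim (V y) = n"
    and C1: "\<And>i. i < n \<Longrightarrow> Ck_on (Suc 0) U (e i)"
    and e: "\<And>i y. i < n \<Longrightarrow> y \<in> U \<Longrightarrow> e i y \<in> V y"
    and De: "\<And>i y v. i < n \<Longrightarrow> y \<in> U \<Longrightarrow> frechet_derivative (e i) (at y) v \<in> V y"
    and sp: "V x = span ((\<lambda>i. e i x) ` {..<n})"
  obtains r where "r > 0" "ball x r \<subseteq> U" "\<And>y. y \<in> ball x r \<Longrightarrow> V y = V x"
proof -
  have "continuous (at x) (e i)" if "i < n" for i
    using C1[OF that] assms(2) by (auto intro: differentiable_imp_continuous_within)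
  moreover have "n = dim (span ((\<lambda>i. e i x) ` {..<n}))" using V(2) sp assms(2) by metis
  ultimately obtain r0 K where r0: "r0 > 0" and K: "K \<ge> 0"
    "\<And>y c. y \<in> cball x r0 \<Longrightarrow> (\<Sum>i<n. \<bar>c i\<bar>) \<le> K * norm (\<Sum>i<n. c i *\<^sub>R e i y)"
    using frame_lower_bound[of n e x] by blast
  have "\<exists>r C. r > 0 \<and> C \<ge> 0 \<and> cball x r \<subseteq> U \<and>
      (\<forall>y\<in>cball x r. \<forall>v. norm (frechet_derivative (e i) (at y) v) \<le> C * norm v)" if "i < n" for i
    using Ck_on_derivative_bound[OF assms(1) C1[OF that] assms(2)] by metis
  then obtain R C where RC: "\<And>i. i < n \<Longrightarrow> R i > (0::real)" "\<And>i. i < n \<Longrightarrow> C i \<ge> (0::real)"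
    "\<And>i y v. i < n \<Longrightarrow> y \<in> cball x (R i) \<Longrightarrow> norm (frechet_derivative (e i) (at y) v) \<le> C i * norm v"
    by metis
  obtain r1 where r1: "r1 > 0" "cball x r1 \<subseteq> U" using assms open_contains_cball by blast
  define Q where "Q = K * (\<Sum>i<n. C i)"
  have Q: "Q \<ge> 0" unfolding Q_def using K(1) RC(2) by (intro mult_nonneg_nonneg sum_nonneg) auto
  \<comment> \<open>The estimate below reads \<open>H y0 \<le> Q * r * H y0\<close>; this radius
    makes \<open>Q * r\<close> at most 1/2, and the added 1 covers \<open>Q = 0\<close>.\<close>
  define r2 where "r2 = 1 / (2 * (Q + 1))"
  define D where "D = insert r0 (insert r1 (insert r2 (R ` {..<n})))"
  define r where "r = Min D"
  have D: "finite D" "D \<noteq> {}" "\<And>z. z \<in> D \<Longrightarrow> z > 0"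
    using r0 r1 RC(1) Q by (auto simp: D_def r2_def)
  have r: "r > 0" "\<And>z. z \<in> D \<Longrightarrow> r \<le> z" using D by (auto simp: r_def)
  have rs: "r \<le> r0" "r \<le> r1" "r \<le> r2" "\<And>i. i < n \<Longrightarrow> r \<le> R i" using r(2) by (auto simp: D_def)
  have sub: "cball x r \<subseteq> U" using r1(2) rs(2) by auto
  \<comment> \<open>Spanning is given at \<open>x\<close> only. Nearby the frame stays independent,
    lies in \<open>V y\<close> and has as many members as the dimension of
    \<open>V y\<close>.\<close>
  have spy: "V y = span ((\<lambda>i. e i y) ` {..<n})" if y: "y \<in> cball x r" for y
  proof -
    have "dim (span ((\<lambda>i. e i y) ` {..<n})) = n"
      by (rule dim_span_frame[of n K]) (rule K(2), use y rs in auto)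
    moreover have "span ((\<lambda>i. e i y) ` {..<n}) \<subseteq> V y"
      by (rule span_minimal) (use e V y sub in auto)
    ultimately show ?thesis
      using subspace_dim_equal[of "span ((\<lambda>i. e i y) ` {..<n})" "V y"] V y sub by auto
  qed
  have comb: "\<exists>c. Z = (\<Sum>i<n. c i *\<^sub>R e i y)" if "y \<in> cball x r" "Z \<in> V y" for Z y
  proof -
    have "Z \<in> span ((\<lambda>i. e i y) ` {..<n})" using spy that by blast
    then show ?thesis
    proof (induction rule: span_induct_alt)
      case base
      then show ?case by (intro exI[of _ "\<lambda>i. 0"]) simp
    next
      case (step a z w)
      then obtain c j where c: "w = (\<Sum>i<n. c i *\<^sub>R e i y)" "j < n" "z = e j y" by auto
      have "(\<Sum>i<n. (c i + (if i = j then a else 0)) *\<^sub>R e i y) =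
          (\<Sum>i<n. c i *\<^sub>R e i y) + (\<Sum>i<n. if i = j then a *\<^sub>R e i y else 0)"
        unfolding sum.distrib[symmetric] by (rule sum.cong) (auto simp: scaleR_add_left)
      then show ?case using c by (intro exI[of _ "\<lambda>i. c i + (if i = j then a else 0)"]) simp
    qed
  qed
  have orth: "\<eta> \<bullet> z = 0" if \<eta>: "\<And>w. w \<in> V x \<Longrightarrow> \<eta> \<bullet> w = 0" and y: "y \<in> cball x r" and z: "z \<in> V y"
    for \<eta> y z
  proof -
    define H where "H y = (\<Sum>i<n. \<bar>\<eta> \<bullet> e i y\<bar>)" for y
    have "continuous_on (cball x r) (e i)" if "i < n" for i
      using C1[OF that] sub
      by (auto intro!: continuous_at_imp_continuous_on differentiable_imp_continuous_within)
    then have "continuous_on (cball x r) H"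
      unfolding H_def by (intro continuous_intros) auto
    then obtain y0 where y0: "y0 \<in> cball x r" "\<And>y. y \<in> cball x r \<Longrightarrow> H y \<le> H y0"
      using continuous_attains_sup[of "cball x r" H] r(1) by auto
    have Hpos: "H y0 \<ge> 0" by (simp add: H_def sum_nonneg)
    have bd: "\<bar>\<eta> \<bullet> e i y0\<bar> \<le> K * C i * H y0 * r" if i: "i < n" for i
    proof -
      have "norm (\<eta> \<bullet> e i y0 - \<eta> \<bullet> e i x) \<le> K * C i * H y0 * norm (y0 - x)"
      proof (rule differentiable_bound[of "cball x r"])
        fix y assume y: "y \<in> cball x r"
        show "((\<lambda>y. \<eta> \<bullet> e i y) has_derivative (\<lambda>v. \<eta> \<bullet> frechet_derivative (e i) (at y) v))
            (at y within cball x r)"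
          by (rule has_derivative_at_withinI, rule has_derivative_inner_right,
              rule Ck_on_has_derivative[OF C1[OF i]]) (use y sub in auto)
        show "onorm (\<lambda>v. \<eta> \<bullet> frechet_derivative (e i) (at y) v) \<le> K * C i * H y0"
        proof (rule onorm_le)
          fix v
          \<comment> \<open>The derivative lies in \<open>V y\<close>, hence is a combination of the
            frame there, and the frame bound controls its coefficients by its norm.\<close>
          obtain c where c: "frechet_derivative (e i) (at y) v = (\<Sum>j<n. c j *\<^sub>R e j y)"
            using comb[OF y De[OF i]] y sub by blast
          have "(\<Sum>j<n. \<bar>c j\<bar>) \<le> K * norm (frechet_derivative (e i) (at y) v)"
            unfolding c by (rule K(2)) (use y rs in auto)
          also have "\<dots> \<le> K * (C i * norm v)"
            by (rule mult_left_mono[OF RC(3)[OF i] K(1)]) (use y rs(4)[OF i] in auto)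
          finally have N: "(\<Sum>j<n. \<bar>c j\<bar>) \<le> K * C i * norm v" by simp
          have "norm (\<eta> \<bullet> frechet_derivative (e i) (at y) v) = \<bar>\<Sum>j<n. c j * (\<eta> \<bullet> e j y)\<bar>"
            unfolding c by (simp add: inner_sum_right)
          also have "\<dots> \<le> (\<Sum>j<n. \<bar>c j\<bar> * H y0)"
          proof (rule order_trans[OF sum_abs], rule sum_mono)
            fix j assume "j \<in> {..<n}"
            then have "\<bar>\<eta> \<bullet> e j y\<bar> \<le> H y"
              unfolding H_def by (intro member_le_sum) auto
            also have "\<dots> \<le> H y0" by (rule y0(2)[OF y])
            finally show "\<bar>c j * (\<eta> \<bullet> e j y)\<bar> \<le> \<bar>c j\<bar> * H y0"
              by (simp add: abs_mult mult_left_mono)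
          qed
          also have "\<dots> = (\<Sum>j<n. \<bar>c j\<bar>) * H y0" by (simp add: sum_distrib_right)
          also have "\<dots> \<le> K * C i * norm v * H y0" by (rule mult_right_mono[OF N Hpos])
          finally show "norm (\<eta> \<bullet> frechet_derivative (e i) (at y) v) \<le> K * C i * H y0 * norm v"
            by (simp add: mult_ac)
        qed
      qed (use y0 r in auto)
      also have "\<dots> \<le> K * C i * H y0 * r"
        using y0(1) K(1) RC(2)[OF i] Hpos
        by (intro mult_left_mono) (auto simp: dist_norm norm_minus_commute)
      finally show ?thesis using \<eta>[OF e[OF i assms(2)]] by simp
    qed
    have "H y0 \<le> (\<Sum>i<n. K * C i * H y0 * r)"
      unfolding H_def using bd by (intro sum_mono) (auto simp: H_def)
    also have "\<dots> = Q * r * H y0"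
      by (simp add: Q_def sum_distrib_left sum_distrib_right mult_ac)
    also have "\<dots> \<le> 1/2 * H y0"
    proof (rule mult_right_mono[OF _ Hpos])
      have "Q * r \<le> Q * r2" by (rule mult_left_mono[OF rs(3) Q])
      also have "\<dots> \<le> 1/2" using Q by (simp add: r2_def field_simps)
      finally show "Q * r \<le> 1/2" .
    qed
    finally have "H y0 = 0" using Hpos by simp
    then have "H y \<le> 0" using y0(2)[OF y] by simp
    then have "H y = 0" unfolding H_def by (meson abs_ge_zero antisym sum_nonneg)
    then have "\<eta> \<bullet> e i y = 0" if "i < n" for i
      using that unfolding H_def by (simp add: sum_nonneg_eq_0_iff)
    then show ?thesis using comb[OF y z] by (auto simp: inner_sum_right)
  qed
  have "V y = V x" if "y \<in> ball x r" for y
  proof -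
    have y: "y \<in> cball x r" "y \<in> U" using that sub by auto
    have "V y \<subseteq> V x"
    proof
      fix z assume z: "z \<in> V y"
      \<comment> \<open>With \<eta> the component of \<open>z\<close> orthogonal to
        \<open>V x\<close>, the product \<open>\<eta> \<bullet> z\<close> is the squared norm of
        \<eta>.\<close>
      obtain p \<eta> where p: "p \<in> span (V x)" "\<And>w. w \<in> span (V x) \<Longrightarrow> orthogonal \<eta> w" "z = p + \<eta>"
        using orthogonal_subspace_decomp_exists[of "V x" z] by blast
      have "\<eta> \<bullet> z = 0" by (rule orth[OF _ y(1) z]) (use p(2) span_base in \<open>auto simp: orthogonal_def\<close>)
      moreover have "\<eta> \<bullet> p = 0" using p by (auto simp: orthogonal_def)
      ultimately have "\<eta> = 0" using p(3) by (simp add: inner_add_right)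
      then show "z \<in> V x" using p V(1)[OF assms(2)] span_eq_iff by fastforce
    qed
    then show ?thesis using subspace_dim_equal[of "V y" "V x"] V y assms(2) by auto
  qed
  moreover have "ball x r \<subseteq> U" using sub by auto
  ultimately show ?thesis using that[OF r(1)] by blast
qed

section \<open>Scalar products\<close>

lemma finite_frame:
  fixes V :: "'v::euclidean_space set"
  assumes "subspace V" "dim V = n"
  obtains e :: "nat \<Rightarrow> 'v" where "V = span (e ` {..<n})"
proof -
  obtain E where E: "E \<subseteq> V" "independent E" "V \<subseteq> span E" "card E = dim V"
    by (rule basis_exists)
  obtain h where h: "bij_betw h {..<n} E"
    using ex_bij_betw_nat_finite[OF finiteI_independent[OF E(2)]] E(4) assms(2)
    by (auto simp: atLeast0LessThan)
  then have im: "h ` {..<n} = E" by (simp add: bij_betw_def)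
  show ?thesis
  proof (rule that)
    show "V = span (h ` {..<n})"
      unfolding im by (rule span_subspace[OF E(1,3) assms(1), symmetric])
  qed
qed

text \<open>The form may be indefinite, as it is on the ambient space for negative curvature.
  Existence and uniqueness of projections are tied to \<open>positive_on\<close> for the subspace at
  hand.\<close>

locale scalar_product =
  fixes b :: "'v::euclidean_space \<Rightarrow> 'v \<Rightarrow> real"
  assumes bilin: "bilinear b" and sym: "b x y = b y x"
begin

lemmas lin_simps =
  bilinear_ladd[OF bilin] bilinear_radd[OF bilin] bilinear_lmul[OF bilin] bilinear_rmul[OF bilin]
  bilinear_lsub[OF bilin] bilinear_rsub[OF bilin] bilinear_lzero[OF bilin] bilinear_rzero[OF bilin]
  bilinear_lneg[OF bilin] bilinear_rneg[OF bilin]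

lemma linear_left: "linear (\<lambda>x. b x y)"
  by (rule linearI) (simp_all add: lin_simps)

lemma linear_right: "linear (b x)"
  by (rule linearI) (simp_all add: lin_simps)

lemma sum_left: "b (sum h I) y = (\<Sum>i\<in>I. b (h i) y)"
  by (rule linear_sum[OF linear_left])

lemma sum_right: "b y (sum h I) = (\<Sum>i\<in>I. b y (h i))"
  by (rule linear_sum[OF linear_right])

lemma subspace_perp: "subspace {v. \<forall>w\<in>W. b v w = 0}"
  by (auto simp: subspace_def lin_simps)

lemma has_derivative_form:
  assumes "(h has_derivative h') (at x)" "(k has_derivative k') (at x)"
  shows "((\<lambda>x. b (h x) (k x)) has_derivative (\<lambda>v. b (h x) (k' v) + b (h' v) (k x))) (at x)"
  using bounded_bilinear.FDERIV[OF _ assms, of b] bilin bilinear_conv_bounded_bilinear by blast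

definition positive_on :: "'v set \<Rightarrow> bool" where
  "positive_on V \<longleftrightarrow> (\<forall>v\<in>V. v \<noteq> 0 \<longrightarrow> b v v > 0)"

lemma positive_on_subset: "positive_on V \<Longrightarrow> W \<subseteq> V \<Longrightarrow> positive_on W"
  by (auto simp: positive_on_def)

text \<open>Gram-Schmidt by induction on the dimension: positivity permits normalising a nonzero
  vector, and the induction goes on in its complement \<open>V'\<close> inside
  \<open>V\<close>.\<close>

lemma orthonormal_frame:
  assumes "subspace V" "positive_on V" "dim V = n"
  obtains E where "\<And>i. i < n \<Longrightarrow> E i \<in> V"
    "\<And>i j. i < n \<Longrightarrow> j < n \<Longrightarrow> b (E i) (E j) = (if i = j then 1 else 0)"
    "\<And>v. v \<in> V \<Longrightarrow> v = (\<Sum>i<n. b v (E i) *\<^sub>R E i)"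
proof -
  have "\<exists>E. (\<forall>i<n. E i \<in> V) \<and> (\<forall>i<n. \<forall>j<n. b (E i) (E j) = (if i = j then 1 else 0)) \<and>
      (\<forall>v\<in>V. v = (\<Sum>i<n. b v (E i) *\<^sub>R E i))"
    using assms
  proof (induction n arbitrary: V)
    case 0
    then have "V \<subseteq> {0}" by simp
    then show ?case by auto
  next
    case (Suc n)
    then obtain v where v: "v \<in> V" "v \<noteq> 0"
      by (metis dim_eq_0 nat.distinct(1) singletonI subsetI)
    have bv: "b v v > 0" using Suc.prems v by (auto simp: positive_on_def)
    define e where "e = (1 / sqrt (b v v)) *\<^sub>R v"
    have e: "e \<in> V" "b e e = 1"
      using v bv Suc.prems by (auto simp: e_def subspace_scale lin_simps)
    define V' where "V' = {w\<in>V. b w e = 0}"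
    have sV': "subspace V'"
      using Suc.prems(1) by (auto simp: V'_def subspace_def lin_simps)
    have "e \<notin> V'" using e by (simp add: V'_def)
    then have "e \<notin> span V'" using sV' span_eq_iff by blast
    moreover have "V = span (insert e V')"
    proof
      show "V \<subseteq> span (insert e V')"
      proof
        fix w assume w: "w \<in> V"
        have "w - b w e *\<^sub>R e \<in> V'"
          using w e Suc.prems(1) by (auto simp: V'_def lin_simps subspace_diff subspace_scale)
        then have "(w - b w e *\<^sub>R e) + b w e *\<^sub>R e \<in> span (insert e V')"
          by (intro span_add span_scale span_base) auto
        then show "w \<in> span (insert e V')" by simp
      qed
      show "span (insert e V') \<subseteq> V"
        by (rule span_minimal) (use e Suc.prems in \<open>auto simp: V'_def\<close>)
    qed
    ultimately have "dim V = dim V' + 1" by (simp add: dim_insert)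
    then have "dim V' = n" using Suc.prems by simp
    moreover have "positive_on V'" by (rule positive_on_subset[OF Suc.prems(2)]) (auto simp: V'_def)
    ultimately obtain E where E: "\<And>i. i < n \<Longrightarrow> E i \<in> V'"
      "\<And>i j. i < n \<Longrightarrow> j < n \<Longrightarrow> b (E i) (E j) = (if i = j then 1 else 0)"
      "\<And>v. v \<in> V' \<Longrightarrow> v = (\<Sum>i<n. b v (E i) *\<^sub>R E i)"
      using Suc.IH[OF sV'] by blast
    have Ee: "b (E i) e = 0" "b e (E i) = 0" if "i < n" for i
      using E(1)[OF that] sym[of e] by (auto simp: V'_def)
    define F where "F = E(n := e)"
    have "w = (\<Sum>i<Suc n. b w (F i) *\<^sub>R F i)" if w: "w \<in> V" for w
    proof -
      have "w - b w e *\<^sub>R e \<in> V'"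
        using w e Suc.prems(1) by (auto simp: V'_def lin_simps subspace_diff subspace_scale)
      then have "w - b w e *\<^sub>R e = (\<Sum>i<n. b (w - b w e *\<^sub>R e) (E i) *\<^sub>R E i)" by (rule E(3))
      also have "\<dots> = (\<Sum>i<n. b w (F i) *\<^sub>R F i)"
        by (rule sum.cong) (auto simp: lin_simps Ee F_def)
      finally show ?thesis by (simp add: F_def algebra_simps)
    qed
    moreover have "F i \<in> V" if "i < Suc n" for i
      using that E(1)[of i] e by (auto simp: F_def V'_def less_Suc_eq)
    moreover have "b (F i) (F j) = (if i = j then 1 else 0)" if "i < Suc n" "j < Suc n" for i j
      using that E(2) Ee e by (auto simp: F_def less_Suc_eq)
    ultimately show ?case by (intro exI[of _ F]) auto
  qed
  then show ?thesis using that by blast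
qed

text \<open>\<open>orth_proj\<close> is a definite description, so its values are certified by a
  candidate. Two candidates differ by a vector of \<open>V\<close> that is orthogonal to itself,
  which positivity makes zero.\<close>

lemma orth_proj_eqI:
  assumes "subspace V" "positive_on V" "w \<in> V" "\<And>u. u \<in> V \<Longrightarrow> b (v - w) u = 0"
  shows "orth_proj b V v = w"
  unfolding orth_proj_def
proof (rule the_equality)
  fix w' assume w': "w' \<in> V \<and> (\<forall>u\<in>V. b (v - w') u = 0)"
  have d: "w' - w \<in> V" using assms w' by (simp add: subspace_diff)
  have "b (w' - w) (w' - w) = b (v - w) (w' - w) - b (v - w') (w' - w)"
    by (simp add: lin_simps)
  also have "\<dots> = 0" using assms(4)[OF d] w' d by simp
  finally show "w' = w" using d assms(2) by (force simp: positive_on_def)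
qed (use assms in auto)

lemma orth_proj:
  assumes "subspace V" "positive_on V"
  shows orth_proj_in: "orth_proj b V v \<in> V"
    and orth_proj_perp: "u \<in> V \<Longrightarrow> b (v - orth_proj b V v) u = 0"
proof -
  obtain E where E: "\<And>i. i < dim V \<Longrightarrow> E i \<in> V"
    "\<And>i j. i < dim V \<Longrightarrow> j < dim V \<Longrightarrow> b (E i) (E j) = (if i = j then 1 else 0)"
    "\<And>v. v \<in> V \<Longrightarrow> v = (\<Sum>i<dim V. b v (E i) *\<^sub>R E i)"
    using orthonormal_frame[OF assms refl] by blast
  define w where "w = (\<Sum>i<dim V. b v (E i) *\<^sub>R E i)"
  have w: "w \<in> V" unfolding w_def using assms(1) E(1) by (intro subspace_sum subspace_scale) auto
  have p: "b (v - w) u = 0" if u: "u \<in> V" for u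
  proof -
    have "b (v - w) (E j) = 0" if j: "j < dim V" for j
    proof -
      have "b w (E j) = (\<Sum>i<dim V. if i = j then b v (E i) else 0)"
        unfolding w_def sum_left by (rule sum.cong) (use E(2) j in \<open>auto simp: lin_simps\<close>)
      then show ?thesis using j by (simp add: lin_simps)
    qed
    then have "b (v - w) (\<Sum>i<dim V. b u (E i) *\<^sub>R E i) = 0"
      unfolding sum_right by (simp add: lin_simps(4))
    then show ?thesis using E(3)[OF u] by simp
  qed
  have eq: "orth_proj b V v = w" by (rule orth_proj_eqI[OF assms w p])
  show "orth_proj b V v \<in> V" using eq w by simp
  show "b (v - orth_proj b V v) u = 0" if "u \<in> V" using eq p that by simp
qed

text \<open>The kernel of \<open>T\<close> and total geodesy are defined by vanishing projections;
  this turns them into relations that can be paired with test vectors.\<close>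

lemma orth_proj_eq_0_iff:
  assumes "subspace V" "positive_on V"
  shows "orth_proj b V v = 0 \<longleftrightarrow> (\<forall>u\<in>V. b v u = 0)"
  using orth_proj_perp[OF assms, of _ v] orth_proj_eqI[OF assms, of 0 v] assms(1)
  by (auto simp: subspace_0)

end

text \<open>The part \<eta> of \<open>h' v\<close> that is Euclidean orthogonal to \<open>V\<close>
  is paired with \<open>h\<close>: the pairing vanishes near \<open>x\<close>, so its derivative
  along \<open>v\<close>, the squared norm of \<eta>, is zero.\<close>

lemma has_derivative_in_subspace:
  fixes h :: "'a::real_normed_vector \<Rightarrow> 'b::euclidean_space"
  assumes V: "subspace V" and "open U" "x \<in> U" "\<And>y. y \<in> U \<Longrightarrow> h y \<in> V"
    and h: "(h has_derivative h') (at x)"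
  shows "h' v \<in> V"
proof -
  obtain p \<eta> where p: "p \<in> span V" "\<And>w. w \<in> span V \<Longrightarrow> orthogonal \<eta> w" "h' v = p + \<eta>"
    using orthogonal_subspace_decomp_exists[of V "h' v"] by blast
  have 1: "((\<lambda>y. \<eta> \<bullet> h y) has_derivative (\<lambda>w. \<eta> \<bullet> h' w)) (at x)"
    by (rule has_derivative_inner_right[OF h])
  have "((\<lambda>y. 0) has_derivative (\<lambda>w. \<eta> \<bullet> h' w)) (at x)"
    by (rule has_derivative_transform_within_open[OF 1 assms(2,3)])
      (use p(2) assms(4) span_base in \<open>auto simp: orthogonal_def\<close>)
  then have "(\<lambda>w. \<eta> \<bullet> h' w) = (\<lambda>w. 0)"
    using has_derivative_unique has_derivative_const by blast
  then have "\<eta> \<bullet> h' v = 0" by meson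
  then have "\<eta> = 0" using p by (simp add: inner_add_right orthogonal_def)
  then show ?thesis using p V span_eq_iff by fastforce
qed

text \<open>Serves to differentiate identities between scalar products along a curve or in a
  chart.\<close>

lemma has_derivative_locally_constant:
  assumes "open U" "x \<in> U" "\<And>y. y \<in> U \<Longrightarrow> h y = c" "(h has_derivative h') (at x)"
  shows "h' v = 0"
proof -
  have "((\<lambda>y. c) has_derivative h') (at x)"
    by (rule has_derivative_transform_within_open[OF assms(4,1,2)]) (use assms(3) in auto)
  then have "h' = (\<lambda>w. 0)" using has_derivative_unique has_derivative_const by blast
  then show ?thesis by simp
qed

section \<open>Tangent spaces of hyperquadrics\<close>

text \<open>For \<open>k = 0\<close> the space form is the hyperplane \<open>{0} \<times> span B\<close>, so that its normal is \<open>(1, 0)\<close>; with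
  this convention the three signs of \<open>k\<close> are treated alike.\<close>

definition normal_vec :: "real \<Rightarrow> real \<times> 'e::euclidean_space \<Rightarrow> real \<times> 'e" where
  "normal_vec k X = (if k = 0 then (1, 0) else X)"

interpretation flat: scalar_product "flat_form k" for k
proof
  show "bilinear (flat_form k)"
    unfolding bilinear_def
    by (auto intro!: linearI simp: flat_form_def algebra_simps inner_add_left inner_add_right)
  show "flat_form k x y = flat_form k y x" for x y
    by (simp add: flat_form_def inner_commute mult.commute)
qed

interpretation prod: scalar_product "prod_form k1 k2" for k1 k2
proof
  show "bilinear (prod_form k1 k2)"
    unfolding bilinear_def
    by (intro conjI allI linearI; simp add: prod_form_def flat.lin_simps algebra_simps)
  show "prod_form k1 k2 x y = prod_form k1 k2 y x" for x y
    by (simp add: prod_form_def flat.sym)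
qed

lemma flat_form_nonneg: "\<not> k < 0 \<Longrightarrow> flat_form k X Y = X \<bullet> Y"
  by (simp add: flat_form_def inner_prod_def)

lemma normal_vec_square:
  assumes "p \<in> hyperquadric k B"
  shows "flat_form k (normal_vec k p) (normal_vec k p) = (if k = 0 then 1 else 1 / k)"
  using assms by (auto simp: normal_vec_def hyperquadric_def flat_form_def split: if_splits)

lemma normal_vec_square_nz:
  assumes "p \<in> hyperquadric k B"
  shows "flat_form k (normal_vec k p) (normal_vec k p) \<noteq> 0"
  using normal_vec_square[OF assms] by auto

lemma snd_normal_vec: "p \<in> hyperquadric k B \<Longrightarrow> snd (normal_vec k p) \<in> span B"
  by (auto simp: normal_vec_def hyperquadric_def span_zero)

lemma subspace_snd_span: "subspace {v :: real \<times> 'e::euclidean_space. snd v \<in> span B}"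
  by (auto simp: subspace_def span_zero span_add span_scale)

lemma tangent_spaceE:
  assumes "v \<in> tangent_space S p"
  obtains \<gamma> where "range \<gamma> \<subseteq> S" "\<gamma> (0::real) = p" "(\<gamma> has_derivative (\<lambda>t. t *\<^sub>R v)) (at 0)"
  using assms by (auto simp: tangent_space_def has_vector_derivative_def)

lemma tangent_space_in_subspace:
  fixes S :: "'v::euclidean_space set"
  assumes "v \<in> tangent_space S p" "subspace V" "S \<subseteq> V"
  shows "v \<in> V"
proof -
  obtain \<gamma> where g: "range \<gamma> \<subseteq> S" "\<gamma> (0::real) = p" "(\<gamma> has_derivative (\<lambda>t. t *\<^sub>R v)) (at 0)"
    by (rule tangent_spaceE[OF assms(1)])
  have "1 *\<^sub>R v \<in> V"
    by (rule has_derivative_in_subspace[OF assms(2) open_UNIV _ _ g(3)]) (use g assms in auto)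
  then show ?thesis by simp
qed

lemma tangent_hyperquadric_subset:
  assumes p: "p \<in> hyperquadric k B" and v: "v \<in> tangent_space (hyperquadric k B) p"
  shows "snd v \<in> span B" "flat_form k v (normal_vec k p) = 0"
proof -
  show "snd v \<in> span B"
    using tangent_space_in_subspace[OF v subspace_snd_span[of B]] by (auto simp: hyperquadric_def)
  obtain \<gamma> where g: "range \<gamma> \<subseteq> hyperquadric k B" "\<gamma> (0::real) = p"
    "(\<gamma> has_derivative (\<lambda>t. t *\<^sub>R v)) (at 0)"
    by (rule tangent_spaceE[OF v])
  show "flat_form k v (normal_vec k p) = 0"
  proof (cases "k = 0")
    case True
    have "((\<lambda>t. fst (\<gamma> t)) has_derivative (\<lambda>t. fst (t *\<^sub>R v))) (at 0)"
      by (rule has_derivative_fst[OF g(3)])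
    then have "fst (1 *\<^sub>R v) = 0"
      by (rule has_derivative_locally_constant[OF open_UNIV UNIV_I, of _ 0, rotated])
        (use g(1) True in \<open>auto simp: hyperquadric_def\<close>)
    then show ?thesis using True by (simp add: normal_vec_def flat_form_def)
  next
    case False
    have "flat_form k (\<gamma> 0) (1 *\<^sub>R v) + flat_form k (1 *\<^sub>R v) (\<gamma> 0) = 0"
      using has_derivative_locally_constant[OF open_UNIV UNIV_I _
          flat.has_derivative_form[OF g(3) g(3), of k], of "1 / k" 1] g(1) False
      by (auto simp: hyperquadric_def image_subset_iff)
    then show ?thesis using False g(2) flat.sym[of k v p] by (simp add: normal_vec_def)
  qed
qed

text \<open>\<open>tangent_space\<close> asks for curves that stay in the set for all real times. A
  straight line does for \<open>k = 0\<close>, its central projection for \<open>k > 0\<close>, and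
  its lift to the upper sheet, seen as a graph, for \<open>k < 0\<close>.\<close>

lemma tangent_hyperquadric_superset:
  assumes p: "p \<in> hyperquadric k B" and v: "snd v \<in> span B" "flat_form k v (normal_vec k p) = 0"
  shows "v \<in> tangent_space (hyperquadric k B) p"
proof -
  have sp: "snd p \<in> span B" using p by (simp add: hyperquadric_def)
  consider "k = 0" | "k > 0" | "k < 0" by linarith
  then have "\<exists>\<gamma>. range \<gamma> \<subseteq> hyperquadric k B \<and> \<gamma> (0::real) = p \<and> (\<gamma> has_vector_derivative v) (at 0)"
  proof cases
    case 1
    have "((\<lambda>t. p + t *\<^sub>R v) has_vector_derivative v) (at 0)"
      by (auto intro!: derivative_eq_intros)
    moreover have "p + t *\<^sub>R v \<in> hyperquadric k B" for t
      using 1 p v by (auto simp: hyperquadric_def normal_vec_def flat_form_def span_add span_scale)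
    ultimately show ?thesis by (intro exI[of _ "\<lambda>t. p + t *\<^sub>R v"]) auto
  next
    case 2
    define N where "N = flat_form k v v"
    have N: "N \<ge> 0" using 2 by (simp add: N_def flat_form_nonneg)
    have pv: "flat_form k p v = 0" "flat_form k v p = 0" "flat_form k p p = 1 / k"
      using v 2 p flat.sym[of k p v] by (auto simp: normal_vec_def hyperquadric_def)
    \<comment> \<open>As \<open>p\<close> and \<open>v\<close> are orthogonal,
      \<open>p + t *\<^sub>R v\<close> has square \<open>(1 + k * t^2 * N) / k\<close>, and
      \<open>r t\<close> rescales this to \<open>1 / k\<close>. The derivative of \<open>r\<close>
      at 0 is zero, so the velocity remains \<open>v\<close>.\<close>
    define r where "r t = 1 / sqrt (1 + k * t^2 * N)" for t
    have pos: "1 + k * t^2 * N > 0" for t using 2 N by (simp add: add_pos_nonneg)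
    have "(r has_real_derivative 0) (at 0)"
      unfolding r_def by (auto intro!: derivative_eq_intros)
    then have "((\<lambda>t. r t *\<^sub>R (p + t *\<^sub>R v)) has_vector_derivative v) (at 0)"
      by (auto intro!: derivative_eq_intros simp: r_def)
    moreover have "r t *\<^sub>R (p + t *\<^sub>R v) \<in> hyperquadric k B" for t
    proof -
      have "flat_form k (p + t *\<^sub>R v) (p + t *\<^sub>R v) = (1 + k * t^2 * N) / k"
        using pv 2 by (simp add: flat.lin_simps N_def[symmetric] field_simps power2_eq_square)
      moreover have "(r t)^2 = 1 / (1 + k * t^2 * N)"
        using pos[of t] by (simp add: r_def power_divide)
      ultimately have "flat_form k (r t *\<^sub>R (p + t *\<^sub>R v)) (r t *\<^sub>R (p + t *\<^sub>R v)) = 1 / k"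
        using pos[of t] by (simp add: flat.lin_simps(3,4) mult.assoc[symmetric] power2_eq_square[symmetric])
      then show ?thesis using 2 v sp by (simp add: hyperquadric_def span_add span_scale)
    qed
    moreover have "r 0 *\<^sub>R (p + 0 *\<^sub>R v) = p" by (simp add: r_def)
    ultimately show ?thesis by (intro exI[of _ "\<lambda>t. r t *\<^sub>R (p + t *\<^sub>R v)"]) auto
  next
    case 3
    have pp: "fst p > 0" "(fst p)^2 = snd p \<bullet> snd p - 1 / k"
      using p 3 by (auto simp: hyperquadric_def flat_form_def power2_eq_square)
    have pv: "snd v \<bullet> snd p = fst v * fst p"
      using v 3 by (simp add: normal_vec_def flat_form_def)
    \<comment> \<open>The upper sheet is the graph over \<open>span B\<close> of the root taken in
      \<open>s\<close>. The tangency relation \<open>pv\<close> is what gives the lift the velocity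
      \<open>fst v\<close> in the first coordinate.\<close>
    define w where "w t = snd p + t *\<^sub>R snd v" for t
    define s where "s t = sqrt (w t \<bullet> w t - 1 / k)" for t
    have pos: "w t \<bullet> w t - 1 / k > 0" for t
      using 3 by (simp add: add_nonneg_pos divide_neg_neg less_le_trans[OF _ inner_ge_zero])
    have s0: "s 0 = fst p" using pp by (simp add: s_def w_def pp(2)[symmetric])
    have wd: "(w has_vector_derivative snd v) (at 0)"
      unfolding w_def by (auto intro!: derivative_eq_intros)
    have wd2: "((\<lambda>t. w t \<bullet> w t - 1 / k) has_real_derivative (2 * (snd p \<bullet> snd v))) (at 0)"
      unfolding w_def by (auto intro!: derivative_eq_intros
          simp: inner_add_left inner_add_right inner_commute)
    have "(s has_real_derivative fst v) (at 0)"
      unfolding s_def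
      by (rule DERIV_cong[OF DERIV_chain2[OF DERIV_real_sqrt[OF pos[of 0]] wd2]])
        (use s0 pv pp(1) in \<open>simp add: s_def inner_commute\<close>)
    then have "((\<lambda>t. (s t, w t)) has_vector_derivative (fst v, snd v)) (at 0)"
      using wd by (intro has_vector_derivative_Pair) (simp_all add: has_real_derivative_iff_has_vector_derivative)
    moreover have "(s t, w t) \<in> hyperquadric k B" for t
    proof -
      have "s t > 0" "s t * s t = w t \<bullet> w t - 1 / k"
        using pos[of t] by (auto simp: s_def)
      moreover have "w t \<in> span B" unfolding w_def using v sp by (simp add: span_add span_scale)
      ultimately show ?thesis using 3 by (simp add: hyperquadric_def flat_form_def)
    qed
    moreover have "(s 0, w 0) = p" using s0 by (simp add: w_def)
    ultimately show ?thesis by (intro exI[of _ "\<lambda>t. (s t, w t)"]) auto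
  qed
  then show ?thesis by (simp add: tangent_space_def)
qed

lemma tangent_hyperquadric:
  assumes "p \<in> hyperquadric k B"
  shows "tangent_space (hyperquadric k B) p = {v. snd v \<in> span B \<and> flat_form k v (normal_vec k p) = 0}"
  using tangent_hyperquadric_subset[OF assms] tangent_hyperquadric_superset[OF assms] by auto

lemma subspace_tangent_hyperquadric:
  assumes "p \<in> hyperquadric k B"
  shows "subspace (tangent_space (hyperquadric k B) p)"
  unfolding tangent_hyperquadric[OF assms]
  by (auto simp: subspace_def span_zero span_add span_scale flat.lin_simps)

text \<open>For \<open>k < 0\<close> this is the fact that the complement of a timelike vector is
  spacelike: Cauchy-Schwarz applied to \<open>pv\<close>, with \<open>norm (snd p)\<close> strictly
  below \<open>fst p\<close>, makes \<open>fst v\<close> smaller in absolute value than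
  \<open>norm (snd v)\<close>.\<close>

lemma tangent_hyperquadric_positive:
  assumes p: "p \<in> hyperquadric k B"
  shows "flat.positive_on k (tangent_space (hyperquadric k B) p)"
  unfolding flat.positive_on_def
proof (intro ballI impI)
  fix v assume v: "v \<in> tangent_space (hyperquadric k B) p" "v \<noteq> 0"
  show "flat_form k v v > 0"
  proof (cases "k < 0")
    case False
    then show ?thesis using v by (simp add: flat_form_nonneg)
  next
    case True
    have pp: "fst p > 0" "(fst p)^2 = (norm (snd p))^2 - 1 / k"
      using p True by (auto simp: hyperquadric_def flat_form_def power2_eq_square power2_norm_eq_inner[unfolded power2_eq_square])
    have pv: "fst v * fst p = snd v \<bullet> snd p"
      using v True unfolding tangent_hyperquadric[OF p] by (simp add: normal_vec_def flat_form_def)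
    have lt: "(norm (snd p))^2 < (fst p)^2" using pp True by (simp add: divide_neg_neg)
    have nz: "snd v \<noteq> 0"
    proof
      assume "snd v = 0"
      then have "fst v = 0" using pv pp by simp
      then show False using \<open>snd v = 0\<close> v(2) by (simp add: prod_eq_iff)
    qed
    have "(fst v)^2 * (fst p)^2 \<le> (norm (snd v))^2 * (norm (snd p))^2"
      using Cauchy_Schwarz_ineq[of "snd v" "snd p"] pv
      by (simp add: power_mult_distrib[symmetric] power2_norm_eq_inner)
    also have "\<dots> < (norm (snd v))^2 * (fst p)^2"
      using lt nz by (intro mult_strict_left_mono) auto
    finally have "(fst v)^2 < (norm (snd v))^2" using pp(1) by (simp add: mult_less_cancel_right)
    then show ?thesis using True by (simp add: flat_form_def power2_eq_square power2_norm_eq_inner[unfolded power2_eq_square])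
  qed
qed

lemma tangent_hyperquadric_nonneg:
  assumes "p \<in> hyperquadric k B" "v \<in> tangent_space (hyperquadric k B) p"
  shows "flat_form k v v \<ge> 0 \<and> (flat_form k v v = 0 \<longrightarrow> v = 0)"
  using tangent_hyperquadric_positive[OF assms(1)] assms(2)
  by (cases "v = 0") (auto simp: flat.positive_on_def flat.lin_simps less_imp_le)

text \<open>For timelike vectors the first components dominate the spatial parts, so their signs
  decide the sign of the form. The sheet of a point can thus be read off from the form, which a
  linear isometry preserves.\<close>

lemma timelike_sign:
  assumes "k < 0" "flat_form k X X < 0" "flat_form k P P < 0" "fst P > 0"
  shows "fst X > 0 \<longleftrightarrow> flat_form k X P < 0"
proof -
  have X: "norm (snd X) < \<bar>fst X\<bar>" and P: "norm (snd P) < fst P"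
    using assms power2_less_imp_less[of "norm (snd X)" "\<bar>fst X\<bar>"]
      power2_less_imp_less[of "norm (snd P)" "fst P"]
    by (simp_all add: flat_form_def power2_norm_eq_inner power2_eq_square[of "fst _"])
  have "\<bar>snd X \<bullet> snd P\<bar> \<le> norm (snd X) * norm (snd P)" by (rule Cauchy_Schwarz_ineq2)
  also have "\<dots> \<le> norm (snd X) * fst P" using P by (intro mult_left_mono) auto
  also have "\<dots> < \<bar>fst X\<bar> * fst P" using X assms(4) by (intro mult_strict_right_mono) auto
  finally have "\<bar>snd X \<bullet> snd P\<bar> < \<bar>fst X\<bar> * fst P" .
  then show ?thesis using assms(1,4)
    by (cases "fst X > 0") (auto simp: flat_form_def abs_if mult_neg_pos split: if_splits)
qed

section \<open>Dimensions of orthogonal complements and of tangent spaces\<close>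

lemma dim_snd_span:
  assumes "B \<subseteq> Basis"
  shows "dim {v :: real \<times> 'e::euclidean_space. snd v \<in> span B} = card B + 1"
proof -
  have "{v :: real \<times> 'e. snd v \<in> span B} = UNIV \<times> span B" by auto
  moreover have "independent B" using assms independent_Basis independent_mono by blast
  ultimately show ?thesis by (simp add: dim_Times dim_eq_card_independent)
qed

text \<open>The form is the Euclidean product after a possible change of sign in the first
  coordinate of one argument. The complement of \<open>W\<close> is thus the Euclidean complement of
  the reflected \<open>W\<close>, which the last assumption keeps inside \<open>V\<close>.\<close>

lemma dim_flat_perp_within:
  assumes "subspace V" "subspace W" "\<And>w. w \<in> W \<Longrightarrow> ((if k < 0 then -1 else 1) * fst w, snd w) \<in> V"
  shows "dim {v \<in> V. \<forall>w\<in>W. flat_form k v w = 0} + dim W = dim V"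
proof -
  define \<sigma> where "\<sigma> w = ((if k < 0 then -1 else 1) * fst w, snd w)" for w :: "real \<times> 'a"
  have lin: "linear \<sigma>" unfolding \<sigma>_def by (rule linearI) auto
  have inj: "inj \<sigma>" unfolding \<sigma>_def by (auto simp: inj_def prod_eq_iff)
  have f: "flat_form k v w = \<sigma> w \<bullet> v" for v w
    by (simp add: flat_form_def \<sigma>_def inner_prod_def inner_commute mult_ac)
  have "dim {y \<in> V. \<forall>x\<in>\<sigma> ` W. orthogonal x y} + dim (\<sigma> ` W) = dim V"
    by (rule dim_subspace_orthogonal_to_vectors)
      (use assms linear_subspace_image[OF lin] in \<open>auto simp: \<sigma>_def\<close>)
  moreover have "dim (\<sigma> ` W) = dim W" by (rule dim_image_eq[OF lin]) (use inj in \<open>auto intro: inj_on_subset\<close>)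
  ultimately show ?thesis by (simp add: f orthogonal_def)
qed

lemma dim_flat_perp:
  fixes W :: "(real \<times> 'e::euclidean_space) set"
  assumes "subspace W"
  shows "dim {v. \<forall>w\<in>W. flat_form k v w = 0} + dim W = DIM('e) + 1"
  using dim_flat_perp_within[of UNIV W k] assms by simp

lemma dim_tangent_hyperquadric:
  assumes B: "B \<subseteq> Basis" and p: "p \<in> hyperquadric k B"
  shows "dim (tangent_space (hyperquadric k B) p) = card B"
proof -
  let ?n = "normal_vec k p"
  have nz: "?n \<noteq> 0" using normal_vec_square_nz[OF p] by (auto simp: flat.lin_simps)
  have "dim {v \<in> {v. snd v \<in> span B}. \<forall>w\<in>span {?n}. flat_form k v w = 0} + dim (span {?n}) = card B + 1"
    unfolding dim_snd_span[OF B, symmetric]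
    by (rule dim_flat_perp_within[OF subspace_snd_span subspace_span])
      (use snd_normal_vec[OF p] in \<open>auto simp: span_singleton span_scale\<close>)
  moreover have "{v \<in> {v. snd v \<in> span B}. \<forall>w\<in>span {?n}. flat_form k v w = 0} =
      tangent_space (hyperquadric k B) p"
    unfolding tangent_hyperquadric[OF p] by (auto simp: span_singleton flat.lin_simps)
  moreover have "dim (span {?n}) = 1" using nz by (simp add: dim_insert)
  ultimately show ?thesis by simp
qed

section \<open>Tangent spaces of products\<close>

lemma tangent_space_Times:
  "tangent_space (S \<times> T) p = tangent_space S (fst p) \<times> tangent_space T (snd p)"
proof (intro set_eqI iffI)
  fix v assume "v \<in> tangent_space (S \<times> T) p"
  then obtain \<gamma> where g: "range \<gamma> \<subseteq> S \<times> T" "\<gamma> (0::real) = p" "(\<gamma> has_vector_derivative v) (at 0)"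
    by (auto simp: tangent_space_def)
  have "((\<lambda>t. fst (\<gamma> t)) has_vector_derivative fst v) (at 0)"
    "((\<lambda>t. snd (\<gamma> t)) has_vector_derivative snd v) (at 0)"
    using has_derivative_fst[OF g(3)[unfolded has_vector_derivative_def]]
      has_derivative_snd[OF g(3)[unfolded has_vector_derivative_def]]
    by (simp_all add: has_vector_derivative_def)
  moreover have "range (\<lambda>t. fst (\<gamma> t)) \<subseteq> S" "range (\<lambda>t. snd (\<gamma> t)) \<subseteq> T"
    using g(1) by (auto simp: image_subset_iff mem_Times_iff)
  ultimately have "fst v \<in> tangent_space S (fst p)" "snd v \<in> tangent_space T (snd p)"
    unfolding tangent_space_def using g(2) by blast+
  then show "v \<in> tangent_space S (fst p) \<times> tangent_space T (snd p)" by (simp add: mem_Times_iff)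
next
  fix v assume "v \<in> tangent_space S (fst p) \<times> tangent_space T (snd p)"
  then obtain \<gamma> \<delta> where g: "range \<gamma> \<subseteq> S" "\<gamma> (0::real) = fst p" "(\<gamma> has_vector_derivative fst v) (at 0)"
    and d: "range \<delta> \<subseteq> T" "\<delta> (0::real) = snd p" "(\<delta> has_vector_derivative snd v) (at 0)"
    by (auto simp: tangent_space_def)
  have "((\<lambda>t. (\<gamma> t, \<delta> t)) has_vector_derivative v) (at 0)"
    using has_vector_derivative_Pair[OF g(3) d(3)] by simp
  moreover have "range (\<lambda>t. (\<gamma> t, \<delta> t)) \<subseteq> S \<times> T" using g(1) d(1) by auto
  ultimately show "v \<in> tangent_space (S \<times> T) p"
    unfolding tangent_space_def using g(2) d(2)
    by (auto intro!: exI[of _ "\<lambda>t. (\<gamma> t, \<delta> t)"])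
qed

lemma space_form_product_tangent:
  assumes "p \<in> hyperquadric k1 B1 \<times> hyperquadric k2 B2"
  shows "subspace (tangent_space (hyperquadric k1 B1 \<times> hyperquadric k2 B2) p)"
    "prod.positive_on k1 k2 (tangent_space (hyperquadric k1 B1 \<times> hyperquadric k2 B2) p)"
proof -
  have p: "fst p \<in> hyperquadric k1 B1" "snd p \<in> hyperquadric k2 B2" using assms by auto
  show "subspace (tangent_space (hyperquadric k1 B1 \<times> hyperquadric k2 B2) p)"
    unfolding tangent_space_Times
    by (intro subspace_Times subspace_tangent_hyperquadric p)
  show "prod.positive_on k1 k2 (tangent_space (hyperquadric k1 B1 \<times> hyperquadric k2 B2) p)"
    unfolding prod.positive_on_def tangent_space_Times
  proof (intro ballI impI)
    fix v assume v: "v \<in> tangent_space (hyperquadric k1 B1) (fst p) \<times> tangent_space (hyperquadric k2 B2) (snd p)" "v \<noteq> 0"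
    then have "flat_form k1 (fst v) (fst v) \<ge> 0 \<and> (flat_form k1 (fst v) (fst v) = 0 \<longrightarrow> fst v = 0)"
      "flat_form k2 (snd v) (snd v) \<ge> 0 \<and> (flat_form k2 (snd v) (snd v) = 0 \<longrightarrow> snd v = 0)"
      using tangent_hyperquadric_nonneg[OF p(1)] tangent_hyperquadric_nonneg[OF p(2)]
      by (simp_all add: mem_Times_iff)
    then show "prod_form k1 k2 v v > 0"
      using v(2) by (auto simp: prod_form_def prod_eq_iff less_le add_nonneg_eq_0_iff)
  qed
qed

section \<open>Maps on manifolds in charts\<close>

lemma frechet_derivative_tangent:
  assumes "(h has_derivative h') (at u)" "range (\<lambda>t. h (u + t *\<^sub>R v)) \<subseteq> S"
  shows "h' v \<in> tangent_space S (h u)"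
proof -
  have "((\<lambda>t. u + t *\<^sub>R v) has_derivative (\<lambda>t. t *\<^sub>R v)) (at (0::real))"
    by (auto intro!: derivative_eq_intros)
  from has_derivative_compose[of _ _ 0 UNIV h h', OF this] assms(1)
  have "((\<lambda>t. h (u + t *\<^sub>R v)) has_derivative (\<lambda>t. h' (t *\<^sub>R v))) (at 0)" by simp
  moreover have "h' (t *\<^sub>R v) = t *\<^sub>R h' v" for t
    using has_derivative_linear[OF assms(1)] linear_scale by blast
  ultimately have "((\<lambda>t. h (u + t *\<^sub>R v)) has_vector_derivative h' v) (at 0)"
    by (simp add: has_vector_derivative_def)
  then show ?thesis unfolding tangent_space_def using assms(2)
    by (auto intro!: exI[of _ "\<lambda>t. h (u + t *\<^sub>R v)"])
qed

text \<open>A derivative within \<open>S\<close> need not be unique as a linear map, but the chain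
  rule along a curve in \<open>S\<close> fixes its value on the velocity of the curve.\<close>

lemma has_derivative_tangent_unique:
  assumes "(h has_derivative h') (at p within S)" "(h has_derivative h'') (at p within S)"
    and "v \<in> tangent_space S p"
  shows "h' v = h'' v"
proof -
  obtain \<gamma> where g: "range \<gamma> \<subseteq> S" "\<gamma> (0::real) = p" "(\<gamma> has_derivative (\<lambda>t. t *\<^sub>R v)) (at 0)"
    by (rule tangent_spaceE[OF assms(3)])
  have "((\<lambda>t. h (\<gamma> t)) has_derivative (\<lambda>t. h' (t *\<^sub>R v))) (at 0)"
    "((\<lambda>t. h (\<gamma> t)) has_derivative (\<lambda>t. h'' (t *\<^sub>R v))) (at 0)"
    using has_derivative_in_compose[OF g(3)] has_derivative_subset[OF assms(1) g(1)]
      has_derivative_subset[OF assms(2) g(1)] g(2) by auto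
  then have "(\<lambda>t. h' (t *\<^sub>R v)) = (\<lambda>t. h'' (t *\<^sub>R v))" by (rule has_derivative_unique)
  then have "h' (1 *\<^sub>R v) = h'' (1 *\<^sub>R v)" by meson
  then show ?thesis by simp
qed

text \<open>\<open>frechet_derivative\<close> within a set picks some derivative. On tangent vectors
  the choice is harmless, so any derivative at hand, usually that of a local extension, may replace
  it.\<close>

lemma frechet_derivative_within_tangent:
  assumes "(h has_derivative h') (at p within S)" "v \<in> tangent_space S p"
  shows "frechet_derivative h (at p within S) v = h' v"
proof (rule has_derivative_tangent_unique[OF _ assms])
  show "(h has_derivative frechet_derivative h (at p within S)) (at p within S)"
    using assms(1) frechet_derivative_works differentiable_def by blast
qed

lemma has_derivative_local_extension:
  assumes "open W" "p \<in> S" "p \<in> W" "(H has_derivative H') (at p)" "\<And>q. q \<in> S \<inter> W \<Longrightarrow> h q = H q"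
  shows "(h has_derivative H') (at p within S)"
proof -
  obtain d where d: "d > 0" "ball p d \<subseteq> W" using assms(1,3) openE by blast
  show ?thesis
  proof (rule has_derivative_transform_within[OF has_derivative_at_withinI[OF assms(4)] d(1) assms(2)])
    fix q assume "q \<in> S" "dist q p < d"
    then have "q \<in> S \<inter> W" using d(2) by (auto simp: dist_commute)
    then show "H q = h q" using assms(5) by simp
  qed
qed

locale smooth_mfd =
  fixes A :: "('a::{t2_space,second_countable_topology}, 'c::euclidean_space) chart set"
  assumes mfd: "smooth_manifold A"
begin

lemma chart_ex: obtains c where "c \<in> A" "x \<in> fst c"
  using mfd unfolding smooth_manifold_def by blast

lemma chart:
  assumes "c \<in> A"
  shows chart_open: "open (fst c)" and chart_image_open: "open (snd c ` fst c)"
    and chart_homeo: "homeomorphism (fst c) (snd c ` fst c) (snd c) (chart_inv c)"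
  using mfd assms unfolding smooth_manifold_def by auto

lemma chart_inv_left: "c \<in> A \<Longrightarrow> x \<in> fst c \<Longrightarrow> chart_inv c (snd c x) = x"
  using chart_homeo homeomorphism_apply1 by blast

lemma open_chart_image:
  assumes "c \<in> A" "open W"
  shows "open (snd c ` (fst c \<inter> W))"
  using homeomorphism_imp_open_map[OF chart_homeo[OF assms(1)], of "fst c \<inter> W"] chart_image_open[OF assms(1)]
    assms(2) openin_open_trans by blast

lemma smooth_map_on_iff:
  assumes "open W"
  shows "smooth_map_on A W h \<longleftrightarrow>
    (\<forall>c\<in>A. \<forall>n. Ck_on n (snd c ` (fst c \<inter> W)) (\<lambda>u. h (chart_inv c u)))"
proof
  assume "smooth_map_on A W h"
  then show "\<forall>c\<in>A. \<forall>n. Ck_on n (snd c ` (fst c \<inter> W)) (\<lambda>u. h (chart_inv c u))"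
    using smooth_on_openD open_chart_image assms unfolding smooth_map_on_def o_def by blast
next
  assume *: "\<forall>c\<in>A. \<forall>n. Ck_on n (snd c ` (fst c \<inter> W)) (\<lambda>u. h (chart_inv c u))"
  show "smooth_map_on A W h"
    unfolding smooth_map_on_def smooth_on_def
  proof (intro ballI)
    fix c p assume c: "c \<in> A" and p: "p \<in> snd c ` (fst c \<inter> W)"
    show "\<exists>W' H. open W' \<and> p \<in> W' \<and> (\<forall>n. Ck_on n W' H) \<and>
        (\<forall>q\<in>snd c ` (fst c \<inter> W) \<inter> W'. (h \<circ> chart_inv c) q = H q)"
      using open_chart_image[OF c assms] p * c
      by (intro exI[of _ "snd c ` (fst c \<inter> W)"] exI[of _ "\<lambda>u. h (chart_inv c u)"]) auto
  qed
qed

lemma smooth_map_on_subset: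
  assumes "open W" "open W'" "W' \<subseteq> W" "smooth_map_on A W h"
  shows "smooth_map_on A W' h"
  using assms(4) unfolding smooth_map_on_iff[OF assms(1)] smooth_map_on_iff[OF assms(2)]
  using Ck_on_subset[of "snd c ` (fst c \<inter> W')" "snd c ` (fst c \<inter> W)" for c] assms(3)
  by (meson Int_mono image_mono order_refl)

lemma smooth_map_on_compose:
  fixes h :: "'a \<Rightarrow> 'b::euclidean_space" and k :: "'b \<Rightarrow> 'd::real_normed_vector"
  assumes "open W" "smooth_map_on A W h" "open \<Omega>" "h ` W \<subseteq> \<Omega>" "\<And>n. Ck_on n \<Omega> k"
  shows "smooth_map_on A W (\<lambda>x. k (h x))"
  unfolding smooth_map_on_iff[OF assms(1)]
proof (intro ballI allI)
  fix c n assume c: "c \<in> A"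
  have h: "Ck_on n (snd c ` (fst c \<inter> W)) (\<lambda>u. h (chart_inv c u))"
    using assms(2) c unfolding smooth_map_on_iff[OF assms(1)] by blast
  show "Ck_on n (snd c ` (fst c \<inter> W)) (\<lambda>u. k (h (chart_inv c u)))"
    by (rule Ck_on_compose[OF open_chart_image[OF c assms(1)] assms(3) _ h assms(5)])
      (use assms(4) chart_inv_left[OF c] in auto)
qed

lemma smooth_map_on_affine:
  assumes "open W" "smooth_map_on A W h" "bounded_linear T"
  shows "smooth_map_on A W (\<lambda>x. T (h x) + a)"
  unfolding smooth_map_on_iff[OF assms(1)]
proof (intro ballI allI)
  fix c n assume c: "c \<in> A"
  have "Ck_on n (snd c ` (fst c \<inter> W)) (\<lambda>u. h (chart_inv c u))"
    using assms(2) c unfolding smooth_map_on_iff[OF assms(1)] by blast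
  then show "Ck_on n (snd c ` (fst c \<inter> W)) (\<lambda>u. T (h (chart_inv c u)) + a)"
    using open_chart_image[OF c assms(1)]
    by (intro Ck_on_add[OF _ Ck_on_bounded_linear[OF assms(3)] Ck_on_const])
qed

lemma chart_deriv:
  assumes "open W" "smooth_map_on A W h" "c \<in> A" "x \<in> fst c" "x \<in> W"
  shows "((\<lambda>u. h (chart_inv c u)) has_derivative chart_deriv c h x) (at (snd c x))"
proof -
  have "Ck_on (Suc 0) (snd c ` (fst c \<inter> W)) (\<lambda>u. h (chart_inv c u))"
    using assms unfolding smooth_map_on_iff[OF assms(1)] by blast
  from Ck_on_has_derivative[OF this] show ?thesis
    using assms(4,5) by (simp add: chart_deriv_def[abs_def] o_def)
qed

lemma chart_deriv_eqI:
  assumes "((\<lambda>u. h (chart_inv c u)) has_derivative D) (at (snd c x))"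
  shows "chart_deriv c h x v = D v"
  using frechet_derivative_apply[OF assms] by (simp add: chart_deriv_def o_def)

lemma chart_deriv_chart_deriv:
  assumes "open W" "smooth_map_on A W h" "c \<in> A" "x \<in> fst c" "x \<in> W"
  shows "((\<lambda>u. chart_deriv c h (chart_inv c u) w) has_derivative
    chart_deriv c (\<lambda>y. chart_deriv c h y w) x) (at (snd c x))"
proof -
  let ?U = "snd c ` (fst c \<inter> W)"
  have "Ck_on (Suc (Suc 0)) ?U (\<lambda>u. h (chart_inv c u))"
    using assms unfolding smooth_map_on_iff[OF assms(1)] by blast
  then have "Ck_on (Suc 0) ?U (\<lambda>u. frechet_derivative (\<lambda>u. h (chart_inv c u)) (at u) w)"
    by (metis Ck_on.simps(2))
  then have "Ck_on (Suc 0) ?U (\<lambda>u. chart_deriv c h (chart_inv c u) w)"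
    by (rule Ck_on_cong[OF open_chart_image[OF assms(3,1)], rotated])
      (use chart_inv_left[OF assms(3)] in \<open>auto simp: chart_deriv_def o_def\<close>)
  from Ck_on_has_derivative[OF this] show ?thesis
    using assms(4,5) by (simp add: chart_deriv_def[of c "\<lambda>y. chart_deriv c h y w", abs_def] o_def)
qed

text \<open>\<open>chart_inv\<close> is a total function, so \<open>h\<close> composed with it stays
  in \<open>S\<close> along the whole coordinate line, also beyond the chart image. This supplies
  the globally defined curve that \<open>tangent_space\<close> demands.\<close>

lemma chart_deriv_tangent:
  assumes "smooth_map_on A UNIV h" "range h \<subseteq> S" "c \<in> A" "x \<in> fst c"
  shows "chart_deriv c h x v \<in> tangent_space S (h x)"
  using frechet_derivative_tangent[OF chart_deriv[OF open_UNIV assms(1,3,4) UNIV_I], of v S]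
    assms(2) chart_inv_left[OF assms(3,4)] by auto

text \<open>The chain rule through the transition map; with it, normality to an immersion can be
  checked in a single chart.\<close>

lemma chart_deriv_change:
  assumes "open W" "smooth_map_on A W h" "c \<in> A" "d \<in> A" "x \<in> fst c" "x \<in> fst d" "x \<in> W"
  shows "chart_deriv c h x v = chart_deriv d h x (chart_deriv c (snd d) x v)"
proof -
  let ?U = "snd c ` (fst c \<inter> fst d)"
  have o: "open ?U" by (rule open_chart_image[OF assms(3) chart_open[OF assms(4)]])
  have "smooth_on ?U (snd d \<circ> chart_inv c)"
    using mfd assms(3,4) unfolding smooth_manifold_def by blast
  then have "Ck_on (Suc 0) ?U (\<lambda>u. snd d (chart_inv c u))"
    using smooth_on_openD[OF o] by (simp add: o_def del: Ck_on.simps)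
  from Ck_on_has_derivative[OF this, of "snd c x"]
  have T: "((\<lambda>u. snd d (chart_inv c u)) has_derivative chart_deriv c (snd d) x) (at (snd c x))"
    using assms by (simp add: chart_deriv_def[abs_def] o_def)
  have D: "((\<lambda>u. h (chart_inv d u)) has_derivative chart_deriv d h x) (at (snd d (chart_inv c (snd c x))))"
    using chart_deriv[OF assms(1,2,4,6,7)] chart_inv_left[OF assms(3,5)] by simp
  have "((\<lambda>u. h (chart_inv d (snd d (chart_inv c u)))) has_derivative
      (\<lambda>v. chart_deriv d h x (chart_deriv c (snd d) x v))) (at (snd c x))"
    by (rule has_derivative_compose[OF T D])
  then have "((\<lambda>u. h (chart_inv c u)) has_derivative
      (\<lambda>v. chart_deriv d h x (chart_deriv c (snd d) x v))) (at (snd c x))"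
    by (rule has_derivative_transform_within_open[OF _ o])
      (use assms chart_inv_left[OF assms(3)] chart_inv_left[OF assms(4)] in auto)
  then show ?thesis by (rule chart_deriv_eqI)
qed

lemma smooth_map_continuous:
  assumes "smooth_map_on A UNIV h"
  shows "continuous_on UNIV h"
proof -
  have "continuous_on (fst c) h" if c: "c \<in> A" for c
  proof -
    have "continuous_on (snd c ` fst c) (\<lambda>u. h (chart_inv c u))"
      using assms c unfolding smooth_map_on_iff[OF open_UNIV] by (metis Ck_on.simps(1) Int_UNIV_right)
    moreover have "continuous_on (fst c) (snd c)" using chart_homeo[OF c] homeomorphism_def by blast
    ultimately have "continuous_on (fst c) (\<lambda>x. h (chart_inv c (snd c x)))"
      by (rule continuous_on_compose2) simp
    then show ?thesis by (rule continuous_on_eq) (simp add: chart_inv_left[OF c])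
  qed
  then have "continuous (at x) h" for x
    using chart_ex[of x] chart_open by (metis at_within_open continuous_on_eq_continuous_within)
  then show ?thesis by (simp add: continuous_at_imp_continuous_on)
qed

text \<open>The place where connectedness of the manifold enters. The values of \<open>h\<close>
  carry no topology, so the lemma covers families of subspaces as well as vector-valued
  maps.\<close>

lemma locally_constant_in_charts:
  assumes "\<And>x. \<exists>c\<in>A. x \<in> fst c \<and>
    (\<exists>r>0. \<forall>u\<in>ball (snd c x) r. u \<in> snd c ` fst c \<longrightarrow> h (chart_inv c u) = h x)"
  shows "h y = h z"
proof (rule connected_local_const[of UNIV])
  show "connected (UNIV :: 'a set)" using mfd unfolding smooth_manifold_def by blast
  show "\<forall>x\<in>UNIV. \<forall>\<^sub>F y in at x within UNIV. h x = h y"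
  proof
    fix x
    obtain c r where c: "c \<in> A" "x \<in> fst c" "r > 0"
      "\<And>u. u \<in> ball (snd c x) r \<Longrightarrow> u \<in> snd c ` fst c \<Longrightarrow> h (chart_inv c u) = h x"
      using assms by blast
    have "continuous_on (fst c) (snd c)" using chart_homeo[OF c(1)] homeomorphism_def by blast
    then have o: "open (fst c \<inter> snd c -` ball (snd c x) r)"
      by (rule continuous_open_preimage[OF _ chart_open[OF c(1)] open_ball])
    have "h x = h y" if "y \<in> fst c \<inter> snd c -` ball (snd c x) r" for y
      using c(4)[of "snd c y"] that chart_inv_left[OF c(1), of y] by auto
    then show "\<forall>\<^sub>F y in at x within UNIV. h x = h y"
      unfolding eventually_at_topological using o c(2,3)
      by (intro exI[of _ "fst c \<inter> snd c -` ball (snd c x) r"]) auto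
  qed
qed auto

text \<open>The frame is asked to span at its base point only. For the osculating spaces below, the
  frame is built from a basis at that point, so spanning is immediate there; at nearby points it
  follows from the constant dimension.\<close>

lemma parallel_subbundle_constant:
  fixes V :: "'a \<Rightarrow> 'e::euclidean_space set"
  assumes V: "\<And>x. subspace (V x)" "\<And>x. dim (V x) = n"
    and frame: "\<And>x. \<exists>W e. open W \<and> x \<in> W \<and> V x = span ((\<lambda>i. e i x) ` {..<n}) \<and>
      (\<forall>i<n. smooth_map_on A W (e i) \<and> (\<forall>y\<in>W. e i y \<in> V y) \<and>
        (\<forall>c\<in>A. \<forall>y\<in>fst c \<inter> W. \<forall>v. chart_deriv c (e i) y v \<in> V y))"
  shows "V y = V z"
proof (rule locally_constant_in_charts[of V])
  fix x
  obtain c where c: "c \<in> A" "x \<in> fst c" by (rule chart_ex)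
  obtain W e where *: "open W \<and> x \<in> W \<and> V x = span ((\<lambda>i. e i x) ` {..<n}) \<and>
      (\<forall>i<n. smooth_map_on A W (e i) \<and> (\<forall>y\<in>W. e i y \<in> V y) \<and>
        (\<forall>c\<in>A. \<forall>y\<in>fst c \<inter> W. \<forall>v. chart_deriv c (e i) y v \<in> V y))"
    using frame[of x] by (elim exE) rule
  then have W: "open W" "x \<in> W" and sp: "V x = span ((\<lambda>i. e i x) ` {..<n})"
    and e: "\<And>i. i < n \<Longrightarrow> smooth_map_on A W (e i)" "\<And>i y. i < n \<Longrightarrow> y \<in> W \<Longrightarrow> e i y \<in> V y"
      "\<And>i c y v. i < n \<Longrightarrow> c \<in> A \<Longrightarrow> y \<in> fst c \<Longrightarrow> y \<in> W \<Longrightarrow> chart_deriv c (e i) y v \<in> V y"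
    by simp_all
  let ?U = "snd c ` (fst c \<inter> W)"
  obtain r where r: "r > 0" "ball (snd c x) r \<subseteq> ?U"
    "\<And>u. u \<in> ball (snd c x) r \<Longrightarrow> V (chart_inv c u) = V (chart_inv c (snd c x))"
  proof (rule parallel_subspace_locally_constant[of ?U "snd c x" "\<lambda>u. V (chart_inv c u)" n
        "\<lambda>i u. e i (chart_inv c u)"])
    show "open ?U" by (rule open_chart_image[OF c(1) W(1)])
    show "snd c x \<in> ?U" using c W by blast
    show "Ck_on (Suc 0) ?U (\<lambda>u. e i (chart_inv c u))" if "i < n" for i
      using e(1)[OF that] c(1) unfolding smooth_map_on_iff[OF W(1)] by blast
    show "frechet_derivative (\<lambda>u. e i (chart_inv c u)) (at u) v \<in> V (chart_inv c u)"
      if i: "i < n" and u: "u \<in> ?U" for i u v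
    proof -
      obtain y where y: "y \<in> fst c" "y \<in> W" "u = snd c y" using u by blast
      have "chart_deriv c (e i) y v \<in> V y" by (rule e(3)[OF i c(1) y(1,2)])
      then show ?thesis using y chart_inv_left[OF c(1) y(1)] by (simp add: chart_deriv_def o_def)
    qed
    show "e i (chart_inv c u) \<in> V (chart_inv c u)" if "i < n" "u \<in> ?U" for i u
      using that e(2) chart_inv_left[OF c(1)] by auto
    show "V (chart_inv c (snd c x)) = span ((\<lambda>i. e i (chart_inv c (snd c x))) ` {..<n})"
      using sp chart_inv_left[OF c] by simp
    show "subspace (V (chart_inv c u))" "dim (V (chart_inv c u)) = n" for u
      by (rule V)+
  qed (rule that)
  have "V (chart_inv c u) = V x" if "u \<in> ball (snd c x) r" for u
    using r(3)[OF that] chart_inv_left[OF c] by simp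
  with c r(1) show "\<exists>c\<in>A. x \<in> fst c \<and>
      (\<exists>r>0. \<forall>u\<in>ball (snd c x) r. u \<in> snd c ` fst c \<longrightarrow> V (chart_inv c u) = V x)" by blast
qed

text \<open>For the flat case, where the first component of the immersion is confined to an affine
  subspace instead of a linear one.\<close>

lemma zero_derivative_constant:
  fixes h :: "'a \<Rightarrow> 'e::real_normed_vector"
  assumes "smooth_map_on A UNIV h" "\<And>c x v. c \<in> A \<Longrightarrow> x \<in> fst c \<Longrightarrow> chart_deriv c h x v = 0"
  shows "h y = h z"
proof (rule locally_constant_in_charts[of h])
  fix x
  obtain c where c: "c \<in> A" "x \<in> fst c" by (rule chart_ex)
  obtain r where r: "r > 0" "ball (snd c x) r \<subseteq> snd c ` fst c"
    using openE[OF chart_image_open[OF c(1)] imageI[OF c(2)]] by metis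
  have "((\<lambda>u. h (chart_inv c u)) has_derivative (\<lambda>v. 0)) (at u within ball (snd c x) r)"
    if u: "u \<in> ball (snd c x) r" for u
  proof -
    obtain y where y: "y \<in> fst c" "u = snd c y" using u r(2) by blast
    have "((\<lambda>u. h (chart_inv c u)) has_derivative chart_deriv c h y) (at u)"
      using chart_deriv[OF open_UNIV assms(1) c(1) y(1)] y(2) by simp
    moreover have "chart_deriv c h y = (\<lambda>v. 0)" using assms(2)[OF c(1) y(1)] by blast
    ultimately show ?thesis by (simp add: has_derivative_at_withinI)
  qed
  then have "\<exists>k. \<forall>u\<in>ball (snd c x) r. h (chart_inv c u) = k"
    by (intro has_derivative_zero_constant[OF convex_ball])
  then have "\<forall>u\<in>ball (snd c x) r. h (chart_inv c u) = h x"
    using r(1) chart_inv_left[OF c] by (metis centre_in_ball)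
  with c r(1) show "\<exists>c\<in>A. x \<in> fst c \<and>
      (\<exists>r>0. \<forall>u\<in>ball (snd c x) r. u \<in> snd c ` fst c \<longrightarrow> h (chart_inv c u) = h x)" by blast
qed

end

section \<open>Totally geodesic inclusions from linear isometries\<close>

text \<open>The image of the axis vector \<open>(1, 0)\<close> under the linear isometry built
  below: it spans the normal line at \<open>p\<close> and is scaled to have the same square as
  \<open>(1, 0)\<close>.\<close>

definition unit_vec :: "real \<Rightarrow> real \<times> 'e::euclidean_space \<Rightarrow> real \<times> 'e" where
  "unit_vec k p = (if k = 0 then (1, 0) else sqrt \<bar>k\<bar> *\<^sub>R p)"

text \<open>The translation part of the inclusion: totally geodesic subspaces of a curved
  hyperquadric are cut out by linear subspaces, those of flat space by affine ones.\<close>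

definition base_point :: "real \<Rightarrow> real \<times> 'e::euclidean_space \<Rightarrow> real \<times> 'e" where
  "base_point k p = (if k = 0 then p else 0)"

lemma unit_vec_square:
  assumes "p \<in> hyperquadric k B"
  shows "flat_form k (unit_vec k p) (unit_vec k p) = (if k < 0 then -1 else 1)"
proof (cases "k = 0")
  case True
  then show ?thesis by (simp add: unit_vec_def flat_form_def)
next
  case False
  then have "flat_form k p p = 1 / k" using assms by (simp add: hyperquadric_def)
  then show ?thesis using False by (simp add: unit_vec_def flat.lin_simps abs_if)
qed

lemma unit_vec_perp_iff:
  "flat_form k v (unit_vec k p) = 0 \<longleftrightarrow> flat_form k v (normal_vec k p) = 0"
  by (simp add: unit_vec_def normal_vec_def flat.lin_simps)

lemma sum_inner_span_Basis:
  assumes "B \<subseteq> Basis" "v \<in> span B"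
  shows "(\<Sum>i\<in>B. (v \<bullet> i) *\<^sub>R i) = (v :: 'e::euclidean_space)"
proof -
  have fin: "finite B" using assms(1) finite_Basis finite_subset by blast
  have z: "v \<bullet> j = 0" if "j \<in> Basis - B" for j
    using assms(2)
  proof (induction rule: span_induct_alt)
    case (step c x y)
    then have "x \<bullet> j = 0" using that assms(1) inner_Basis[of x j] by auto
    with step show ?case by (simp add: inner_add_left)
  qed simp
  have "(\<Sum>i\<in>B. (v \<bullet> i) *\<^sub>R i) = (\<Sum>i\<in>Basis. (v \<bullet> i) *\<^sub>R i)"
    by (rule sum.mono_neutral_left) (use assms(1) z in auto)
  then show ?thesis by (simp add: euclidean_representation)
qed

text \<open>The complement of \<open>N\<close> splits into the line of \<open>P\<close> and a
  subspace \<open>V\<close> of the tangent space at \<open>p\<close>. On \<open>V\<close> the form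
  is positive, so an orthonormal frame exists also in the Lorentzian case; \<open>J\<close> sends
  the axis to \<open>P\<close> and the members of \<open>B\<close> to the frame, and
  \<open>K\<close> reads off the coordinates.\<close>

lemma isometry_onto_complement:
  fixes p :: "real \<times> 'e::euclidean_space"
  assumes p: "p \<in> hyperquadric k Basis"
    and N: "subspace N" "dim N = l" "N \<subseteq> tangent_space (hyperquadric k Basis) p"
  obtains B :: "'e set" and J K :: "real \<times> 'e \<Rightarrow> real \<times> 'e"
  where "B \<subseteq> Basis" "card B + l = DIM('e)" "linear J" "linear K" "\<And>Z. snd (K Z) \<in> span B"
    "\<And>X Y. snd X \<in> span B \<Longrightarrow> snd Y \<in> span B \<Longrightarrow> flat_form k (J X) (J Y) = flat_form k X Y"
    "\<And>X. snd X \<in> span B \<Longrightarrow> K (J X) = X"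
    "\<And>Z. (\<And>n. n \<in> N \<Longrightarrow> flat_form k Z n = 0) \<Longrightarrow> J (K Z) = Z"
    "J (1, 0) = unit_vec k p"
proof -
  define P where "P = unit_vec k p"
  \<comment> \<open>\<epsilon> is the square of \<open>P\<close> and its own inverse, so the
    component of \<open>Z\<close> along \<open>P\<close> has the coefficient
    \<open>\<epsilon> * flat_form k Z P\<close>.\<close>
  define \<epsilon> where "\<epsilon> = (if k < 0 then -1 else (1::real))"
  have PP: "flat_form k P P = \<epsilon>" unfolding P_def \<epsilon>_def by (rule unit_vec_square[OF p])
  have \<epsilon>: "\<epsilon> * \<epsilon> = 1" "\<epsilon> \<noteq> 0" by (auto simp: \<epsilon>_def)
  have NP: "flat_form k n P = 0" if "n \<in> N" for n
    using that N(3) tangent_hyperquadric[OF p] by (auto simp: P_def unit_vec_perp_iff)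
  have NP': "flat_form k P n = 0" if "n \<in> N" for n using NP[OF that] flat.sym[of k P n] by simp
  have "P \<notin> span N" using NP[of P] PP \<epsilon> span_eq_iff[of N] N(1) by metis
  then have dP: "dim (span (insert P N)) = l + 1" using N(2) by (simp add: dim_insert)
  define V where "V = {v. \<forall>w\<in>span (insert P N). flat_form k v w = 0}"
  have sV: "subspace V" unfolding V_def by (rule flat.subspace_perp)
  have dV: "dim V + (l + 1) = DIM('e) + 1"
    using dim_flat_perp[of "span (insert P N)" k] dP by (simp add: V_def)
  have VP: "flat_form k v P = 0" "flat_form k P v = 0" if "v \<in> V" for v
    using that flat.sym[of k P v] by (auto simp: V_def span_base)
  have "V \<subseteq> tangent_space (hyperquadric k Basis) p"
    unfolding tangent_hyperquadric[OF p] using VP by (auto simp: P_def unit_vec_perp_iff)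
  then have pV: "flat.positive_on k V"
    using flat.positive_on_subset tangent_hyperquadric_positive[OF p] by blast
  have mem_V: "Z - (\<epsilon> * flat_form k Z P) *\<^sub>R P \<in> V" if Z: "\<And>n. n \<in> N \<Longrightarrow> flat_form k Z n = 0" for Z
  proof -
    have "subspace {w. flat_form k (Z - (\<epsilon> * flat_form k Z P) *\<^sub>R P) w = 0}"
      by (auto simp: subspace_def flat.lin_simps distrib_left)
    moreover have "insert P N \<subseteq> {w. flat_form k (Z - (\<epsilon> * flat_form k Z P) *\<^sub>R P) w = 0}"
      using Z NP' PP \<epsilon>(1) by (auto simp: flat.lin_simps)
    ultimately show ?thesis unfolding V_def using span_minimal by blast
  qed
  obtain E where E: "\<And>i. i < dim V \<Longrightarrow> E i \<in> V"
    "\<And>i j. i < dim V \<Longrightarrow> j < dim V \<Longrightarrow> flat_form k (E i) (E j) = (if i = j then 1 else 0)"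
    "\<And>v. v \<in> V \<Longrightarrow> v = (\<Sum>i<dim V. flat_form k v (E i) *\<^sub>R E i)"
    using flat.orthonormal_frame[OF sV pV refl] by blast
  \<comment> \<open>Any set of basis vectors of the right size can carry the coordinates of the
    model.\<close>
  have "dim V \<le> card (Basis :: 'e set)" using dV by simp
  then obtain B :: "'e set" where B: "B \<subseteq> Basis" "card B = dim V" "finite B"
    by (rule obtain_subset_with_card_n)
  obtain h where h: "bij_betw h {..<dim V} B"
    using ex_bij_betw_nat_finite[OF B(3)] B(2) by (auto simp: atLeast0LessThan)
  define F where "F i = E (inv_into {..<dim V} h i)" for i
  have hi: "inv_into {..<dim V} h i < dim V" "h (inv_into {..<dim V} h i) = i" if "i \<in> B" for i
    using that bij_betw_inv_into[OF h] bij_betw_inv_into_right[OF h] by (auto simp: bij_betw_def)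
  have F: "F i \<in> V" if "i \<in> B" for i using E(1) hi that by (simp add: F_def)
  have FF: "flat_form k (F i) (F j) = (if i = j then 1 else 0)" if "i \<in> B" "j \<in> B" for i j
  proof -
    have "inv_into {..<dim V} h i = inv_into {..<dim V} h j \<longleftrightarrow> i = j"
      using hi(2)[OF that(1)] hi(2)[OF that(2)] by metis
    then show ?thesis
      using E(2)[OF hi(1)[OF that(1)] hi(1)[OF that(2)]] by (simp add: F_def)
  qed
  have Fexp: "(\<Sum>i\<in>B. flat_form k v (F i) *\<^sub>R F i) = v" if "v \<in> V" for v
  proof -
    have "(\<Sum>i\<in>B. flat_form k v (F i) *\<^sub>R F i) = (\<Sum>i<dim V. flat_form k v (F (h i)) *\<^sub>R F (h i))"
      by (rule sum.reindex_bij_betw[OF h, symmetric])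
    also have "\<dots> = (\<Sum>i<dim V. flat_form k v (E i) *\<^sub>R E i)"
      by (rule sum.cong) (use h in \<open>auto simp: F_def bij_betw_inv_into_left\<close>)
    finally show ?thesis using E(3)[OF that] by simp
  qed
  define J where "J X = fst X *\<^sub>R P + (\<Sum>i\<in>B. (snd X \<bullet> i) *\<^sub>R F i)" for X :: "real \<times> 'e"
  define K where "K Z = (\<epsilon> * flat_form k Z P, \<Sum>i\<in>B. flat_form k Z (F i) *\<^sub>R i)" for Z
  have linJ: "linear J"
    by (rule linearI) (simp_all add: J_def inner_add_left scaleR_add_left sum.distrib scaleR_add_right scaleR_sum_right)
  have linK: "linear K"
    by (rule linearI) (simp_all add: K_def flat.lin_simps algebra_simps sum.distrib scaleR_sum_right)
  have JP: "flat_form k (J X) P = \<epsilon> * fst X" for X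
    by (simp add: J_def flat.lin_simps flat.sum_left PP VP F)
  have JF: "flat_form k (J X) (F i) = snd X \<bullet> i" if i: "i \<in> B" for X i
  proof -
    have "flat_form k (J X) (F i) = (\<Sum>j\<in>B. (snd X \<bullet> j) * flat_form k (F j) (F i))"
      using VP(2)[OF F[OF i]] by (simp add: J_def flat.lin_simps flat.sum_left)
    also have "\<dots> = (\<Sum>j\<in>B. if j = i then snd X \<bullet> j else 0)"
      by (rule sum.cong) (use FF i in auto)
    finally show ?thesis using i B(3) by simp
  qed
  show ?thesis
  proof (rule that[OF B(1) _ linJ linK])
    show "card B + l = DIM('e)" using B(2) dV by simp
    show "snd (K Z) \<in> span B" for Z
      unfolding K_def snd_conv by (intro span_sum span_scale span_base)
    show "flat_form k (J X) (J Y) = flat_form k X Y" if "snd X \<in> span B" "snd Y \<in> span B" for X Y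
    proof -
      have "flat_form k (J X) (J Y) = fst Y * (\<epsilon> * fst X) + (\<Sum>i\<in>B. (snd Y \<bullet> i) * (snd X \<bullet> i))"
        by (subst (2) J_def) (simp add: flat.lin_simps flat.sum_right JP JF)
      also have "(\<Sum>i\<in>B. (snd Y \<bullet> i) * (snd X \<bullet> i)) = snd X \<bullet> (\<Sum>i\<in>B. (snd Y \<bullet> i) *\<^sub>R i)"
        by (simp add: inner_sum_right)
      also have "\<dots> = snd X \<bullet> snd Y" using sum_inner_span_Basis[OF B(1) that(2)] by simp
      finally show ?thesis by (simp add: flat_form_def \<epsilon>_def mult_ac)
    qed
    show "K (J X) = X" if "snd X \<in> span B" for X
      using sum_inner_span_Basis[OF B(1) that] \<epsilon>(1)
      by (simp add: K_def JP JF prod_eq_iff mult.assoc[symmetric])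
    show "J (K Z) = Z" if Z: "\<And>n. n \<in> N \<Longrightarrow> flat_form k Z n = 0" for Z
    proof -
      define w where "w = Z - (\<epsilon> * flat_form k Z P) *\<^sub>R P"
      have w: "w \<in> V" unfolding w_def by (rule mem_V[OF Z])
      have "flat_form k Z (F i) = flat_form k w (F i)" if "i \<in> B" for i
        using VP(2)[OF F[OF that]] by (simp add: w_def flat.lin_simps)
      moreover have "(\<Sum>j\<in>B. flat_form k Z (F j) *\<^sub>R j) \<bullet> i = flat_form k Z (F i)" if i: "i \<in> B" for i
      proof -
        have "(\<Sum>j\<in>B. flat_form k Z (F j) *\<^sub>R j) \<bullet> i = (\<Sum>j\<in>B. if j = i then flat_form k Z (F j) else 0)"
          unfolding inner_sum_left
          by (rule sum.cong) (use B(1) i in \<open>auto simp: inner_Basis subset_iff\<close>)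
        then show ?thesis using i B(3) by simp
      qed
      ultimately have "(\<Sum>i\<in>B. (snd (K Z) \<bullet> i) *\<^sub>R F i) = (\<Sum>i\<in>B. flat_form k w (F i) *\<^sub>R F i)"
        by (intro sum.cong) (auto simp: K_def)
      then have "J (K Z) = (\<epsilon> * flat_form k Z P) *\<^sub>R P + w"
        using Fexp[OF w] by (simp add: J_def K_def)
      then show ?thesis by (simp add: w_def)
    qed
    show "J (1, 0) = unit_vec k p" by (simp add: J_def P_def)
  qed
qed

section \<open>The inclusion attached to a linear isometry\<close>

locale standard_inclusion =
  fixes k :: real and p :: "real \<times> 'e::euclidean_space" and B :: "'e set"
    and J K :: "real \<times> 'e \<Rightarrow> real \<times> 'e"
  assumes p: "p \<in> hyperquadric k Basis" and linJ: "linear J" and linK: "linear K"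
    and K_span: "snd (K Z) \<in> span B"
    and iso: "snd X \<in> span B \<Longrightarrow> snd Y \<in> span B \<Longrightarrow> flat_form k (J X) (J Y) = flat_form k X Y"
    and KJ: "snd X \<in> span B \<Longrightarrow> K (J X) = X"
    and J1: "J (1, 0) = unit_vec k p"
begin

definition incl :: "real \<times> 'e \<Rightarrow> real \<times> 'e" where
  "incl X = J X + base_point k p"

text \<open>The isometry preserves the defining equation; for \<open>k < 0\<close> the sheet
  remains, which \<open>timelike_sign\<close> reads off against \<open>p\<close>. The direction from
  left to right later places the reduced map in the smaller hyperquadric.\<close>

lemma incl_in_iff:
  assumes X: "snd X \<in> span B"
  shows "incl X \<in> hyperquadric k Basis \<longleftrightarrow> X \<in> hyperquadric k B"
proof -
  have e: "snd ((1, 0) :: real \<times> 'e) \<in> span B" by (simp add: span_zero)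
  have JP: "flat_form k (J X) (unit_vec k p) = (if k < 0 then -1 else 1) * fst X"
    using iso[OF X e] J1 by (simp add: flat_form_def)
  show ?thesis
  proof (cases "k = 0")
    case True
    then have "fst (J X) = fst X" using JP by (simp add: unit_vec_def flat_form_def)
    then show ?thesis
      unfolding incl_def base_point_def hyperquadric_def using True p X by (simp add: hyperquadric_def)
  next
    case False
    have sq: "flat_form k (incl X) (incl X) = flat_form k X X"
      using iso[OF X X] False by (simp add: incl_def base_point_def)
    have "fst (incl X) > 0 \<longleftrightarrow> fst X > 0" if k: "k < 0" and X2: "flat_form k X X = 1 / k"
    proof -
      have p2: "flat_form k p p = 1 / k" "fst p > 0" using p k by (auto simp: hyperquadric_def)
      have "fst (incl X) > 0 \<longleftrightarrow> flat_form k (incl X) p < 0"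
        by (rule timelike_sign[OF k]) (use sq X2 k p2 in \<open>auto simp: divide_pos_neg\<close>)
      \<comment> \<open>A positive multiple of \<open>p\<close> is \<open>J (1, 0)\<close>, so
        pairing with \<open>p\<close> returns the first coordinate of \<open>X\<close> up to sign
        and a positive factor.\<close>
      also have "sqrt \<bar>k\<bar> * flat_form k (incl X) p = - fst X"
        using JP k by (simp add: unit_vec_def flat.lin_simps incl_def base_point_def)
      then have "fst X = - (sqrt \<bar>k\<bar> * flat_form k (incl X) p)" by simp
      then have "flat_form k (incl X) p < 0 \<longleftrightarrow> fst X > 0"
        using k by (simp add: mult_less_0_iff)
      finally show ?thesis .
    qed
    then show ?thesis using False X sq by (auto simp: hyperquadric_def)
  qed
qed

lemma incl_in: "X \<in> hyperquadric k B \<Longrightarrow> incl X \<in> hyperquadric k Basis"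
  using incl_in_iff by (auto simp: hyperquadric_def)

text \<open>The reason for total geodesy: the derivative of a tangent field leaves the tangent space
  only along this normal, whose image is normal to the large hyperquadric.\<close>

lemma normal_vec_incl: "normal_vec k (incl X) = J (normal_vec k X)"
  using J1 by (simp add: normal_vec_def incl_def unit_vec_def base_point_def)

lemma incl_has_derivative: "(incl has_derivative J) (at X within S)"
proof -
  have "bounded_linear J" using linJ linear_conv_bounded_linear by blast
  from bounded_linear_imp_has_derivative[OF this]
  show ?thesis unfolding incl_def[abs_def] by (auto intro!: derivative_eq_intros)
qed

lemma fd_incl:
  "v \<in> tangent_space S X \<Longrightarrow> frechet_derivative incl (at X within S) v = J v"
  by (rule frechet_derivative_within_tangent[OF incl_has_derivative])

lemma K_incl: "snd X \<in> span B \<Longrightarrow> K (incl X - base_point k p) = X"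
  by (simp add: incl_def KJ)

lemma incl_isometric_embedding:
  "isometric_embedding (flat_form k) (hyperquadric k B) (flat_form k) (hyperquadric k Basis) incl"
  unfolding isometric_embedding_def
proof (intro conjI ballI)
  let ?S = "hyperquadric k B"
  show "incl ` ?S \<subseteq> hyperquadric k Basis" using incl_in by blast
  have bJ: "bounded_linear J" using linJ linear_conv_bounded_linear by blast
  show "smooth_on ?S incl"
    unfolding incl_def[abs_def]
    by (rule smooth_onI)
      (intro Ck_on_add[OF open_UNIV Ck_on_bounded_linear[OF bJ open_UNIV Ck_on_ident] Ck_on_const])
  \<comment> \<open>Continuity of the inverse is visible through this explicit formula.\<close>
  have inv: "inv_into ?S incl Z = K (Z - base_point k p)" if Z: "Z \<in> incl ` ?S" for Z
  proof -
    obtain X where X: "X \<in> ?S" "Z = incl X" using Z by blast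
    have "inj_on incl ?S"
      by (rule inj_on_inverseI[of _ "\<lambda>Z. K (Z - base_point k p)"])
        (auto simp: hyperquadric_def intro!: K_incl)
    then have "inv_into ?S incl Z = X" using X by simp
    then show ?thesis using X K_incl by (simp add: hyperquadric_def)
  qed
  show "homeomorphism ?S (incl ` ?S) incl (inv_into ?S incl)"
  proof (rule homeomorphismI)
    show "continuous_on ?S incl"
      by (rule has_derivative_continuous_on[OF incl_has_derivative])
    have "continuous_on (incl ` ?S) (\<lambda>Z. K (Z - base_point k p))"
      by (intro continuous_on_compose2[OF linear_continuous_on[of K UNIV]] continuous_intros)
        (use linK linear_conv_bounded_linear in auto)
    then show "continuous_on (incl ` ?S) (inv_into ?S incl)"
      by (rule continuous_on_eq) (simp add: inv)
    show "inv_into ?S incl ` incl ` ?S \<subseteq> ?S" by (auto simp: inv_into_into)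
    show "inv_into ?S incl (incl X) = X" if "X \<in> ?S" for X
      using inv[of "incl X"] that K_incl by (auto simp: hyperquadric_def)
    show "incl (inv_into ?S incl Z) = Z" if "Z \<in> incl ` ?S" for Z
      using that by (rule f_inv_into_f)
  qed simp
  fix X v w assume X: "X \<in> ?S" and v: "v \<in> tangent_space ?S X" and w: "w \<in> tangent_space ?S X"
  show "flat_form k (frechet_derivative incl (at X within ?S) v)
      (frechet_derivative incl (at X within ?S) w) = flat_form k v w"
    unfolding fd_incl[OF v] fd_incl[OF w]
    by (rule iso) (use tangent_hyperquadric[OF X] v w in auto)
qed

text \<open>The differential of the inclusion is the fixed map \<open>J\<close>, so the derivative
  of the image of \<open>Y\<close> is \<open>J\<close> of the derivative of \<open>Y\<close>. The
  latter is a tangent vector plus a multiple of the normal, and \<xi> is orthogonal to the images of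
  both.\<close>

lemma incl_totally_geodesic:
  "totally_geodesic (hyperquadric k B) (flat_form k) (hyperquadric k Basis) incl"
  unfolding totally_geodesic_def
proof (intro allI impI ballI)
  let ?S = "hyperquadric k B"
  fix Y q X
  assume Y: "smooth_on ?S Y" "\<forall>q\<in>?S. Y q \<in> tangent_space ?S q"
    and q: "q \<in> ?S" and X: "X \<in> tangent_space ?S q"
  let ?N = "{\<xi> \<in> tangent_space (hyperquadric k Basis) (incl q).
    \<forall>v\<in>tangent_space ?S q. flat_form k \<xi> (frechet_derivative incl (at q within ?S) v) = 0}"
  let ?Z = "frechet_derivative (\<lambda>r. frechet_derivative incl (at r within ?S) (Y r)) (at q within ?S) X"
  have N: "?N = {\<xi> \<in> tangent_space (hyperquadric k Basis) (incl q).
      \<forall>v\<in>tangent_space ?S q. flat_form k \<xi> (J v) = 0}"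
    using fd_incl by auto
  obtain W H where W: "open W" "q \<in> W" "\<And>n. Ck_on n W H" "\<And>r. r \<in> ?S \<inter> W \<Longrightarrow> Y r = H r"
    using Y(1) q unfolding smooth_on_def by metis
  have HD: "(H has_derivative frechet_derivative H (at q)) (at q)"
    using Ck_on_has_derivative[OF W(3) W(2)] .
  have YD: "(Y has_derivative frechet_derivative H (at q)) (at q within ?S)"
    by (rule has_derivative_local_extension[OF W(1) q W(2) HD W(4)])
  have bJ: "bounded_linear J" using linJ linear_conv_bounded_linear by blast
  have D: "((\<lambda>r. J (Y r)) has_derivative (\<lambda>v. J (frechet_derivative H (at q) v))) (at q within ?S)"
    by (rule bounded_linear.has_derivative[OF bJ YD])
  have D': "((\<lambda>r. frechet_derivative incl (at r within ?S) (Y r)) has_derivative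
      (\<lambda>v. J (frechet_derivative H (at q) v))) (at q within ?S)"
    by (rule has_derivative_transform[OF q _ D]) (use fd_incl Y(2) in auto)
  have Z: "?Z = J (frechet_derivative H (at q) X)"
    by (rule frechet_derivative_within_tangent[OF D' X])
  \<comment> \<open>\<open>Y\<close> is constrained on the hyperquadric only, so the derivative of
    its extension \<open>H\<close> is examined along a curve in the set with velocity
    \<open>X\<close>.\<close>
  have snd: "snd (frechet_derivative H (at q) X) \<in> span B"
  proof -
    obtain \<gamma> where g: "range \<gamma> \<subseteq> ?S" "\<gamma> (0::real) = q" "(\<gamma> has_derivative (\<lambda>t. t *\<^sub>R X)) (at 0)"
      by (rule tangent_spaceE[OF X])
    from has_derivative_subset[OF YD g(1)]
    have "((\<lambda>t. Y (\<gamma> t)) has_derivative (\<lambda>t. frechet_derivative H (at q) (t *\<^sub>R X))) (at 0)"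
      using has_derivative_in_compose[OF g(3)] g(2) by auto
    then have "frechet_derivative H (at q) (1 *\<^sub>R X) \<in> {v. snd v \<in> span B}"
      by (rule has_derivative_in_subspace[OF subspace_snd_span open_UNIV UNIV_I, rotated])
        (use g(1) Y(2) tangent_hyperquadric in blast)
    then show ?thesis by simp
  qed
  have "subspace ?N" "flat.positive_on k ?N"
    unfolding N using subspace_tangent_hyperquadric[OF incl_in[OF q]]
      tangent_hyperquadric_positive[OF incl_in[OF q]]
    by (auto simp: subspace_def flat.lin_simps flat.positive_on_def)
  moreover have "flat_form k ?Z \<xi> = 0" if \<xi>: "\<xi> \<in> ?N" for \<xi>
  proof -
    let ?n = "normal_vec k q" and ?z = "frechet_derivative H (at q) X"
    \<comment> \<open>The coefficient of the normal vector; the denominator is nonzero for every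
      sign of \<open>k\<close>.\<close>
    define a where "a = flat_form k ?z ?n / flat_form k ?n ?n"
    have "?z - a *\<^sub>R ?n \<in> tangent_space ?S q"
      unfolding tangent_hyperquadric[OF q]
      using snd snd_normal_vec[OF q] normal_vec_square_nz[OF q]
      by (simp add: flat.lin_simps a_def span_diff span_scale)
    then have "flat_form k \<xi> (J (?z - a *\<^sub>R ?n)) = 0" using \<xi> unfolding N by blast
    moreover have "flat_form k \<xi> (J ?n) = 0"
      using \<xi> tangent_hyperquadric[OF incl_in[OF q]] normal_vec_incl by auto
    ultimately show ?thesis
      unfolding Z using flat.sym[of k "J ?z" \<xi>] by (simp add: linear_diff[OF linJ] linear_scale[OF linJ] flat.lin_simps)
  qed
  ultimately show "orth_proj (flat_form k) ?N ?Z = 0" by (simp add: flat.orth_proj_eq_0_iff)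
qed

end

section \<open>From parallel subbundles to reduction of codimension\<close>

locale product_immersion = smooth_mfd A
  for A :: "('a::{t2_space,second_countable_topology}, 'c::euclidean_space) chart set" +
  fixes g :: "('a, 'c) metric" and k1 k2 :: real
    and f :: "'a \<Rightarrow> ('e1::euclidean_space, 'e2::euclidean_space) flat_product"
  assumes imm: "isometric_immersion A g (prod_form k1 k2) (space_form_product k1 k2) f"
begin

abbreviation b where "b \<equiv> prod_form k1 k2"
abbreviation M1 :: "(real \<times> 'e1) set" where "M1 \<equiv> hyperquadric k1 Basis"
abbreviation M2 :: "(real \<times> 'e2) set" where "M2 \<equiv> hyperquadric k2 Basis"
abbreviation N where "N x \<equiv> normal_space A b (space_form_product k1 k2) f x"

lemma f_in: "f x \<in> M1 \<times> M2" "fst (f x) \<in> M1" "snd (f x) \<in> M2"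
  using imm unfolding isometric_immersion_def space_form_product_def by (auto simp: mem_Times_iff image_subset_iff)

lemma f_smooth: "smooth_map_on A UNIV f"
  using imm unfolding isometric_immersion_def by blast

lemma f_isometric: "c \<in> A \<Longrightarrow> x \<in> fst c \<Longrightarrow> b (chart_deriv c f x v) (chart_deriv c f x w) = g c x v w"
  using imm unfolding isometric_immersion_def by blast

lemma df:
  assumes "c \<in> A" "x \<in> fst c"
  shows "((\<lambda>u. f (chart_inv c u)) has_derivative chart_deriv c f x) (at (snd c x))"
  by (rule chart_deriv[OF open_UNIV f_smooth assms UNIV_I])

lemma tangent_eq:
  "tangent_space (space_form_product k1 k2) (f x) = tangent_space M1 (fst (f x)) \<times> tangent_space M2 (snd (f x))"
  unfolding space_form_product_def tangent_space_Times ..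

lemma tangent_M1: "tangent_space M1 (fst (f x)) = {v. flat_form k1 v (normal_vec k1 (fst (f x))) = 0}"
  using tangent_hyperquadric[OF f_in(2)] by simp

lemma N_eq: "N x = {\<xi> \<in> tangent_space (space_form_product k1 k2) (f x).
    \<forall>c\<in>A. x \<in> fst c \<longrightarrow> (\<forall>v. b \<xi> (chart_deriv c f x v) = 0)}"
  by (simp add: normal_space_def)

lemma subspace_N: "subspace (N x)"
  using space_form_product_tangent(1)[OF f_in(1)[of x]]
  unfolding N_eq unfolding space_form_product_def by (auto simp: subspace_def prod.lin_simps)

lemma positive_N: "prod.positive_on k1 k2 (N x)"
  by (rule prod.positive_on_subset[OF space_form_product_tangent(2)[OF f_in(1)[of x]]])
    (unfold N_eq, auto simp: space_form_product_def)

lemma N_chartI: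
  assumes "c \<in> A" "x \<in> fst c" "\<xi> \<in> tangent_space (space_form_product k1 k2) (f x)"
    "\<And>v. b \<xi> (chart_deriv c f x v) = 0"
  shows "\<xi> \<in> N x"
proof -
  have "b \<xi> (chart_deriv d f x v) = 0" if "d \<in> A" "x \<in> fst d" for d v
    using assms(4) chart_deriv_change[OF open_UNIV f_smooth that(1) assms(1) that(2) assms(2) UNIV_I, of v]
    by metis
  then show ?thesis unfolding N_eq using assms(3) by blast
qed

lemma N_perp: "\<xi> \<in> N x \<Longrightarrow> c \<in> A \<Longrightarrow> x \<in> fst c \<Longrightarrow> b \<xi> (chart_deriv c f x v) = 0"
  by (simp add: N_eq)

text \<open>The flat second derivative and its normal projection differ by a vector orthogonal to
  the normal space. Conditions on the first normal space thus become accessible to flat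
  calculus.\<close>

lemma second_ff_perp_iff:
  assumes "\<xi> \<in> N x"
  shows "b \<xi> (second_ff A b (space_form_product k1 k2) f c x v w) = 0 \<longleftrightarrow>
    b \<xi> (chart_deriv c (\<lambda>y. chart_deriv c f y w) x v) = 0"
proof -
  let ?Z = "chart_deriv c (\<lambda>y. chart_deriv c f y w) x v"
  have "b \<xi> (?Z - orth_proj b (N x) ?Z) = 0"
    by (subst prod.sym) (rule prod.orth_proj_perp[OF subspace_N positive_N assms])
  then show ?thesis by (simp add: second_ff_def prod.lin_simps)
qed

text \<open>The pairing of \<xi> with its image under \<open>T\<close> is the square of the second
  component of \<xi>, and the form is positive definite on the tangent space where that component
  lies.\<close>

lemma kernel_T_snd:
  assumes "\<xi> \<in> kernel_T A k1 k2 f x"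
  shows "snd \<xi> = 0"
proof -
  have \<xi>: "\<xi> \<in> N x" "tensor_T A k1 k2 f x \<xi> = 0" using assms by (auto simp: kernel_T_def)
  let ?V = "{0 :: real \<times> 'e1} \<times> tangent_space M2 (snd (f x))"
  have s: "snd \<xi> \<in> tangent_space M2 (snd (f x))" using \<xi>(1) by (auto simp: N_eq tangent_eq)
  have "pi2 k1 k2 (f x) \<xi> = (0, snd \<xi>)"
    unfolding pi2_def
  proof (rule prod.orth_proj_eqI)
    show "subspace ?V"
      by (intro subspace_Times subspace_tangent_hyperquadric f_in) simp
    show "prod.positive_on k1 k2 ?V"
      by (rule prod.positive_on_subset[OF space_form_product_tangent(2)[OF f_in(1)[of x]]])
        (use subspace_0[OF subspace_tangent_hyperquadric[OF f_in(2)]] in \<open>auto simp: tangent_space_Times\<close>)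
    show "(0, snd \<xi>) \<in> ?V" using s by simp
    show "b (\<xi> - (0, snd \<xi>)) u = 0" if "u \<in> ?V" for u
      using that by (auto simp: prod_form_def flat.lin_simps)
  qed
  then have "orth_proj b (N x) (0, snd \<xi>) = 0" using \<xi>(2) by (simp add: tensor_T_def)
  then have "b (0, snd \<xi>) \<xi> = 0"
    using \<xi>(1) unfolding prod.orth_proj_eq_0_iff[OF subspace_N positive_N] by blast
  then have "flat_form k2 (snd \<xi>) (snd \<xi>) = 0" by (simp add: prod_form_def flat.lin_simps)
  then show ?thesis using tangent_hyperquadric_nonneg[OF f_in(3) s] by blast
qed

lemma normal_vec_smooth: "smooth_map_on A UNIV (\<lambda>x. normal_vec k1 (fst (f x)))"
proof (cases "k1 = 0")
  case True
  then show ?thesis by (simp add: normal_vec_def smooth_map_on_iff Ck_on_const)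
next
  case False
  then show ?thesis
    using smooth_map_on_affine[OF open_UNIV f_smooth bounded_linear_fst, of 0] by (simp add: normal_vec_def)
qed

lemma chart_deriv_normal_vec:
  assumes "c \<in> A" "x \<in> fst c"
  shows "chart_deriv c (\<lambda>x. normal_vec k1 (fst (f x))) x v = (if k1 = 0 then 0 else fst (chart_deriv c f x v))"
proof (cases "k1 = 0")
  case True
  have "chart_deriv c (\<lambda>x. normal_vec k1 (fst (f x))) x v = 0"
    unfolding normal_vec_def True by (rule chart_deriv_eqI) simp
  then show ?thesis using True by simp
next
  case False
  have "chart_deriv c (\<lambda>x. normal_vec k1 (fst (f x))) x v = fst (chart_deriv c f x v)"
    by (rule chart_deriv_eqI) (use False has_derivative_fst[OF df[OF assms]] in \<open>simp add: normal_vec_def\<close>)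
  then show ?thesis using False by simp
qed

text \<open>The derivative of a section of \<open>L\<close> has no component tangent to \<open>f\<close> (as \<open>L \<subseteq> N\<^sub>1\<^sup>\<bottom>\<close>) and none
  normal to the product of the space forms (as \<open>L \<subseteq> U\<close>); thus it is its own normal component.\<close>

lemma section_deriv_normal:
  assumes W: "open W" and \<xi>: "smooth_map_on A W \<xi>"
    and ker: "\<And>y. y \<in> W \<Longrightarrow> \<xi> y \<in> kernel_T A k1 k2 f y"
    and perp: "\<And>y. y \<in> W \<Longrightarrow> \<xi> y \<in> first_normal_perp A b (space_form_product k1 k2) f y"
    and c: "c \<in> A" and x: "x \<in> fst c" "x \<in> W"
  shows "chart_deriv c \<xi> x v \<in> N x"
proof -
  let ?Z = "chart_deriv c \<xi> x v" and ?U = "snd c ` (fst c \<inter> W)"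
  have U: "open ?U" "snd c x \<in> ?U" using open_chart_image[OF c W] x by auto
  have inv: "chart_inv c u \<in> fst c \<and> chart_inv c u \<in> W" if "u \<in> ?U" for u
    using that chart_inv_left[OF c] by auto
  have D\<xi>: "((\<lambda>u. \<xi> (chart_inv c u)) has_derivative chart_deriv c \<xi> x) (at (snd c x))"
    by (rule chart_deriv[OF W \<xi> c x])
  have cx: "chart_inv c (snd c x) = x" by (rule chart_inv_left[OF c x(1)])
  have s0: "snd (\<xi> y) = 0" if "y \<in> W" for y by (rule kernel_T_snd[OF ker[OF that]])
  have N\<xi>: "\<xi> y \<in> N y" if "y \<in> W" for y using ker[OF that] by (simp add: kernel_T_def)
  have "subspace {z :: (real \<times> 'e1) \<times> real \<times> 'e2. snd z = 0}" by (auto simp: subspace_def)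
  from has_derivative_in_subspace[OF this U _ D\<xi>, of v] have sZ: "snd ?Z = 0"
    using s0 inv by blast
  \<comment> \<open>The orthogonality of \<xi> to the ambient normal is differentiated. The
    derivative of that normal is the first component of the differential of \<open>f\<close>, or 0
    if \<open>k1 = 0\<close>; \<xi> is orthogonal to it, being normal to \<open>f\<close> with no
    second component.\<close>
  have "fst ?Z \<in> tangent_space M1 (fst (f x))"
  proof -
    let ?n = "\<lambda>y. (normal_vec k1 (fst (f y)), 0) :: ('e1, 'e2) flat_product"
    have Dn: "((\<lambda>u. ?n (chart_inv c u)) has_derivative
        (\<lambda>v. (chart_deriv c (\<lambda>x. normal_vec k1 (fst (f x))) x v, 0))) (at (snd c x))"
      by (intro has_derivative_Pair chart_deriv[OF open_UNIV normal_vec_smooth c x(1) UNIV_I] has_derivative_const)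
    have "b (\<xi> y) (?n y) = 0" if "y \<in> W" for y
      using N\<xi>[OF that] by (auto simp: N_eq tangent_eq tangent_M1 prod_form_def flat.lin_simps)
    then have "b (\<xi> (chart_inv c u)) (?n (chart_inv c u)) = 0" if "u \<in> ?U" for u
      using inv[OF that] by blast
    from has_derivative_locally_constant[OF U this prod.has_derivative_form[OF D\<xi> Dn], of v]
    have "b (\<xi> x) (chart_deriv c (\<lambda>x. normal_vec k1 (fst (f x))) x v, 0) + b ?Z (?n x) = 0"
      by (simp add: cx)
    moreover have "b (\<xi> x) (chart_deriv c (\<lambda>x. normal_vec k1 (fst (f x))) x v, 0) = 0"
      using N_perp[OF N\<xi>[OF x(2)] c x(1), of v] s0[OF x(2)]
      unfolding chart_deriv_normal_vec[OF c x(1)] by (simp add: prod_form_def flat.lin_simps)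
    ultimately show ?thesis by (simp add: tangent_M1 prod_form_def flat.lin_simps)
  qed
  then have T: "?Z \<in> tangent_space (space_form_product k1 k2) (f x)"
    using sZ subspace_0[OF subspace_tangent_hyperquadric[OF f_in(3)[of x]]]
    by (simp add: tangent_eq mem_Times_iff)
  show ?thesis
  proof (rule N_chartI[OF c x(1) T])
    fix w
    have D2: "((\<lambda>u. chart_deriv c f (chart_inv c u) w) has_derivative
        chart_deriv c (\<lambda>y. chart_deriv c f y w) x) (at (snd c x))"
      by (rule chart_deriv_chart_deriv[OF open_UNIV f_smooth c x(1) UNIV_I])
    \<comment> \<open>The product rule for this relation also yields the pairing of \<xi> with a
      second derivative of \<open>f\<close>, which vanishes because \<xi> is orthogonal to the first
      normal space.\<close>
    have "b (\<xi> (chart_inv c u)) (chart_deriv c f (chart_inv c u) w) = 0" if "u \<in> ?U" for u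
      using inv[OF that] N_perp N\<xi> c by blast
    from has_derivative_locally_constant[OF U this prod.has_derivative_form[OF D\<xi> D2], of v]
    have "b (\<xi> x) (chart_deriv c (\<lambda>y. chart_deriv c f y w) x v) + b ?Z (chart_deriv c f x w) = 0"
      by (simp add: cx)
    moreover have "second_ff A b (space_form_product k1 k2) f c x v w \<in>
        first_normal_space A b (space_form_product k1 k2) f x"
      unfolding first_normal_space_def by (rule span_base) (use c x(1) in blast)
    then have "b (\<xi> x) (second_ff A b (space_form_product k1 k2) f c x v w) = 0"
      using perp[OF x(2)] by (simp add: first_normal_perp_def)
    ultimately show "b ?Z (chart_deriv c f x w) = 0"
      using second_ff_perp_iff[OF N\<xi>[OF x(2)]] by simp
  qed
qed

section \<open>Construction of the reduced immersion\<close>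

lemma reduces_codim_leftI:
  assumes L: "normal_subbundle A b (space_form_product k1 k2) f l L"
    and par: "parallel_normal A b (space_form_product k1 k2) f L"
    and sub: "\<And>x. L x \<subseteq> kernel_T A k1 k2 f x \<inter> first_normal_perp A b (space_form_product k1 k2) f x"
  shows "reduces_codim_left A g k1 k2 f l"
proof -
  have LN: "L x \<subseteq> N x" and dL: "dim (L x) = l" for x
    using conjunct1[OF L[unfolded normal_subbundle_def]] by simp_all
  have frame: "\<exists>W e. open W \<and> x \<in> W \<and> (\<forall>i<l. smooth_map_on A W (e i)) \<and>
      (\<forall>y\<in>W. L y = span ((\<lambda>i. e i y) ` {..<l}))" for x
    using conjunct2[OF L[unfolded normal_subbundle_def]] by (rule spec)
  have sL: "subspace (L x)" for x
  proof -
    obtain W and e :: "nat \<Rightarrow> 'a \<Rightarrow> ('e1, 'e2) flat_product"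
      where "open W \<and> x \<in> W \<and> (\<forall>i<l. smooth_map_on A W (e i)) \<and>
        (\<forall>y\<in>W. L y = span ((\<lambda>i. e i y) ` {..<l}))"
      using frame[of x] by (elim exE) rule
    then have "L x = span ((\<lambda>i. e i x) ` {..<l})" by simp
    then show ?thesis by (simp only: subspace_span)
  qed
  have const: "L y = L z" for y z
  proof (rule parallel_subbundle_constant[OF sL dL])
    fix x
    obtain W e where *: "open W \<and> x \<in> W \<and> (\<forall>i<l. smooth_map_on A W (e i)) \<and>
        (\<forall>y\<in>W. L y = span ((\<lambda>i. e i y) ` {..<l}))"
      using frame[of x] by (elim exE) rule
    then have W: "open W" "x \<in> W" "\<And>i. i < l \<Longrightarrow> smooth_map_on A W (e i)"
      "\<And>y. y \<in> W \<Longrightarrow> L y = span ((\<lambda>i. e i y) ` {..<l})"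
      by simp_all
    have eL: "e i y \<in> L y" if "i < l" "y \<in> W" for i y
      unfolding W(4)[OF that(2)] using that(1) by (intro span_base) auto
    have "chart_deriv c (e i) y v \<in> L y" if i: "i < l" and c: "c \<in> A" "y \<in> fst c" "y \<in> W" for c i y v
    proof -
      have "chart_deriv c (e i) y v \<in> N y"
        by (rule section_deriv_normal[OF W(1) W(3)[OF i] _ _ c]) (use eL[OF i] sub in blast)+
      \<comment> \<open>The projection fixes a derivative that is already normal, so parallelism in
        the normal connection becomes closure under flat differentiation.\<close>
      then have "normal_deriv A b (space_form_product k1 k2) f c (e i) y v = chart_deriv c (e i) y v"
        unfolding normal_deriv_def
        by (intro prod.orth_proj_eqI[OF subspace_N positive_N]) (auto simp: prod.lin_simps)
      moreover have "normal_deriv A b (space_form_product k1 k2) f c (e i) y v \<in> L y"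
        using par W(1) W(3)[OF i] eL[OF i] c unfolding parallel_normal_def by blast
      ultimately show ?thesis by simp
    qed
    then show "\<exists>W e. open W \<and> x \<in> W \<and> L x = span ((\<lambda>i. e i x) ` {..<l}) \<and>
      (\<forall>i<l. smooth_map_on A W (e i) \<and> (\<forall>y\<in>W. e i y \<in> L y) \<and>
        (\<forall>c\<in>A. \<forall>y\<in>fst c \<inter> W. \<forall>v. chart_deriv c (e i) y v \<in> L y))"
      using W(1,2) W(3) W(4)[OF W(2)] eL by (intro exI[of _ W] exI[of _ e]) blast
  qed
  \<comment> \<open>An arbitrary base point; it fixes the axis of the isometry and, for
    \<open>k1 = 0\<close>, the translation.\<close>
  define x0 :: 'a where "x0 = undefined"
  define p where "p = fst (f x0)"
  have p: "p \<in> M1" using f_in by (simp add: p_def)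
  define D where "D = {n. (n, 0) \<in> L x0}"
  have D_iff: "n \<in> D \<longleftrightarrow> (n, 0) \<in> L x" for n x using const[of x x0] by (simp add: D_def)
  have L_eq: "L x = (\<lambda>n. (n, 0)) ` D" for x
  proof -
    have "snd \<xi> = 0" if "\<xi> \<in> L x" for \<xi> using that sub kernel_T_snd by blast
    then have "\<xi> = (fst \<xi>, 0)" if "\<xi> \<in> L x" for \<xi> using that by (simp add: prod_eq_iff)
    then show ?thesis using D_iff[of _ x] by (metis (no_types, lifting) image_iff subsetI subset_antisym)
  qed
  have lin: "linear (\<lambda>n :: real \<times> 'e1. (n, 0 :: real \<times> 'e2))" by (rule linearI) auto
  have sD: "subspace D" 
    using linear_subspace_vimage[OF lin sL[of x0]] by (simp add: D_def vimage_def)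
  have "dim (L x0) = dim D"
    unfolding L_eq by (rule dim_image_eq[OF lin]) (auto simp: inj_on_def)
  then have dD: "dim D = l" using dL by simp
  have DT: "D \<subseteq> tangent_space M1 (fst (f x))" for x
  proof
    fix n assume "n \<in> D"
    then have "(n, 0) \<in> N x" using D_iff[of n x] LN by blast
    then show "n \<in> tangent_space M1 (fst (f x))" by (simp add: N_eq tangent_eq)
  qed
  have Ddf: "flat_form k1 (fst (chart_deriv c f x v)) n = 0" if "c \<in> A" "x \<in> fst c" "n \<in> D" for c x v n
  proof -
    have "(n, 0) \<in> N x" using that(3) D_iff[of n x] LN by blast
    from N_perp[OF this that(1,2)] have "flat_form k1 n (fst (chart_deriv c f x v)) = 0"
      by (simp add: prod_form_def flat.lin_simps)
    then show ?thesis by (subst flat.sym)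
  qed
  obtain B :: "'e1 set" and J K where B: "B \<subseteq> Basis" "card B + l = DIM('e1)"
    and JK: "linear J" "linear K" "\<And>Z. snd (K Z) \<in> span B"
    "\<And>X Y. snd X \<in> span B \<Longrightarrow> snd Y \<in> span B \<Longrightarrow> flat_form k1 (J X) (J Y) = flat_form k1 X Y"
    "\<And>X. snd X \<in> span B \<Longrightarrow> K (J X) = X"
    and JKZ: "\<And>Z. (\<And>n. n \<in> D \<Longrightarrow> flat_form k1 Z n = 0) \<Longrightarrow> J (K Z) = Z"
    and J1: "J (1, 0) = unit_vec k1 p"
    using isometry_onto_complement[OF p sD dD] DT[of x0] unfolding p_def by blast
  interpret I: standard_inclusion k1 p B J K
    by (rule standard_inclusion.intro[OF p JK J1])
  let ?q = "base_point k1 p"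
  \<comment> \<open>For nonzero \<open>k1\<close> the normal vector is the position vector, so
    tangency of \<open>D\<close> gives the claim. In the flat case the height of \<open>f\<close>
    along \<open>n\<close> has zero derivative and is compared with its value at
    \<open>x0\<close>.\<close>
  have perp: "flat_form k1 (fst (f x) - ?q) n = 0" if n: "n \<in> D" for x n
  proof (cases "k1 = 0")
    case False
    have "n \<in> tangent_space M1 (fst (f x))" using DT n by blast
    then show ?thesis using False flat.sym[of k1 n "fst (f x)"]
      by (simp add: tangent_M1 normal_vec_def base_point_def)
  next
    case True
    have bl: "bounded_linear (\<lambda>z :: ('e1, 'e2) flat_product. flat_form k1 (fst z) n)"
      using bounded_linear_compose[OF linear_conv_bounded_linear[THEN iffD1, OF flat.linear_left[of k1 n]]
          bounded_linear_fst] by simp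
    have "flat_form k1 (fst (f x)) n = flat_form k1 (fst (f x0)) n"
    proof (rule zero_derivative_constant[of "\<lambda>x. flat_form k1 (fst (f x)) n"])
      show "smooth_map_on A UNIV (\<lambda>x. flat_form k1 (fst (f x)) n)"
        using smooth_map_on_affine[OF open_UNIV f_smooth bl, of 0] by simp
      fix c x v assume c: "c \<in> A" "x \<in> fst c"
      have "chart_deriv c (\<lambda>x. flat_form k1 (fst (f x)) n) x v = flat_form k1 (fst (chart_deriv c f x v)) n"
        by (rule chart_deriv_eqI) (rule bounded_linear.has_derivative[OF bl df[OF c]])
      then show "chart_deriv c (\<lambda>x. flat_form k1 (fst (f x)) n) x v = 0" using Ddf[OF c n] by simp
    qed
    then show ?thesis using True by (simp add: base_point_def p_def flat.lin_simps)
  qed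
  \<comment> \<open>On the complement of \<open>D\<close> the map \<open>J\<close> undoes
    \<open>K\<close>, so the inclusion sends \<open>h x\<close> back to the first component of
    \<open>f x\<close>.\<close>
  define h where "h x = K (fst (f x) - ?q)" for x
  have jh: "I.incl (h x) = fst (f x)" for x
    unfolding h_def I.incl_def by (subst JKZ) (use perp in auto)
  have h_in: "h x \<in> hyperquadric k1 B" for x
    using I.incl_in_iff[of "h x"] jh f_in JK(3) by (simp add: h_def)
  define T where "T z = (K (fst z), snd z)" for z :: "('e1, 'e2) flat_product"
  have "linear T" unfolding T_def by (rule linearI) (auto simp: linear_add[OF JK(2)] linear_scale[OF JK(2)])
  then have T: "bounded_linear T" using linear_conv_bounded_linear by blast
  define fbar where "fbar x = (h x, snd (f x))" for x
  have fbar: "fbar x = T (f x) + (- K ?q, 0)" for x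
    by (simp add: fbar_def h_def T_def linear_diff[OF JK(2)])
  have dfbar: "chart_deriv c fbar x v = T (chart_deriv c f x v)" if "c \<in> A" "x \<in> fst c" for c x v
    unfolding fbar[abs_def]
    by (rule chart_deriv_eqI) (intro has_derivative_add_const bounded_linear.has_derivative[OF T df[OF that]])
  have "isometric_immersion A g b (hyperquadric k1 B \<times> M2) fbar"
    unfolding isometric_immersion_def
  proof (intro conjI ballI allI)
    show "range fbar \<subseteq> hyperquadric k1 B \<times> M2" using h_in f_in by (auto simp: fbar_def)
    show "smooth_map_on A UNIV fbar"
      unfolding fbar[abs_def] by (rule smooth_map_on_affine[OF open_UNIV f_smooth T])
    fix c x v w assume c: "c \<in> A" "x \<in> fst c"
    \<comment> \<open>The differential of \<open>f\<close> has its first component in the complement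
      of \<open>D\<close>, where \<open>K\<close> is therefore isometric because \<open>J\<close>
      is.\<close>
    have "J (K (fst (chart_deriv c f x u))) = fst (chart_deriv c f x u)" for u
      by (rule JKZ[OF Ddf[OF c]])
    then have "flat_form k1 (K (fst (chart_deriv c f x v))) (K (fst (chart_deriv c f x w))) =
        flat_form k1 (fst (chart_deriv c f x v)) (fst (chart_deriv c f x w))"
      using JK(4)[OF JK(3) JK(3)] by metis
    then show "b (chart_deriv c fbar x v) (chart_deriv c fbar x w) = g c x v w"
      unfolding dfbar[OF c] T_def f_isometric[OF c, symmetric] by (simp add: prod_form_def)
  qed
  moreover have "f = map_prod I.incl id \<circ> fbar"
    by (rule ext) (simp add: fbar_def jh prod_eq_iff)
  ultimately show ?thesis
    unfolding reduces_codim_left_def using B I.incl_isometric_embedding I.incl_totally_geodesic by blast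
qed

end

section \<open>Differentials of totally geodesic inclusions\<close>

locale geodesic_inclusion =
  fixes k :: real and B :: "'e::euclidean_space set" and j :: "real \<times> 'e \<Rightarrow> real \<times> 'e"
  assumes B: "B \<subseteq> Basis"
    and emb: "isometric_embedding (flat_form k) (hyperquadric k B) (flat_form k) (hyperquadric k Basis) j"
    and tg: "totally_geodesic (hyperquadric k B) (flat_form k) (hyperquadric k Basis) j"
begin

abbreviation S :: "(real \<times> 'e) set" where "S \<equiv> hyperquadric k B"
abbreviation M :: "(real \<times> 'e) set" where "M \<equiv> hyperquadric k Basis"

definition dj :: "real \<times> 'e \<Rightarrow> real \<times> 'e \<Rightarrow> real \<times> 'e" where
  "dj q = frechet_derivative j (at q within S)"

text \<open>For nonzero \<open>k\<close> this is the tangent space at \<open>j q\<close> of the cone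
  over the image of \<open>j\<close>. As a linear subspace of flat space it can be compared between
  different points.\<close>

definition osculating :: "real \<times> 'e \<Rightarrow> (real \<times> 'e) set" where
  "osculating q = span (insert (normal_vec k (j q)) (dj q ` tangent_space S q))"

lemma j_in: "q \<in> S \<Longrightarrow> j q \<in> M"
  using emb unfolding isometric_embedding_def by blast

lemma local_extension:
  assumes "q \<in> S"
  obtains W H where "open W" "q \<in> W" "\<And>n. Ck_on n W H" "\<And>r. r \<in> S \<inter> W \<Longrightarrow> j r = H r"
proof -
  have "smooth_on S j" using emb unfolding isometric_embedding_def by blast
  then obtain W H where "open W \<and> q \<in> W \<and> (\<forall>n. Ck_on n W H) \<and> (\<forall>r\<in>S \<inter> W. j r = H r)"
    using assms unfolding smooth_on_def by meson
  then show ?thesis using that by blast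
qed

lemma dj_has_derivative:
  assumes "q \<in> S"
  shows "(j has_derivative dj q) (at q within S)"
proof -
  obtain W H where W: "open W" "q \<in> W" "\<And>n. Ck_on n W H" "\<And>r. r \<in> S \<inter> W \<Longrightarrow> j r = H r"
    using local_extension[OF assms] by blast
  have "(j has_derivative frechet_derivative H (at q)) (at q within S)"
    by (rule has_derivative_local_extension[OF W(1) assms W(2) Ck_on_has_derivative[OF W(3) W(2)] W(4)])
  then show ?thesis unfolding dj_def using frechet_derivative_works differentiable_def by blast
qed

lemma linear_dj: "q \<in> S \<Longrightarrow> linear (dj q)"
  by (rule has_derivative_linear[OF dj_has_derivative])

lemma dj_isometric:
  assumes "q \<in> S" "v \<in> tangent_space S q" "w \<in> tangent_space S q"
  shows "flat_form k (dj q v) (dj q w) = flat_form k v w"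
  using emb assms unfolding isometric_embedding_def dj_def by blast

lemma dj_tangent:
  assumes "q \<in> S" "v \<in> tangent_space S q"
  shows "dj q v \<in> tangent_space M (j q)"
proof -
  obtain \<gamma> where g: "range \<gamma> \<subseteq> S" "\<gamma> (0::real) = q" "(\<gamma> has_derivative (\<lambda>t. t *\<^sub>R v)) (at 0)"
    by (rule tangent_spaceE[OF assms(2)])
  have "((\<lambda>t. j (\<gamma> t)) has_derivative (\<lambda>t. dj q (t *\<^sub>R v))) (at 0)"
    using has_derivative_in_compose[OF g(3)] has_derivative_subset[OF dj_has_derivative[OF assms(1)] g(1)]
      g(2) by auto
  then have "((\<lambda>t. j (\<gamma> t)) has_vector_derivative dj q v) (at 0)"
    by (simp add: has_vector_derivative_def linear_scale[OF linear_dj[OF assms(1)]])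
  moreover have "range (\<lambda>t. j (\<gamma> t)) \<subseteq> M" using g(1) j_in by blast
  ultimately show ?thesis
    unfolding tangent_space_def using g(2) by (auto intro!: exI[of _ "\<lambda>t. j (\<gamma> t)"])
qed

lemma subspace_dj_image: "q \<in> S \<Longrightarrow> subspace (dj q ` tangent_space S q)"
  by (rule linear_subspace_image[OF linear_dj subspace_tangent_hyperquadric])

text \<open>The differential is injective, being isometric on a positive definite space, and the
  ambient normal is not tangent because its square is nonzero.\<close>

lemma dim_osculating:
  assumes q: "q \<in> S"
  shows "dim (osculating q) = card B + 1"
proof -
  let ?n = "normal_vec k (j q)" and ?T = "tangent_space S q"
  have sT: "subspace ?T" by (rule subspace_tangent_hyperquadric[OF q])
  have "inj_on (dj q) ?T"
  proof (rule inj_onI)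
    fix v w assume vw: "v \<in> ?T" "w \<in> ?T" "dj q v = dj q w"
    have d: "v - w \<in> ?T" using vw sT by (simp add: subspace_diff)
    have "dj q (v - w) = 0" using vw by (simp add: linear_diff[OF linear_dj[OF q]])
    then have "flat_form k (v - w) (v - w) = 0"
      using dj_isometric[OF q d d] by (simp add: flat.lin_simps)
    then show "v = w" using tangent_hyperquadric_nonneg[OF q d] by simp
  qed
  then have "dim (dj q ` ?T) = card B"
    using dim_image_eq[OF linear_dj[OF q], of ?T] sT dim_tangent_hyperquadric[OF B q]
    by (simp add: span_eq_iff[THEN iffD2])
  moreover have "?n \<notin> span (dj q ` ?T)"
  proof
    assume "?n \<in> span (dj q ` ?T)"
    then have "?n \<in> dj q ` ?T" using span_eq_iff subspace_dj_image[OF q] by blast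
    then have "flat_form k ?n ?n = 0"
      using dj_tangent[OF q] tangent_hyperquadric[OF j_in[OF q]] by auto
    then show False using normal_vec_square_nz[OF j_in[OF q]] by simp
  qed
  ultimately show ?thesis by (simp add: osculating_def dim_insert)
qed

text \<open>Total geodesy provides orthogonality to the normal vectors of \<open>j\<close>, whereas
  membership is wanted. Removing from \<open>Z\<close> its component along the ambient normal and
  its projection to the image of the differential leaves such a normal vector \<xi>, which is then
  orthogonal to itself.\<close>

lemma mem_osculatingI:
  assumes q: "q \<in> S"
    and Z: "\<And>\<xi>. \<xi> \<in> tangent_space M (j q) \<Longrightarrow>
      (\<And>v. v \<in> tangent_space S q \<Longrightarrow> flat_form k \<xi> (dj q v) = 0) \<Longrightarrow> flat_form k Z \<xi> = 0"
  shows "Z \<in> osculating q"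
proof -
  let ?n = "normal_vec k (j q)" and ?I = "dj q ` tangent_space S q"
  define a where "a = flat_form k Z ?n / flat_form k ?n ?n"
  define w where "w = orth_proj (flat_form k) ?I (Z - a *\<^sub>R ?n)"
  have IT: "?I \<subseteq> tangent_space M (j q)" using dj_tangent[OF q] by blast
  have I: "subspace ?I" "flat.positive_on k ?I"
    using subspace_dj_image[OF q] flat.positive_on_subset[OF tangent_hyperquadric_positive[OF j_in[OF q]] IT]
    by auto
  have w: "w \<in> ?I" "\<And>u. u \<in> ?I \<Longrightarrow> flat_form k (Z - a *\<^sub>R ?n - w) u = 0"
    unfolding w_def by (rule flat.orth_proj_in[OF I], rule flat.orth_proj_perp[OF I])
  define \<xi> where "\<xi> = Z - a *\<^sub>R ?n - w"
  have "Z - a *\<^sub>R ?n \<in> tangent_space M (j q)"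
    unfolding tangent_hyperquadric[OF j_in[OF q]]
    using normal_vec_square_nz[OF j_in[OF q]] by (simp add: flat.lin_simps a_def)
  moreover have "w \<in> tangent_space M (j q)" using w(1) IT by blast
  ultimately have T: "\<xi> \<in> tangent_space M (j q)"
    unfolding \<xi>_def by (rule subspace_diff[OF subspace_tangent_hyperquadric[OF j_in[OF q]]])
  have "flat_form k Z \<xi> = 0"
    by (rule Z[OF T]) (use w(2) in \<open>auto simp: \<xi>_def\<close>)
  moreover have "flat_form k ?n \<xi> = 0"
    using T unfolding tangent_hyperquadric[OF j_in[OF q]] by (subst flat.sym) simp
  moreover have "flat_form k w \<xi> = 0"
    using w(2)[OF w(1)] unfolding \<xi>_def by (subst flat.sym)
  ultimately have "flat_form k \<xi> \<xi> = 0"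
    by (subst (1) \<xi>_def) (simp add: flat.lin_simps)
  then have "\<xi> = 0" using tangent_hyperquadric_nonneg[OF j_in[OF q] T] by blast
  then have "Z = a *\<^sub>R ?n + w" by (simp add: \<xi>_def algebra_simps)
  then show ?thesis
    unfolding osculating_def using w(1) by (simp add: span_add span_scale span_base)
qed

text \<open>On \<open>S\<close> this is the orthogonal projection of the constant vector
  \<open>u\<close> to the tangent space at \<open>q\<close>, since the factor is the inverse of the
  square of the normal vector. The formula is polynomial in \<open>q\<close>, hence smooth on the
  whole space.\<close>

definition tangent_field :: "real \<times> 'e \<Rightarrow> real \<times> 'e \<Rightarrow> real \<times> 'e" where
  "tangent_field u q = u - ((if k = 0 then 1 else k) * flat_form k u (normal_vec k q)) *\<^sub>R normal_vec k q"

lemma tangent_field_tangent: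
  assumes "q \<in> S" "snd u \<in> span B"
  shows "tangent_field u q \<in> tangent_space S q"
  unfolding tangent_hyperquadric[OF assms(1)] tangent_field_def
  using assms snd_normal_vec[OF assms(1)] normal_vec_square[OF assms(1)]
  by (auto simp: flat.lin_simps span_diff span_scale)

lemma tangent_field_id:
  assumes "q \<in> S" "u \<in> tangent_space S q"
  shows "tangent_field u q = u"
  using assms by (simp add: tangent_hyperquadric tangent_field_def)

lemma Ck_on_tangent_field: "Ck_on n UNIV (tangent_field u)"
proof -
  let ?\<kappa> = "if k = 0 then 1 else k"
  have n: "Ck_on n UNIV (normal_vec k :: real \<times> 'e \<Rightarrow> real \<times> 'e)"
  proof (cases "k = 0")
    case True
    then have "(normal_vec k :: real \<times> 'e \<Rightarrow> real \<times> 'e) = (\<lambda>q. (1, 0))" by (simp add: normal_vec_def fun_eq_iff)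
    then show ?thesis by (simp only: Ck_on_const)
  next
    case False
    then have "(normal_vec k :: real \<times> 'e \<Rightarrow> real \<times> 'e) = (\<lambda>q. q)" by (simp add: normal_vec_def fun_eq_iff)
    then show ?thesis by (simp only: Ck_on_ident)
  qed
  have "linear (\<lambda>q. - (?\<kappa> * flat_form k u q))"
    by (rule linearI) (simp_all add: flat.lin_simps algebra_simps)
  then have bl: "bounded_linear (\<lambda>q. - (?\<kappa> * flat_form k u q))"
    using linear_conv_bounded_linear by blast
  have "Ck_on n UNIV (\<lambda>q. u + (- (?\<kappa> * flat_form k u (normal_vec k q))) *\<^sub>R normal_vec k q)"
    by (rule Ck_on_add[OF open_UNIV Ck_on_const
          Ck_on_scaleR[OF open_UNIV Ck_on_bounded_linear[OF bl open_UNIV n] n]])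
  then show ?thesis by (simp add: tangent_field_def[abs_def])
qed

text \<open>The differential of \<open>j\<close> is available within \<open>S\<close> only, while
  smooth frames are differentiated on open sets. \<open>F u\<close> is the derivative of a local
  extension of \<open>j\<close> along the projected field; on \<open>S\<close> it is the image of a
  tangent field, so total geodesy controls its derivatives along \<open>S\<close>.\<close>

lemma osculating_frame_field:
  assumes q: "q \<in> S"
  obtains W F where "open W" "q \<in> W" "\<And>u n. Ck_on n W (F u)"
    "\<And>u r. snd u \<in> span B \<Longrightarrow> r \<in> S \<Longrightarrow> r \<in> W \<Longrightarrow> F u r = dj r (tangent_field u r)"
    "\<And>u r X. snd u \<in> span B \<Longrightarrow> r \<in> S \<Longrightarrow> r \<in> W \<Longrightarrow> X \<in> tangent_space S r \<Longrightarrow>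
      frechet_derivative (F u) (at r) X \<in> osculating r"
proof -
  obtain W H where W: "open W" "q \<in> W" "\<And>n. Ck_on n W H" "\<And>r. r \<in> S \<inter> W \<Longrightarrow> j r = H r"
    using local_extension[OF q] by blast
  define F where "F u r = frechet_derivative H (at r) (tangent_field u r)" for u r
  have HD: "(H has_derivative frechet_derivative H (at r)) (at r)" if "r \<in> W" for r
    by (rule Ck_on_has_derivative[OF W(3) that])
  have CF: "Ck_on n W (F u)" for n u
  proof (rule Ck_on_cong[OF W(1)])
    \<comment> \<open>The direction of differentiation moves with \<open>r\<close>, so it is
      expanded into fixed ones.\<close>
    show "Ck_on n W (\<lambda>r. \<Sum>i\<in>Basis. (tangent_field u r \<bullet> i) *\<^sub>R frechet_derivative H (at r) i)"
    proof (intro Ck_on_sum[OF W(1)] Ck_on_scaleR[OF W(1)])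
      fix i
      show "Ck_on n W (\<lambda>r. tangent_field u r \<bullet> i)"
        by (rule Ck_on_subset[OF subset_UNIV
              Ck_on_bounded_linear[OF bounded_linear_inner_left open_UNIV Ck_on_tangent_field]])
      show "Ck_on n W (\<lambda>r. frechet_derivative H (at r) i)" 
        using W(3)[of "Suc n"] unfolding Ck_on.simps by blast
    qed
    fix r assume "r \<in> W"
    from HD[OF this] have "H differentiable (at r)" unfolding differentiable_def by blast
    from frechet_derivative_euclidean[OF this, of "tangent_field u r"]
    show "(\<Sum>i\<in>Basis. (tangent_field u r \<bullet> i) *\<^sub>R frechet_derivative H (at r) i) = F u r"
      by (simp add: F_def)
  qed
  have Fd: "F u r = dj r (tangent_field u r)" if u: "snd u \<in> span B" and r: "r \<in> S" "r \<in> W" for u r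
    unfolding F_def dj_def
    by (rule frechet_derivative_within_tangent[symmetric])
      (rule has_derivative_local_extension[OF W(1) r HD[OF r(2)] W(4)], assumption,
       rule tangent_field_tangent[OF r(1) u])
  have "frechet_derivative (F u) (at r) X \<in> osculating r"
    if u: "snd u \<in> span B" and r: "r \<in> S" "r \<in> W" and X: "X \<in> tangent_space S r" for u r X
  proof (rule mem_osculatingI[OF r(1)])
    let ?N = "{\<xi> \<in> tangent_space M (j r). \<forall>v\<in>tangent_space S r. flat_form k \<xi> (dj r v) = 0}"
    let ?Z = "frechet_derivative (\<lambda>s. dj s (tangent_field u s)) (at r within S) X"
    have "((\<lambda>s. dj s (tangent_field u s)) has_derivative frechet_derivative (F u) (at r)) (at r within S)"
      by (rule has_derivative_local_extension[OF W(1) r Ck_on_has_derivative[OF CF r(2)]])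
        (use Fd[OF u] in auto)
    then have Z: "?Z = frechet_derivative (F u) (at r) X"
      by (rule frechet_derivative_within_tangent[OF _ X])
    have "smooth_on S (tangent_field u)" by (rule smooth_onI[OF Ck_on_tangent_field])
    then have "orth_proj (flat_form k) ?N ?Z = 0"
      using tg tangent_field_tangent[OF _ u] r(1) X unfolding totally_geodesic_def dj_def by blast
    moreover have "subspace ?N" "flat.positive_on k ?N"
      using subspace_tangent_hyperquadric[OF j_in[OF r(1)]] tangent_hyperquadric_positive[OF j_in[OF r(1)]]
      by (auto simp: subspace_def flat.lin_simps flat.positive_on_def)
    ultimately have *: "\<forall>\<xi>\<in>?N. flat_form k ?Z \<xi> = 0" by (simp only: flat.orth_proj_eq_0_iff)
    show "flat_form k (frechet_derivative (F u) (at r) X) \<xi> = 0"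
      if "\<xi> \<in> tangent_space M (j r)" "\<And>v. v \<in> tangent_space S r \<Longrightarrow> flat_form k \<xi> (dj r v) = 0" for \<xi>
      using * that unfolding Z by blast
  qed
  then show ?thesis using that[OF W(1,2) CF Fd] by blast
qed

end

section \<open>From reduction of codimension to parallel subbundles\<close>

context product_immersion
begin

text \<open>The frame consists of the images of \<open>card B\<close> projected constant fields,
  which at \<open>p x\<close> come from a basis of the tangent space, and of the ambient normal. The
  derivative of that normal is zero or the first component of the differential of \<open>f\<close>,
  so it stays in the family.\<close>

lemma fst_df_in_osculating_constant:
  assumes G: "geodesic_inclusion k1 B j"
    and p: "smooth_map_on A UNIV p" "\<And>x. p x \<in> hyperquadric k1 B" "\<And>x. fst (f x) = j (p x)"
  shows "c \<in> A \<Longrightarrow> x \<in> fst c \<Longrightarrow>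
      fst (chart_deriv c f x v) \<in> geodesic_inclusion.osculating k1 B j (p x)"
    and "geodesic_inclusion.osculating k1 B j (p x) = geodesic_inclusion.osculating k1 B j (p y)"
proof -
  interpret G: geodesic_inclusion k1 B j by (rule G)
  have dp: "((\<lambda>u. p (chart_inv c u)) has_derivative chart_deriv c p x) (at (snd c x))"
    if "c \<in> A" "x \<in> fst c" for c x
    by (rule chart_deriv[OF open_UNIV p(1) that UNIV_I])
  have dpT: "chart_deriv c p x v \<in> tangent_space G.S (p x)" if "c \<in> A" "x \<in> fst c" for c x v
    by (rule chart_deriv_tangent[OF p(1) _ that]) (use p(2) in blast)
  have df1: "fst (chart_deriv c f x v) = G.dj (p x) (chart_deriv c p x v)"
    if c: "c \<in> A" "x \<in> fst c" for c x v
  proof -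
    have 1: "((\<lambda>u. fst (f (chart_inv c u))) has_derivative (\<lambda>v. fst (chart_deriv c f x v))) (at (snd c x))"
      by (rule has_derivative_fst[OF df[OF c]])
    \<comment> \<open>The derivative of \<open>j\<close> is one within the hyperquadric, so the
      chain rule is applied relative to the range of the inner map.\<close>
    have "range (\<lambda>u. p (chart_inv c u)) \<subseteq> G.S" using p(2) by blast
    then have "(j has_derivative G.dj (p x)) (at (p (chart_inv c (snd c x))) within range (\<lambda>u. p (chart_inv c u)))"
      unfolding chart_inv_left[OF c] by (rule has_derivative_subset[OF G.dj_has_derivative[OF p(2)]])
    then have 2: "((\<lambda>u. j (p (chart_inv c u))) has_derivative (\<lambda>v. G.dj (p x) (chart_deriv c p x v))) (at (snd c x))"
      by (rule has_derivative_in_compose[OF dp[OF c]])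
    show ?thesis using has_derivative_unique[OF 1 2[folded p(3)]] by meson
  qed
  have dj_osc: "G.dj (p x) w \<in> G.osculating (p x)" if "w \<in> tangent_space G.S (p x)" for x w
    unfolding G.osculating_def by (rule span_base) (use that in blast)
  show df_osc: "fst (chart_deriv c f x v) \<in> G.osculating (p x)" if c: "c \<in> A" "x \<in> fst c" for c x v
    unfolding df1[OF c] by (rule dj_osc[OF dpT[OF c]])
  show "G.osculating (p x) = G.osculating (p y)"
  proof (rule parallel_subbundle_constant[of "\<lambda>x. G.osculating (p x)" "card B + 1"])
    show "subspace (G.osculating (p x))" for x by (simp add: G.osculating_def)
    show "dim (G.osculating (p x)) = card B + 1" for x by (rule G.dim_osculating[OF p(2)])
    fix x
    let ?n = "card B + 1" and ?T = "tangent_space G.S (p x)"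
    obtain u where u2: "?T = span (u ` {..<card B})"
      by (rule finite_frame[OF subspace_tangent_hyperquadric[OF p(2)[of x]]
            dim_tangent_hyperquadric[OF G.B p(2)[of x]]])
    have u1: "u i \<in> ?T" if "i < card B" for i
      unfolding u2 by (rule span_base) (use that in blast)
    have su: "snd (u i) \<in> span B" if "i < card B" for i
      using u1[OF that] tangent_hyperquadric[OF p(2)] by blast
    obtain W F where W: "open W" "p x \<in> W" "\<And>u n. Ck_on n W (F u)"
      and F: "\<And>u r. snd u \<in> span B \<Longrightarrow> r \<in> G.S \<Longrightarrow> r \<in> W \<Longrightarrow> F u r = G.dj r (G.tangent_field u r)"
      and DF: "\<And>u r X. snd u \<in> span B \<Longrightarrow> r \<in> G.S \<Longrightarrow> r \<in> W \<Longrightarrow> X \<in> tangent_space G.S r \<Longrightarrow>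
        frechet_derivative (F u) (at r) X \<in> G.osculating r"
      using G.osculating_frame_field[OF p(2)[of x]] by blast
    \<comment> \<open>The last index, \<open>card B\<close>, belongs to the ambient normal.\<close>
    define e where "e i y = (if i < card B then F (u i) (p y) else normal_vec k1 (fst (f y)))" for i :: nat and y
    have e1: "e i = (\<lambda>y. F (u i) (p y))" if "i < card B" for i using that by (simp add: e_def fun_eq_iff)
    have e2: "e i = (\<lambda>y. normal_vec k1 (fst (f y)))" if "\<not> i < card B" for i
      using that by (simp add: e_def fun_eq_iff)
    let ?W = "p -` W"
    have oW: "open ?W"
      using continuous_open_preimage[OF smooth_map_continuous[OF p(1)] open_UNIV W(1)] by simp
    have n_osc: "normal_vec k1 (fst (f y)) \<in> G.osculating (p y)" for y
      unfolding G.osculating_def p(3) by (rule span_base) blast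
    have "smooth_map_on A ?W (e i)" for i
    proof (cases "i < card B")
      case True
      show ?thesis
        unfolding e1[OF True]
        by (rule smooth_map_on_compose[OF oW smooth_map_on_subset[OF open_UNIV oW _ p(1)] W(1) _ W(3)]) auto
    next
      case False
      show ?thesis
        unfolding e2[OF False] by (rule smooth_map_on_subset[OF open_UNIV oW _ normal_vec_smooth]) simp
    qed
    moreover have e_osc: "e i y \<in> G.osculating (p y)" if y: "y \<in> ?W" for i y
    proof (cases "i < card B")
      case True
      have "p y \<in> W" using y by simp
      then show ?thesis
        unfolding e1[OF True] F[OF su[OF True] p(2) \<open>p y \<in> W\<close>]
        by (intro dj_osc G.tangent_field_tangent[OF p(2) su[OF True]])
    next
      case False
      show ?thesis unfolding e2[OF False] by (rule n_osc)
    qed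
    moreover have "chart_deriv c (e i) y v \<in> G.osculating (p y)" if y: "y \<in> ?W" and c: "c \<in> A" "y \<in> fst c" for c i y v
    proof (cases "i < card B")
      case True
      have yW: "p y \<in> W" using y by simp
      have "(F (u i) has_derivative frechet_derivative (F (u i)) (at (p y))) (at (p (chart_inv c (snd c y))))"
        unfolding chart_inv_left[OF c] by (rule Ck_on_has_derivative[OF W(3) yW])
      from has_derivative_compose[OF dp[OF c] this]
      have "chart_deriv c (e i) y v = frechet_derivative (F (u i)) (at (p y)) (chart_deriv c p y v)"
        unfolding e1[OF True] by (rule chart_deriv_eqI)
      then show ?thesis using DF[OF su[OF True] p(2) yW dpT[OF c]] by simp
    next
      case False
      show ?thesis
        unfolding e2[OF False] chart_deriv_normal_vec[OF c]
        using df_osc[OF c] by (simp add: G.osculating_def span_zero)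
    qed
    moreover have "G.osculating (p x) = span ((\<lambda>i. e i x) ` {..<?n})"
    proof
      show "span ((\<lambda>i. e i x) ` {..<?n}) \<subseteq> G.osculating (p x)"
        by (rule span_minimal) (use e_osc W(2) in \<open>auto simp: G.osculating_def\<close>)
      \<comment> \<open>At the base point \<open>u i\<close> is tangent, so projecting it changes
        nothing.\<close>
      have eu: "e i x = G.dj (p x) (u i)" if "i < card B" for i
        using F[OF su[OF that] p(2) W(2)] G.tangent_field_id[OF p(2) u1[OF that]] e1[OF that] by simp
      have "normal_vec k1 (j (p x)) = e (card B) x" by (simp add: e_def p(3))
      then have 1: "normal_vec k1 (j (p x)) \<in> span ((\<lambda>i. e i x) ` {..<?n})"
        by (auto intro: span_base)
      have "G.dj (p x) ` span (u ` {..<card B}) = span (G.dj (p x) ` u ` {..<card B})"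
        by (rule linear_span_image[OF G.linear_dj[OF p(2)], symmetric])
      also have "\<dots> \<subseteq> span ((\<lambda>i. e i x) ` {..<?n})"
      proof (rule span_mono, rule subsetI)
        fix z assume "z \<in> G.dj (p x) ` u ` {..<card B}"
        then obtain i where "i < card B" "z = G.dj (p x) (u i)" by blast
        then have "z = e i x" "i < ?n" using eu by simp_all
        then show "z \<in> (\<lambda>i. e i x) ` {..<?n}" by blast
      qed
      finally have "G.dj (p x) ` ?T \<subseteq> span ((\<lambda>i. e i x) ` {..<?n})" unfolding u2[symmetric] .
      with 1 show "G.osculating (p x) \<subseteq> span ((\<lambda>i. e i x) ` {..<?n})"
        unfolding G.osculating_def by (intro span_minimal) auto
    qed
    ultimately show "\<exists>W e. open W \<and> x \<in> W \<and> G.osculating (p x) = span ((\<lambda>i. e i x) ` {..<?n}) \<and>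
      (\<forall>i<?n. smooth_map_on A W (e i) \<and> (\<forall>y\<in>W. e i y \<in> G.osculating (p y)) \<and>
        (\<forall>c\<in>A. \<forall>y\<in>fst c \<inter> W. \<forall>v. chart_deriv c (e i) y v \<in> G.osculating (p y)))"
      using oW W(2) by (intro exI[of _ ?W] exI[of _ e]) simp
  qed
qed

text \<open>That \<open>V\<close> contains the ambient normal makes the complement tangent to the
  first factor; that it contains the differential makes the complement normal to \<open>f\<close>.
  As \<open>V\<close> is the same at all points, the latter relation can be differentiated, which
  gives orthogonality to the first normal space.\<close>

lemma parallel_subbundle_of_perp:
  assumes V: "dim V + l = DIM('e1) + 1" "subspace V"
    and nV: "\<And>x. normal_vec k1 (fst (f x)) \<in> V"
    and dV: "\<And>c x v. c \<in> A \<Longrightarrow> x \<in> fst c \<Longrightarrow> fst (chart_deriv c f x v) \<in> V"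
  shows "\<exists>L. normal_subbundle A b (space_form_product k1 k2) f l L \<and>
    parallel_normal A b (space_form_product k1 k2) f L \<and>
    (\<forall>x. L x \<subseteq> kernel_T A k1 k2 f x \<inter> first_normal_perp A b (space_form_product k1 k2) f x)"
proof -
  define D where "D = {n. \<forall>w\<in>V. flat_form k1 n w = 0}"
  define L where "L = (\<lambda>n. (n, 0 :: real \<times> 'e2)) ` D"
  have sD: "subspace D" unfolding D_def by (rule flat.subspace_perp)
  have dD: "dim D = l" using dim_flat_perp[OF V(2), of k1] V(1) by (simp add: D_def)
  have lin: "linear (\<lambda>n :: real \<times> 'e1. (n, 0 :: real \<times> 'e2))" by (rule linearI) auto
  have sL: "subspace L" unfolding L_def by (rule linear_subspace_image[OF lin sD])
  have dL: "dim L = l"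
    unfolding L_def dD[symmetric] by (rule dim_image_eq[OF lin]) (auto simp: inj_on_def)
  have bL: "b \<xi> w = 0" if "\<xi> \<in> L" "fst w \<in> V" for \<xi> w
    using that by (auto simp: L_def D_def prod_form_def flat.lin_simps)
  have LN: "L \<subseteq> N x" for x
  proof
    fix \<xi> assume \<xi>: "\<xi> \<in> L"
    obtain n where n: "\<xi> = (n, 0)" "n \<in> D" using \<xi> by (auto simp: L_def)
    have "n \<in> tangent_space M1 (fst (f x))" unfolding tangent_M1 using n(2) nV by (simp add: D_def)
    then have T: "\<xi> \<in> tangent_space (space_form_product k1 k2) (f x)"
      unfolding tangent_eq n(1) using subspace_0[OF subspace_tangent_hyperquadric[OF f_in(3)[of x]]] by simp
    obtain c where c: "c \<in> A" "x \<in> fst c" by (rule chart_ex)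
    show "\<xi> \<in> N x" by (rule N_chartI[OF c T bL[OF \<xi> dV[OF c]]])
  qed
  have ker: "L \<subseteq> kernel_T A k1 k2 f x" for x
  proof
    fix \<xi> assume \<xi>: "\<xi> \<in> L"
    let ?V = "{0 :: real \<times> 'e1} \<times> tangent_space M2 (snd (f x))"
    \<comment> \<open>Vectors without second component are annihilated before \<open>T\<close> takes
      the normal part.\<close>
    have "pi2 k1 k2 (f x) \<xi> = 0"
      unfolding pi2_def
    proof (rule prod.orth_proj_eqI)
      show "subspace ?V"
        by (intro subspace_Times subspace_tangent_hyperquadric f_in) simp
      show "prod.positive_on k1 k2 ?V"
        by (rule prod.positive_on_subset[OF space_form_product_tangent(2)[OF f_in(1)[of x]]])
          (use subspace_0[OF subspace_tangent_hyperquadric[OF f_in(2)]] in \<open>auto simp: tangent_space_Times\<close>)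
      show "0 \<in> ?V" using subspace_0[OF \<open>subspace ?V\<close>] .
      show "b (\<xi> - 0) u = 0" if "u \<in> ?V" for u
        using that \<xi> by (auto simp: L_def prod_form_def flat.lin_simps)
    qed
    then have "tensor_T A k1 k2 f x \<xi> = 0"
      unfolding tensor_T_def by (simp add: prod.orth_proj_eq_0_iff[OF subspace_N positive_N] prod.lin_simps)
    then show "\<xi> \<in> kernel_T A k1 k2 f x" using \<xi> LN unfolding kernel_T_def by blast
  qed
  have perp: "L \<subseteq> first_normal_perp A b (space_form_product k1 k2) f x" for x
  proof
    fix \<xi> assume \<xi>: "\<xi> \<in> L"
    have \<xi>N: "\<xi> \<in> N x" using \<xi> LN by blast
    have sff: "b \<xi> (second_ff A b (space_form_product k1 k2) f c x v w) = 0" if c: "c \<in> A" "x \<in> fst c" for c v w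
      unfolding second_ff_perp_iff[OF \<xi>N]
    proof -
      have bl: "bounded_linear (b \<xi>)"
        using prod.linear_right[of k1 k2 \<xi>] linear_conv_bounded_linear by blast
      have D: "((\<lambda>u. b \<xi> (chart_deriv c f (chart_inv c u) w)) has_derivative
          (\<lambda>v. b \<xi> (chart_deriv c (\<lambda>y. chart_deriv c f y w) x v))) (at (snd c x))"
        by (rule bounded_linear.has_derivative[OF bl
              chart_deriv_chart_deriv[OF open_UNIV f_smooth c UNIV_I]])
      show "b \<xi> (chart_deriv c (\<lambda>y. chart_deriv c f y w) x v) = 0"
      proof (rule has_derivative_locally_constant[OF chart_image_open[OF c(1)] _ _ D])
        show "snd c x \<in> snd c ` fst c" using c(2) by blast
        fix u assume "u \<in> snd c ` fst c"
        then obtain y where y: "y \<in> fst c" "u = snd c y" by blast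
        show "b \<xi> (chart_deriv c f (chart_inv c u) w) = 0"
          unfolding y(2) chart_inv_left[OF c(1) y(1)] by (rule bL[OF \<xi> dV[OF c(1) y(1)]])
      qed
    qed
    have "first_normal_space A b (space_form_product k1 k2) f x \<subseteq> {\<eta>. b \<xi> \<eta> = 0}"
      unfolding first_normal_space_def
      by (rule span_minimal) (use sff in \<open>auto simp: subspace_def prod.lin_simps\<close>)
    then show "\<xi> \<in> first_normal_perp A b (space_form_product k1 k2) f x"
      using \<xi>N unfolding first_normal_perp_def by blast
  qed
  have "normal_subbundle A b (space_form_product k1 k2) f l (\<lambda>x. L)"
  proof -
    obtain e :: "nat \<Rightarrow> ('e1, 'e2) flat_product" where e: "L = span (e ` {..<l})"
      by (rule finite_frame[OF sL dL])
    have "smooth_map_on A UNIV (\<lambda>y. e i)" for i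
      by (simp add: smooth_map_on_iff Ck_on_const)
    then have "\<exists>W (e :: nat \<Rightarrow> 'a \<Rightarrow> ('e1, 'e2) flat_product). open W \<and> x \<in> W \<and>
        (\<forall>i<l. smooth_map_on A W (e i)) \<and> (\<forall>y\<in>W. L = span ((\<lambda>i. e i y) ` {..<l}))" for x
      using e by (intro exI[of _ UNIV] exI[of _ "\<lambda>i y. e i"]) simp
    then show ?thesis unfolding normal_subbundle_def using LN dL by blast
  qed
  moreover have "parallel_normal A b (space_form_product k1 k2) f (\<lambda>x. L)"
    unfolding parallel_normal_def
  proof (intro allI impI ballI)
    fix W \<xi> c x v
    assume W: "open W" "smooth_map_on A W \<xi>" "\<forall>y\<in>W. \<xi> y \<in> L" and c: "c \<in> A" and x: "x \<in> fst c \<inter> W"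
    have D: "((\<lambda>u. \<xi> (chart_inv c u)) has_derivative chart_deriv c \<xi> x) (at (snd c x))"
      by (rule chart_deriv[OF W(1,2) c]) (use x in auto)
    \<comment> \<open>The derivative of a section of a fixed subspace stays in it and, as that
      subspace is normal, is its own normal component.\<close>
    have "chart_deriv c \<xi> x v \<in> L"
    proof (rule has_derivative_in_subspace[OF sL open_chart_image[OF c W(1)] _ _ D])
      show "snd c x \<in> snd c ` (fst c \<inter> W)" using x by blast
      fix u assume "u \<in> snd c ` (fst c \<inter> W)"
      then obtain y where y: "y \<in> fst c" "y \<in> W" "u = snd c y" by blast
      show "\<xi> (chart_inv c u) \<in> L"
        unfolding y(3) chart_inv_left[OF c y(1)] using W(3) y(2) by blast
    qed
    moreover from this have "normal_deriv A b (space_form_product k1 k2) f c \<xi> x v = chart_deriv c \<xi> x v"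
      unfolding normal_deriv_def
      by (intro prod.orth_proj_eqI[OF subspace_N positive_N])
        (use LN in \<open>auto simp: prod.lin_simps\<close>)
    ultimately show "normal_deriv A b (space_form_product k1 k2) f c \<xi> x v \<in> L" by simp
  qed
  ultimately show ?thesis using ker perp by blast
qed

lemma reduces_codim_leftD:
  assumes "reduces_codim_left A g k1 k2 f l"
  shows "\<exists>L. normal_subbundle A b (space_form_product k1 k2) f l L \<and>
    parallel_normal A b (space_form_product k1 k2) f L \<and>
    (\<forall>x. L x \<subseteq> kernel_T A k1 k2 f x \<inter> first_normal_perp A b (space_form_product k1 k2) f x)"
proof -
  obtain B :: "'e1 set" and j fbar where B: "B \<subseteq> Basis" "card B + l = DIM('e1)"
    and emb: "isometric_embedding (flat_form k1) (hyperquadric k1 B) (flat_form k1) M1 j"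
    and tg: "totally_geodesic (hyperquadric k1 B) (flat_form k1) M1 j"
    and fbar: "isometric_immersion A g b (hyperquadric k1 B \<times> M2) fbar"
    and f: "f = map_prod j id \<circ> fbar"
    using assms unfolding reduces_codim_left_def by blast
  have G: "geodesic_inclusion k1 B j" by (rule geodesic_inclusion.intro[OF B(1) emb tg])
  interpret G: geodesic_inclusion k1 B j by (rule G)
  define p where "p x = fst (fbar x)" for x
  have sm: "smooth_map_on A UNIV p"
    using smooth_map_on_affine[OF open_UNIV _ bounded_linear_fst, of fbar 0] fbar
    unfolding isometric_immersion_def p_def[abs_def] by simp
  have p_in: "p x \<in> hyperquadric k1 B" for x
    using fbar unfolding isometric_immersion_def by (auto simp: p_def mem_Times_iff image_subset_iff)
  have f1: "fst (f x) = j (p x)" for x by (simp add: f p_def)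
  note osc = fst_df_in_osculating_constant[OF G sm p_in f1]
  \<comment> \<open>\<open>undefined\<close> stands for an arbitrary point of the manifold, the
    family being constant.\<close>
  define V where "V = G.osculating (p undefined)"
  have V: "G.osculating (p x) = V" for x unfolding V_def by (rule osc(2))
  show ?thesis
  proof (rule parallel_subbundle_of_perp)
    show "dim V + l = DIM('e1) + 1"
      using G.dim_osculating[OF p_in] B(2) by (simp add: V_def)
    show "subspace V" by (simp add: V_def G.osculating_def)
    show "normal_vec k1 (fst (f x)) \<in> V" for x
      unfolding V[of x, symmetric] G.osculating_def f1 by (rule span_base) blast
    show "fst (chart_deriv c f x v) \<in> V" if "c \<in> A" "x \<in> fst c" for c x v
      unfolding V[of x, symmetric] by (rule osc(1)[OF that])
  qed
qed

end

theorem theorem12: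
  fixes A :: "('a::{t2_space,second_countable_topology}, 'c::euclidean_space) chart set"
    and g :: "('a, 'c) metric"
    and k1 k2 :: real
    and f :: "'a \<Rightarrow> ('e1::euclidean_space, 'e2::euclidean_space) flat_product"
    and l :: nat
  assumes "riemannian_manifold A g"
    and "isometric_immersion A g (prod_form k1 k2) (space_form_product k1 k2) f"
  shows "reduces_codim_left A g k1 k2 f l \<longleftrightarrow>
    (\<exists>L. normal_subbundle A (prod_form k1 k2) (space_form_product k1 k2) f l L \<and>
         parallel_normal A (prod_form k1 k2) (space_form_product k1 k2) f L \<and>
         (\<forall>x. L x \<subseteq> kernel_T A k1 k2 f x \<inter>
            first_normal_perp A (prod_form k1 k2) (space_form_product k1 k2) f x))"
proof -
  interpret product_immersion A g k1 k2 f
    by unfold_locales (use assms in \<open>auto simp: riemannian_manifold_def\<close>)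
  show ?thesis using reduces_codim_leftI reduces_codim_leftD by blast
qed

end
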